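(* Let $A$ be a constant with $\frac12\cdot\frac1{4\pi}<A<\frac1{4\pi}$, let $n\ge1$ be an integer, and let $U_n(y)=y+\frac{A}{n}\sin(4n\pi y)$, $y\in[0,1]$. Let $(\alpha^0,c^0)$ be a point on the unstable eigenmode curve of the Rayleigh equation associated with $U_n$ which stems from the neutral mode $(\alpha_n,\tfrac12)$. Then for $\epsilon>0$ sufficiently small there exists an unstable eigenmode $(\alpha^0,c^* )$, with $\operatorname{Im}c^*>0$, of the Orr-Sommerfeld equation with $U=U_n$. Moreover $c^*\to c^0$ as $\epsilon\to0^+$.
   Context: For a shear profile $U(y)$ on $[0,1]$, wave number $\alpha>0$ and $\epsilon>0$ (the inverse Reynolds number), the Orr-Sommerfeld equation is $$\frac{\epsilon}{i\alpha}\left[\partial_y^2-\alpha^2\right]^2\phi+U''\phi-(U-c)\left[\partial_y^2-\alpha^2\right]\phi=0,\qquad \phi=\phi'=0\ \text{ at } y=0,1 .$$ The Rayleigh equation is $$U''\phi-(U-c)\left[\partial_y^2-\alpha^2\right]\phi=0,\qquad \phi(0)=\phi(1)=0 .$$ A pair $(\alpha,c)$ with $\alpha>0$, $c\in\mathbb{C}$ is an eigenmode of either equation if the corresponding boundary value problem has a nontrivial solution $\phi$; it is called unstable if $\operatorname{Im}c>0$ and neutral if $\operatorname{Im}c=0$. (The profile $U_n$ is treated as frozen in the Orr-Sommerfeld equation.) The number $\alpha_n>0$ is defined by: $-\alpha_n^2$ is the lowest (and negative) eigenvalue of the operator $L=-\frac{d^2}{dy^2}+Q(y)$ on $(0,1)$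 with Dirichlet boundary conditions, where $$Q(y)=\frac{U_n''(y)}{U_n(y)-\frac12};$$ $(\alpha_n,\frac12)$ is then a neutral eigenmode of the Rayleigh equation for $U_n$. An unstable eigenmode curve stemming from the neutral mode $(\alpha_n,\frac12)$ means: a continuous function $c(\alpha)$ defined on an interval of wave numbers having $\alpha_n$ as an end point, such that $(\alpha,c(\alpha))$ is an unstable eigenmode of the Rayleigh equation for each $\alpha$ in that interval and $c(\alpha)\to\frac12$ as $\alpha\to\alpha_n$. *)

theory Defs
  imports "HOL-Analysis.Analysis"
begin

(* Derivatives are taken within [0,1], i.e. one-sided at the end points; for y in [0,1]
   they depend only on the values of f on [0,1]. *)
definition D01 :: "(real \<Rightarrow> 'a::real_normed_vector) \<Rightarrow> real \<Rightarrow> 'a" where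
  "D01 f y = vector_derivative f (at y within {0..1})"

definition C_k_01 :: "nat \<Rightarrow> (real \<Rightarrow> 'a::real_normed_vector) \<Rightarrow> bool" where
  "C_k_01 k f \<longleftrightarrow> (\<forall>j<k. (D01 ^^ j) f differentiable_on {0..1}) \<and>
                   continuous_on {0..1} ((D01 ^^ k) f)"

definition helmholtz :: "real \<Rightarrow> (real \<Rightarrow> complex) \<Rightarrow> real \<Rightarrow> complex" where
  "helmholtz \<alpha> \<phi> y = D01 (D01 \<phi>) y - of_real (\<alpha>^2) * \<phi> y"

definition rayleigh_eigenmode :: "(real \<Rightarrow> real) \<Rightarrow> real \<Rightarrow> complex \<Rightarrow> bool" where
  "rayleigh_eigenmode U \<alpha> c \<longleftrightarrow> \<alpha> > 0 \<and>
     (\<exists>\<phi>. C_k_01 2 \<phi> \<and> (\<exists>y\<in>{0..1}. \<phi> y \<noteq> 0) \<and> \<phi> 0 = 0 \<and> \<phi> 1 = 0 \<and>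
       (\<forall>y\<in>{0..1}. of_real (D01 (D01 U) y) * \<phi> y
                     - (of_real (U y) - c) * helmholtz \<alpha> \<phi> y = 0))"

(* \<epsilon> is the inverse Reynolds number *)
definition orr_sommerfeld_eigenmode ::
    "real \<Rightarrow> (real \<Rightarrow> real) \<Rightarrow> real \<Rightarrow> complex \<Rightarrow> bool" where
  "orr_sommerfeld_eigenmode \<epsilon> U \<alpha> c \<longleftrightarrow> \<alpha> > 0 \<and>
     (\<exists>\<phi>. C_k_01 4 \<phi> \<and> (\<exists>y\<in>{0..1}. \<phi> y \<noteq> 0) \<and>
       \<phi> 0 = 0 \<and> \<phi> 1 = 0 \<and> D01 \<phi> 0 = 0 \<and> D01 \<phi> 1 = 0 \<and>
       (\<forall>y\<in>{0..1}. of_real \<epsilon> / (\<i> * of_real \<alpha>) * helmholtz \<alpha> (helmholtz \<alpha> \<phi>) y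
                     + of_real (D01 (D01 U) y) * \<phi> y
                     - (of_real (U y) - c) * helmholtz \<alpha> \<phi> y = 0))"

definition unstable_rayleigh_eigenmode :: "(real \<Rightarrow> real) \<Rightarrow> real \<Rightarrow> complex \<Rightarrow> bool" where
  "unstable_rayleigh_eigenmode U \<alpha> c \<longleftrightarrow> rayleigh_eigenmode U \<alpha> c \<and> Im c > 0"

definition unstable_orr_sommerfeld_eigenmode ::
    "real \<Rightarrow> (real \<Rightarrow> real) \<Rightarrow> real \<Rightarrow> complex \<Rightarrow> bool" where
  "unstable_orr_sommerfeld_eigenmode \<epsilon> U \<alpha> c \<longleftrightarrow>
     orr_sommerfeld_eigenmode \<epsilon> U \<alpha> c \<and> Im c > 0"

(* U'' / (U - c), continuously extended to the points where U = c
   (the plain quotient would be 0 there, because x / 0 = 0). *)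
definition rayleigh_potential :: "(real \<Rightarrow> real) \<Rightarrow> real \<Rightarrow> real \<Rightarrow> real" where
  "rayleigh_potential U c y =
     (if U y = c then Lim (at y within {0..1}) (\<lambda>z. D01 (D01 U) z / (U z - c))
      else D01 (D01 U) y / (U y - c))"

(* Eigenvalues of - d^2/dy^2 + Q on (0,1) with Dirichlet conditions. For continuous Q the operator
   is self-adjoint and its eigenfunctions are C^2, so real eigenvalues and real-valued classical
   eigenfunctions suffice. *)
definition dirichlet_eigenvalue :: "(real \<Rightarrow> real) \<Rightarrow> real \<Rightarrow> bool" where
  "dirichlet_eigenvalue Q \<mu> \<longleftrightarrow>
     (\<exists>\<phi>::real \<Rightarrow> real. C_k_01 2 \<phi> \<and> (\<exists>y\<in>{0..1}. \<phi> y \<noteq> 0) \<and> \<phi> 0 = 0 \<and> \<phi> 1 = 0 \<and>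
       (\<forall>y\<in>{0..1}. - D01 (D01 \<phi>) y + Q y * \<phi> y = \<mu> * \<phi> y))"

definition lowest_dirichlet_eigenvalue :: "(real \<Rightarrow> real) \<Rightarrow> real \<Rightarrow> bool" where
  "lowest_dirichlet_eigenvalue Q \<mu> \<longleftrightarrow>
     dirichlet_eigenvalue Q \<mu> \<and> (\<forall>\<nu>. dirichlet_eigenvalue Q \<nu> \<longrightarrow> \<mu> \<le> \<nu>)"

(* For an interval I with non-empty interior, the points of frontier I are exactly its finite
   end points. *)
definition unstable_curve_stemming_from ::
    "(real \<Rightarrow> real) \<Rightarrow> real \<Rightarrow> complex \<Rightarrow> real set \<Rightarrow> (real \<Rightarrow> complex) \<Rightarrow> bool" where
  "unstable_curve_stemming_from U \<alpha>s cs I c \<longleftrightarrow>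
     is_interval I \<and> interior I \<noteq> {} \<and> I \<subseteq> {0<..} \<and> \<alpha>s \<in> frontier I \<and>
     continuous_on I c \<and>
     (\<forall>\<alpha>\<in>I. unstable_rayleigh_eigenmode U \<alpha> (c \<alpha>)) \<and>
     (c \<longlongrightarrow> cs) (at \<alpha>s within I)"

definition shear_profile :: "real \<Rightarrow> nat \<Rightarrow> real \<Rightarrow> real" where
  "shear_profile A n y = y + A / real n * sin (4 * real n * pi * y)"

end

(*
  An unstable Rayleigh mode survives small viscosity for every C^2 profile. The number c0 is a zero
  of the analytic shooting function D0 of the Rayleigh problem on Im c > 0, and D0 does not vanish for
  large Im c, so on a small circle around c0 the Rayleigh problem is uniformly solvable. Since
  Im c > 0, the energy identity of the Orr-Sommerfeld equation bounds phi' and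
  sqrt epsilon (phi'' - alpha^2 phi) in L2 by phi and the source f; testing with w / (U - c), where
  w solves a Rayleigh problem, then bounds phi itself by f. The test function has to vanish to
  second order at the walls, which a corrector of small H1 norm achieves.

  Suppose that there is no Orr-Sommerfeld eigenvalue near c0. Then the solution phi_c with a fixed
  source f is analytic in c, and hence so is the viscous and corrector part F(c) of the weak
  equation tested against the Rayleigh mode of c0. It is small on the circle by the a priori bound,
  so it is small at c0 by Cauchy's inequality. But F(c0) is close to the integral of f psi with
  psi = w0 / (U - c0), which is not small for f = cnj psi.
*)
theory Submission
  imports Defs "HOL-Complex_Analysis.Complex_Analysis"
begin

section \<open>Derivatives and mean square norms on the unit interval\<close>

text \<open>The limit is singular: at \<epsilon> = 0 the order drops from four to two and the
  conditions on \<phi>' at the walls are lost, so the viscous solution is no regular perturbation of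
  a Rayleigh solution, and \<phi>'' - \<alpha>^2 \<phi> is controlled only up to a factor 1 / sqrt
  \<epsilon>. Duality avoids the construction of boundary layer solutions. The transpose of the
  Rayleigh operator U'' - (U - c) (D^2 - \<alpha>^2) sends w / (U - c) to - w'' + \<alpha>^2 w + U''
  w / (U - c), so a Rayleigh mode w yields an element of the kernel of the transpose, and only the
  test function has to be adapted to the walls. The constants are chosen in a fixed order: the
  distance to the real axis and the lower bound for D0 on the circle, then the size \<eta> of the
  corrector, then \<epsilon>. A small \<eta> makes the second derivative of the corrector large, but
  that derivative meets only the viscous term, which the energy identity makes of order sqrt
  \<epsilon>.\<close>

definition deriv01 :: "(real \<Rightarrow> 'a::real_normed_vector) \<Rightarrow> (real \<Rightarrow> 'a) \<Rightarrow> bool" where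
  "deriv01 f f' \<longleftrightarrow> (\<forall>y\<in>{0..1}. (f has_vector_derivative f' y) (at y within {0..1}))"

lemma deriv01_continuous: "deriv01 f f' \<Longrightarrow> continuous_on {0..1} f"
  unfolding deriv01_def continuous_on_eq_continuous_within
  using has_vector_derivative_continuous by blast

text \<open>The bridge to \<open>D01\<close>: one-sided derivatives within a nondegenerate interval
  are unique. The analysis carries explicit derivative functions along; iterates of
  \<open>D01\<close> occur only where the two eigenmode notions are translated.\<close>

lemma deriv01_D01: "deriv01 f f' \<Longrightarrow> y \<in> {0..1} \<Longrightarrow> D01 f y = f' y"
  unfolding deriv01_def D01_def
  using vector_derivative_within_cbox[of 0 1 y f "f' y"] by simp

lemma deriv01_cong:
  "deriv01 f f' \<Longrightarrow> (\<And>y. y \<in> {0..1} \<Longrightarrow> g y = f y) \<Longrightarrow> (\<And>y. y \<in> {0..1} \<Longrightarrow> g' y = f' y)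
    \<Longrightarrow> deriv01 g g'"
  unfolding deriv01_def by (auto intro: has_vector_derivative_transform)

lemma deriv01_D01I: "f differentiable_on {0..1} \<Longrightarrow> deriv01 f (D01 f)"
  unfolding deriv01_def D01_def differentiable_on_def
  using vector_derivative_works by blast

lemma deriv01_differentiable: "deriv01 f f' \<Longrightarrow> f differentiable_on {0..1}"
  unfolding deriv01_def differentiable_on_def
  using differentiableI_vector by blast

lemma deriv01_integral:
  fixes f :: "real \<Rightarrow> 'a::banach"
  assumes "deriv01 f f'"
  shows "(f' has_integral (f 1 - f 0)) {0..1}"
  using assms unfolding deriv01_def by (intro fundamental_theorem_of_calculus) auto

lemma deriv01_add: "deriv01 f f' \<Longrightarrow> deriv01 g g' \<Longrightarrow> deriv01 (\<lambda>y. f y + g y) (\<lambda>y. f' y + g' y)"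
  unfolding deriv01_def by (auto intro: has_vector_derivative_add)

lemma deriv01_diff: "deriv01 f f' \<Longrightarrow> deriv01 g g' \<Longrightarrow> deriv01 (\<lambda>y. f y - g y) (\<lambda>y. f' y - g' y)"
  unfolding deriv01_def by (auto intro: has_vector_derivative_diff)

lemma deriv01_cmult:
  fixes f :: "real \<Rightarrow> 'a::real_normed_algebra"
  shows "deriv01 f f' \<Longrightarrow> deriv01 (\<lambda>y. c * f y) (\<lambda>y. c * f' y)"
  unfolding deriv01_def by (auto intro: has_vector_derivative_mult_right)

lemma deriv01_mult:
  fixes f g :: "real \<Rightarrow> 'a::real_normed_algebra"
  shows "deriv01 f f' \<Longrightarrow> deriv01 g g' \<Longrightarrow> deriv01 (\<lambda>y. f y * g y) (\<lambda>y. f y * g' y + f' y * g y)"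
  unfolding deriv01_def by (auto intro: has_vector_derivative_mult)

lemma deriv01_cnj: "deriv01 f f' \<Longrightarrow> deriv01 (\<lambda>y. cnj (f y)) (\<lambda>y. cnj (f' y))"
  unfolding deriv01_def by (auto intro: has_vector_derivative_cnj)

lemma deriv01_of_real:
  "deriv01 f f' \<Longrightarrow> deriv01 (\<lambda>y. complex_of_real (f y)) (\<lambda>y. complex_of_real (f' y))"
  unfolding deriv01_def
  by (auto intro: bounded_linear.has_vector_derivative[OF bounded_linear_of_real])

lemma deriv01_const: "deriv01 (\<lambda>y. c) (\<lambda>y. 0)"
  unfolding deriv01_def by auto

lemma deriv01_inverse:
  fixes f :: "real \<Rightarrow> complex"
  assumes f: "deriv01 f f'" and nz: "\<And>y. y \<in> {0..1} \<Longrightarrow> f y \<noteq> 0"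
  shows "deriv01 (\<lambda>y. inverse (f y)) (\<lambda>y. - f' y / (f y)^2)"
  unfolding deriv01_def
proof
  fix y :: real assume y: "y \<in> {0..1}"
  have "(inverse has_field_derivative - (inverse (f y) ^ Suc (Suc 0))) (at (f y) within f ` {0..1})"
    by (rule DERIV_inverse) (use nz y in auto)
  then have "((inverse \<circ> f) has_vector_derivative f' y * - (inverse (f y) ^ Suc (Suc 0))) (at y within {0..1})"
    using f y unfolding deriv01_def by (intro field_vector_diff_chain_within) auto
  then show "((\<lambda>y. inverse (f y)) has_vector_derivative - f' y / (f y)^2) (at y within {0..1})"
    by (simp add: o_def power2_eq_square divide_simps mult_ac)
qed

section \<open>The mean square norm and the Cauchy-Schwarz inequality\<close>

definition L2 :: "(real \<Rightarrow> complex) \<Rightarrow> real" where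
  "L2 f = sqrt (integral {0..1} (\<lambda>y. (cmod (f y))^2))"

lemma integrable01: "continuous_on {0..1} f \<Longrightarrow> f integrable_on {0..1}"
  for f :: "real \<Rightarrow> 'a::banach"
  by (rule integrable_continuous_real)

lemma integral_nonneg01: "continuous_on {0..1} f \<Longrightarrow> (\<And>y. y \<in> {0..1} \<Longrightarrow> 0 \<le> f y) \<Longrightarrow> 0 \<le> integral {0..1} f"
  for f :: "real \<Rightarrow> real"
  by (intro integral_nonneg integrable01)

lemma L2_nonneg: "continuous_on {0..1} f \<Longrightarrow> 0 \<le> L2 f"
  unfolding L2_def by (intro real_sqrt_ge_zero integral_nonneg01) (auto intro!: continuous_intros)

lemma L2_square: "continuous_on {0..1} f \<Longrightarrow> (L2 f)^2 = integral {0..1} (\<lambda>y. (cmod (f y))^2)"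
  unfolding L2_def by (intro real_sqrt_pow2 integral_nonneg01) (auto intro!: continuous_intros)

lemma L2_cong: "(\<And>y. y \<in> {0..1} \<Longrightarrow> cmod (f y) = cmod (g y)) \<Longrightarrow> L2 f = L2 g"
  unfolding L2_def by (intro arg_cong[where f = sqrt] integral_cong) simp

text \<open>The best choice is s = b / a. If b = 0 or a = 0, letting s tend to 0 or to infinity,
  respectively, makes the right-hand side arbitrarily small. This gives Cauchy-Schwarz without
  division by a norm.\<close>

lemma sum_scaled_ge_imp_le_mult:
  fixes x a b :: real
  assumes "a \<ge> 0" "b \<ge> 0" and s: "\<And>s. s > 0 \<Longrightarrow> 2 * x \<le> s * a^2 + b^2 / s"
  shows "x \<le> a * b"
proof (cases "a = 0 \<or> b = 0")
  case False
  then have "2 * x \<le> (b/a) * a^2 + b^2 / (b/a)"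
    using assms by (intro s) auto
  then show ?thesis using False by (simp add: power2_eq_square field_simps)
next
  case True
  have "x \<le> e" if "e > 0" for e
  proof -
    have "2 * x \<le> (e / (a^2 + 1)) * a^2 + b^2 / (e / (a^2 + 1))" if "b = 0"
      using \<open>e > 0\<close> by (intro s) (auto intro!: divide_pos_pos add_nonneg_pos)
    moreover have "(e / (a^2 + 1)) * a^2 \<le> e"
      using \<open>e > 0\<close> by (simp add: divide_le_eq add_nonneg_pos)
    moreover have "2 * x \<le> ((b^2+1) / e) * a^2 + b^2 / ((b^2+1) / e)" if "a = 0"
      using \<open>e > 0\<close> by (intro s) (auto intro!: divide_pos_pos add_nonneg_pos)
    moreover have "b^2 / ((b^2+1) / e) \<le> e"
      using \<open>e > 0\<close> by (simp add: divide_le_eq add_nonneg_pos)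
    ultimately show ?thesis using True \<open>e > 0\<close> by auto
  qed
  then have "x \<le> 0" by (rule field_le_epsilon[of x 0, simplified])
  then show ?thesis using True by auto
qed

lemma L2_Cauchy_Schwarz_norm:
  assumes f: "continuous_on {0..1} f" and g: "continuous_on {0..1} g"
  shows "integral {0..1} (\<lambda>y. cmod (f y) * cmod (g y)) \<le> L2 f * L2 g"
proof (rule sum_scaled_ge_imp_le_mult)
  fix s :: real assume s: "s > 0"
  have "2 * (a * b) \<le> s * a^2 + b^2 / s" for a b :: real
  proof -
    have "0 \<le> (s * a - b)^2 / s" using s by simp
    also have "\<dots> = s * a^2 + b^2 / s - 2 * (a * b)"
      using s by (simp add: power2_eq_square field_simps)
    finally show ?thesis by simp
  qed
  then have "integral {0..1} (\<lambda>y. 2 * (cmod (f y) * cmod (g y)))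
      \<le> integral {0..1} (\<lambda>y. s * (cmod (f y))^2 + (cmod (g y))^2 / s)"
    using f g s by (intro integral_le integrable01) (auto intro!: continuous_intros)
  also have "\<dots> = integral {0..1} (\<lambda>y. s * (cmod (f y))^2) + integral {0..1} (\<lambda>y. (cmod (g y))^2 / s)"
    using f g s by (intro integral_add integrable01) (auto intro!: continuous_intros)
  finally show "2 * integral {0..1} (\<lambda>y. cmod (f y) * cmod (g y)) \<le> s * (L2 f)^2 + (L2 g)^2 / s"
    using f g by (simp add: L2_square)
qed (use f g L2_nonneg in auto)

lemma norm_integral_le01:
  fixes f :: "real \<Rightarrow> 'a::banach"
  assumes "continuous_on {0..1} f" "continuous_on {0..1} h" "\<And>y. y \<in> {0..1} \<Longrightarrow> norm (f y) \<le> h y"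
  shows "norm (integral {0..1} f) \<le> integral {0..1} h"
  using assms by (intro integral_norm_bound_integral integrable01) auto

lemma L2_Cauchy_Schwarz:
  assumes f: "continuous_on {0..1} f" and g: "continuous_on {0..1} g"
  shows "cmod (integral {0..1} (\<lambda>y. f y * g y)) \<le> L2 f * L2 g"
proof -
  have "cmod (integral {0..1} (\<lambda>y. f y * g y)) \<le> integral {0..1} (\<lambda>y. cmod (f y) * cmod (g y))"
    using f g by (intro norm_integral_le01) (auto intro!: continuous_intros simp: norm_mult)
  then show ?thesis using L2_Cauchy_Schwarz_norm[OF f g] by simp
qed

lemma L2_le:
  assumes f: "continuous_on {0..1} f" and K: "K \<ge> 0" "\<And>y. y \<in> {0..1} \<Longrightarrow> cmod (f y) \<le> K * h y"
    and h: "\<And>y. y \<in> {0..1} \<Longrightarrow> 0 \<le> h y" "continuous_on {0..1} h"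
  shows "L2 f \<le> K * sqrt (integral {0..1} (\<lambda>y. (h y)^2))"
proof -
  have "integral {0..1} (\<lambda>y. (cmod (f y))^2) \<le> integral {0..1} (\<lambda>y. K^2 * (h y)^2)"
  proof (intro integral_le integrable01)
    show "(cmod (f y))\<^sup>2 \<le> K\<^sup>2 * (h y)\<^sup>2" if "y \<in> {0..1}" for y
      using K(2)[OF that] by (metis norm_ge_zero power_mono power_mult_distrib)
  qed (use f h in \<open>auto intro!: continuous_intros\<close>)
  also have "\<dots> = K^2 * integral {0..1} (\<lambda>y. (h y)^2)" by simp
  finally show ?thesis unfolding L2_def using K(1)
    by (metis real_sqrt_abs abs_of_nonneg real_sqrt_le_mono real_sqrt_mult)
qed

lemma L2_le_L2:
  assumes f: "continuous_on {0..1} f" and K: "K \<ge> 0" "\<And>y. y \<in> {0..1} \<Longrightarrow> cmod (f y) \<le> K * cmod (h y)"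
    and h: "continuous_on {0..1} h"
  shows "L2 f \<le> K * L2 h"
  using L2_le[OF f K] h unfolding L2_def by (auto intro!: continuous_intros)

lemma L2_le_const:
  assumes f: "continuous_on {0..1} f" and K: "\<And>y. y \<in> {0..1} \<Longrightarrow> cmod (f y) \<le> K"
  shows "L2 f \<le> K"
proof -
  have "0 \<le> K" using K[of 0] by (simp add: order_trans[OF norm_ge_zero])
  then show ?thesis using L2_le[OF f, of K "\<lambda>_. 1"] K by auto
qed

lemma L2_cmult: "L2 (\<lambda>y. c * f y) = cmod c * L2 f"
  unfolding L2_def by (simp add: norm_mult power_mult_distrib real_sqrt_mult)

lemma L2_add:
  assumes f: "continuous_on {0..1} f" and g: "continuous_on {0..1} g"
  shows "L2 (\<lambda>y. f y + g y) \<le> L2 f + L2 g"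
proof -
  have c: "continuous_on {0..1} (\<lambda>y. f y + g y)" using f g by (intro continuous_intros)
  have "(L2 (\<lambda>y. f y + g y))^2 = integral {0..1} (\<lambda>y. (cmod (f y + g y))^2)"
    using c by (rule L2_square)
  also have "\<dots> \<le> integral {0..1} (\<lambda>y. (cmod (f y))^2 + 2 * (cmod (f y) * cmod (g y)) + (cmod (g y))^2)"
  proof (intro integral_le integrable01)
    show "(cmod (f y + g y))^2 \<le> (cmod (f y))^2 + 2 * (cmod (f y) * cmod (g y)) + (cmod (g y))^2" for y
    proof -
      have "(cmod (f y + g y))^2 \<le> (cmod (f y) + cmod (g y))^2"
        by (intro power_mono norm_triangle_ineq) auto
      then show ?thesis by (simp add: power2_sum)
    qed
  qed (use f g in \<open>auto intro!: continuous_intros\<close>)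
  also have "\<dots> = (L2 f)^2 + 2 * integral {0..1} (\<lambda>y. cmod (f y) * cmod (g y)) + (L2 g)^2"
    using f g by (subst integral_add, (intro integrable01 continuous_intros; simp)+)+
      (simp add: L2_square)
  also have "\<dots> \<le> (L2 f)^2 + 2 * (L2 f * L2 g) + (L2 g)^2"
    using L2_Cauchy_Schwarz_norm[OF f g] by simp
  also have "\<dots> = (L2 f + L2 g)^2" by (simp add: power2_sum)
  finally show ?thesis using L2_nonneg[OF f] L2_nonneg[OF g]
    by (meson add_nonneg_nonneg power2_le_imp_le)
qed

lemma L2_diff:
  assumes f: "continuous_on {0..1} f" and g: "continuous_on {0..1} g"
  shows "L2 (\<lambda>y. f y - g y) \<le> L2 f + L2 g"
  using L2_add[OF f, of "\<lambda>y. - g y"] g L2_cmult[of "-1" g] by (auto intro!: continuous_intros)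

lemma integral_norm_le_L2:
  assumes f: "continuous_on {0..1} f"
  shows "integral {0..1} (\<lambda>y. cmod (f y)) \<le> L2 f"
  using L2_Cauchy_Schwarz_norm[OF f, of "\<lambda>_. 1"] L2_le_const[of "\<lambda>_. 1" 1] L2_nonneg[OF f]
  by (auto intro: order_trans[OF _ mult_left_le])

lemma L2_eq_0:
  assumes f: "continuous_on {0..1} f" and "L2 f = 0" and y: "y \<in> {0..1}"
  shows "f y = 0"
proof -
  have c: "continuous_on {0..1} (\<lambda>y. (cmod (f y))^2)" using f by (intro continuous_intros)
  have "integral {0..1} (\<lambda>y. (cmod (f y))^2) = 0"
    using L2_square[OF f] assms(2) by simp
  then have "(cmod (f y))^2 = 0"
    using integral_eq_0_iff[OF c] y by simp
  then show ?thesis by simp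
qed

lemma bounded_continuous01:
  fixes f :: "real \<Rightarrow> 'a::real_normed_vector"
  assumes "continuous_on {0..1} f"
  obtains M where "M > 0" "\<And>y. y \<in> {0..1} \<Longrightarrow> norm (f y) \<le> M"
proof -
  have "bounded (f ` {0..1})"
    using assms by (intro compact_imp_bounded compact_continuous_image) auto
  then obtain M where "M > 0" "\<forall>x\<in>f ` {0..1}. norm x \<le> M" unfolding bounded_pos by blast
  then show ?thesis using that by blast
qed

section \<open>Initial value problems and boundary layer correctors\<close>

lemma has_integral_exp:
  fixes L :: real
  assumes "y \<ge> 0" "L \<noteq> 0"
  shows "((\<lambda>s. exp (L * s)) has_integral ((exp (L * y) - 1) / L)) {0..y}"
proof -
  have "((\<lambda>s. exp (L * s)) has_integral (exp (L * y) / L - exp (L * 0) / L)) {0..y}"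
    using assms
    by (intro fundamental_theorem_of_calculus)
      (auto intro!: derivative_eq_intros simp flip: has_real_derivative_iff_has_vector_derivative)
  then show ?thesis by (simp add: diff_divide_distrib)
qed

text \<open>In the weighted supremum norm with weight \<open>exp (- 2 K y)\<close> the Picard operator
  contracts by the factor \<open>1/2\<close>, so that one application of Banach's theorem yields the
  solution on the whole interval.\<close>

lemma ivp_exists:
  fixes G :: "real \<Rightarrow> 'a::banach \<Rightarrow> 'a"
  assumes cont: "continuous_on ({0..1} \<times> UNIV) (\<lambda>(y, x). G y x)" and "K > 0"
    and lip: "\<And>y x z. y \<in> {0..1} \<Longrightarrow> norm (G y x - G y z) \<le> K * norm (x - z)"
  shows "\<exists>x. x 0 = x0 \<and> deriv01 x (\<lambda>y. G y (x y))"
proof -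
  define L where "L = 2 * K"
  have L: "L > 0" using \<open>K > 0\<close> by (simp add: L_def)
  \<comment> \<open>\<open>bcontfun\<close> lives on the whole line; composing with the projection
    onto [0,1] extends \<open>S z\<close> to a bounded continuous function there.\<close>
  define cl :: "real \<Rightarrow> real" where "cl y = max 0 (min 1 y)" for y
  have cl: "cl y \<in> {0..1}" "y \<in> {0..1} \<Longrightarrow> cl y = y" for y by (auto simp: cl_def)
  \<comment> \<open>The unknown is z y = exp (- L y) x y. This rescaling moves the weight from the
    norm into the equation, so the plain supremum norm of \<open>bcontfun\<close> can be
    used.\<close>
  define g where "g z s = G s (exp (L * s) *\<^sub>R apply_bcontfun z s)" for z s
  define S where "S z y = exp (- (L * y)) *\<^sub>R (x0 + integral {0..y} (g z))" for z y
  have g_cont: "continuous_on {0..1} (g z)" for z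
  proof -
    have "continuous_on {0..1} (\<lambda>s. (\<lambda>(y, x). G y x) (s, exp (L * s) *\<^sub>R apply_bcontfun z s))"
      by (rule continuous_on_compose2[OF cont]) (auto intro!: continuous_intros)
    then show ?thesis by (simp add: g_def[abs_def])
  qed
  have S_cont: "continuous_on {0..1} (S z)" for z
    unfolding S_def
    by (intro continuous_intros indefinite_integral_continuous_1 integrable01 g_cont)
  have cl_cont: "continuous_on UNIV cl"
    unfolding cl_def by (intro continuous_intros)
  have "continuous_on UNIV (\<lambda>y. S z (cl y))" for z
    by (rule continuous_on_compose2[OF S_cont cl_cont]) (use cl in auto)
  moreover have "bounded (range (\<lambda>y. S z (cl y)))" for z
  proof (rule bounded_subset)
    show "bounded (S z ` {0..1})"
      by (intro compact_imp_bounded compact_continuous_image S_cont) auto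
  qed (use cl in auto)
  ultimately have bc: "(\<lambda>y. S z (cl y)) \<in> bcontfun" for z by (simp add: bcontfun_def)
  define T where "T z = Bcontfun (\<lambda>y. S z (cl y))" for z
  have T: "apply_bcontfun (T z) y = S z (cl y)" for z y
    unfolding T_def by (subst Bcontfun_inverse[OF bc]) simp
  have contr: "dist (T z) (T z') \<le> 1/2 * dist z z'" for z z'
  proof (rule dist_bound)
    fix y0 :: real
    define y where "y = cl y0"
    have y: "0 \<le> y" "y \<le> 1" using cl[of y0] by (auto simp: y_def)
    have sub: "continuous_on {0..y} (g z)" for z
      by (rule continuous_on_subset[OF g_cont]) (use y in auto)
    have "norm (integral {0..y} (g z) - integral {0..y} (g z'))
        = norm (integral {0..y} (\<lambda>s. g z s - g z' s))"
      by (subst integral_diff) (auto intro!: integrable_continuous_real sub)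
    also have "\<dots> \<le> integral {0..y} (\<lambda>s. K * dist z z' * exp (L * s))"
    proof (rule integral_norm_bound_integral)
      fix s assume s: "s \<in> {0..y}"
      have "norm (g z s - g z' s) \<le> K * norm (exp (L * s) *\<^sub>R (apply_bcontfun z s - apply_bcontfun z' s))"
        using lip[of s] s y by (simp add: g_def scaleR_diff_right)
      also have "\<dots> \<le> K * (exp (L * s) * dist z z')"
        using dist_bounded[of z s z'] \<open>K > 0\<close> by (simp add: dist_norm)
      finally show "norm (g z s - g z' s) \<le> K * dist z z' * exp (L * s)" by (simp add: mult_ac)
    qed (auto intro!: integrable_continuous_real sub continuous_intros)
    also have "\<dots> = K * dist z z' * ((exp (L * y) - 1) / L)"
      using has_integral_mult_right[OF has_integral_exp[of y L], of "K * dist z z'"] L y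
      by (intro integral_unique) auto
    also have "\<dots> = 1/2 * dist z z' * (exp (L * y) - 1)"
      using \<open>K > 0\<close> by (simp add: L_def)
    finally have *: "norm (integral {0..y} (g z) - integral {0..y} (g z')) \<le> 1/2 * dist z z' * exp (L * y)"
      by (smt (verit) mult_left_mono zero_le_dist divide_nonneg_nonneg mult_nonneg_nonneg)
    have "dist (T z y0) (T z' y0) = exp (- (L * y)) * norm (integral {0..y} (g z) - integral {0..y} (g z'))"
      unfolding T S_def y_def[symmetric] dist_norm
      by (simp flip: scaleR_diff_right)
    also have "\<dots> \<le> exp (- (L * y)) * (1/2 * dist z z' * exp (L * y))"
      using * by (intro mult_left_mono) auto
    also have "\<dots> = 1/2 * dist z z'" by (simp add: exp_minus field_simps)
    finally show "dist (T z y0) (T z' y0) \<le> 1/2 * dist z z'" .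
  qed
  obtain z where z: "T z = z"
    using banach_fix_type[of "1/2" T] contr by auto
  define x where "x y = exp (L * y) *\<^sub>R apply_bcontfun z y" for y
  have x: "x y = x0 + integral {0..y} (g z)" if "y \<in> {0..1}" for y
  proof -
    have "apply_bcontfun z y = S z y" using T[of z y] z cl that by simp
    then show ?thesis by (simp add: x_def S_def exp_minus)
  qed
  have "deriv01 x (\<lambda>y. G y (x y))"
  proof (rule deriv01_cong)
    show "deriv01 (\<lambda>y. x0 + integral {0..y} (g z)) (g z)"
      unfolding deriv01_def using integral_has_vector_derivative[OF g_cont]
      by (auto intro!: derivative_eq_intros)
  qed (use x in \<open>auto simp: g_def x_def\<close>)
  moreover have "x 0 = x0" using x[of 0] by simp
  ultimately show ?thesis by blast
qed

text \<open>A Gronwall estimate that never differentiates the norm. At the point p where exp (- 2 K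
  y) norm (x y) is largest, the integral of K norm (x s) is at most half of norm (x p) and can be
  absorbed, which costs the factor 2.\<close>

lemma ivp_bound:
  fixes x :: "real \<Rightarrow> 'a::banach"
  assumes x: "deriv01 x x'" "continuous_on {0..1} x'" and "K > 0"
    and x': "\<And>y. y \<in> {0..1} \<Longrightarrow> norm (x' y) \<le> K * norm (x y) + h y"
    and h: "continuous_on {0..1} h" "\<And>y. y \<in> {0..1} \<Longrightarrow> 0 \<le> h y" and y: "y \<in> {0..1}"
  shows "norm (x y) \<le> 2 * exp (2 * K) * (norm (x 0) + integral {0..1} h)"
proof -
  define L where "L = 2 * K"
  have L: "L > 0" using \<open>K > 0\<close> by (simp add: L_def)
  define w where "w y = exp (- (L * y)) * norm (x y)" for y
  have "continuous_on {0..1} w"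
    unfolding w_def using deriv01_continuous[OF x(1)] by (intro continuous_intros)
  then obtain p where p: "p \<in> {0..1}" and max: "\<And>y. y \<in> {0..1} \<Longrightarrow> w y \<le> w p"
    using continuous_attains_sup[of "{0..1}" w] by auto
  have le: "norm (x s) \<le> w p * exp (L * s)" if "s \<in> {0..1}" for s
    using max[OF that] by (simp add: w_def exp_minus field_simps)
  have sub: "continuous_on {0..p} f" if "continuous_on {0..1} f" for f :: "real \<Rightarrow> 'b::topological_space"
    using that p by (auto intro: continuous_on_subset)
  have absorb: "v * e \<le> 2 * (n + H)"
    if "d \<le> v / 2 * (e - 1) + H" "m = v * e" "m \<le> d + n" "0 \<le> v" for v e n H d m :: real
  proof -
    have "2 * d \<le> m - v + 2 * H" using that(1,2) by (simp add: field_simps)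
    then have "m \<le> 2 * (n + H)" using that(3,4) by argo
    then show ?thesis using that(2) by simp
  qed
  have "(x' has_integral (x p - x 0)) {0..p}"
    using x(1) p unfolding deriv01_def
    by (intro fundamental_theorem_of_calculus)
      (auto intro: has_vector_derivative_within_subset[where S = "{0..1}"])
  then have "norm (x p - x 0) = norm (integral {0..p} x')" by (simp add: integral_unique)
  also have "\<dots> \<le> integral {0..p} (\<lambda>s. K * w p * exp (L * s) + h s)"
  proof (rule integral_norm_bound_integral)
    fix s assume s: "s \<in> {0..p}"
    then have s1: "s \<in> {0..1}" using p by auto
    have "K * norm (x s) \<le> K * (w p * exp (L * s))"
      using le[OF s1] \<open>K > 0\<close> by (intro mult_left_mono) auto
    then show "norm (x' s) \<le> K * w p * exp (L * s) + h s"
      using x'[OF s1] by (simp add: mult_ac)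
  qed (auto intro!: integrable_continuous_real continuous_intros sub x h)
  also have "\<dots> = integral {0..p} (\<lambda>s. K * w p * exp (L * s)) + integral {0..p} h"
    by (intro integral_add integrable_continuous_real continuous_intros sub h)
  also have "integral {0..p} (\<lambda>s. K * w p * exp (L * s)) = K * w p * ((exp (L * p) - 1) / L)"
    using has_integral_mult_right[OF has_integral_exp[of p L], of "K * w p"] L p
    by (intro integral_unique) auto
  also have "\<dots> = w p / 2 * (exp (L * p) - 1)"
    using \<open>K > 0\<close> by (simp add: L_def)
  also have "integral {0..p} h \<le> integral {0..1} h"
    using p h by (intro integral_subset_le integrable_continuous_real sub) auto
  finally have "norm (x p - x 0) \<le> w p / 2 * (exp (L * p) - 1) + integral {0..1} h" by simp
  moreover have "norm (x p) = w p * exp (L * p)" by (simp add: w_def exp_minus)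
  moreover have "norm (x p) \<le> norm (x p - x 0) + norm (x 0)"
    using norm_triangle_ineq[of "x p - x 0" "x 0"] by simp
  moreover have wp: "w p \<ge> 0" by (simp add: w_def)
  moreover have "integral {0..1} h \<ge> 0" using h by (intro integral_nonneg01)
  ultimately have "w p * exp (L * p) \<le> 2 * (norm (x 0) + integral {0..1} h)"
    using absorb by metis
  moreover have "w p \<le> w p * exp (L * p)"
    using L p wp by (intro mult_le_cancel_left1[THEN iffD2]) auto
  ultimately have wp2: "w p \<le> 2 * (norm (x 0) + integral {0..1} h)" by linarith
  have "exp (L * y) \<le> exp (2 * K)"
    using y \<open>K > 0\<close> by (simp add: L_def mult_left_le)
  have "norm (x y) \<le> w p * exp (L * y)" by (rule le[OF y])
  also have "\<dots> \<le> (2 * (norm (x 0) + integral {0..1} h)) * exp (2 * K)"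
    using wp2 wp \<open>exp (L * y) \<le> exp (2 * K)\<close> by (intro mult_mono) auto
  finally show ?thesis by (simp add: algebra_simps)
qed

section \<open>Correctors with unit slope at one wall\<close>

lemma deriv01I: "(\<And>y. (f has_real_derivative f' y) (at y)) \<Longrightarrow> deriv01 f f'"
  unfolding deriv01_def
  by (auto simp flip: has_real_derivative_iff_has_vector_derivative intro: has_field_derivative_at_within)

text \<open>Bernoulli gives N y \<le> (1 + y)^N, and (1 + y) (1 - y) \<le> 1. This tames the factor
  N that differentiating a high power produces.\<close>

lemma mult_power_one_minus_le:
  fixes y :: real
  assumes "0 \<le> y" "y \<le> 1"
  shows "real N * y * (1 - y) ^ N \<le> 1"
proof -
  have "real N * y * (1 - y) ^ N \<le> (1 + y) ^ N * (1 - y) ^ N"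
    using Bernoulli_inequality[of y N] assms by (intro mult_right_mono) auto
  also have "\<dots> = ((1 + y) * (1 - y)) ^ N" by (simp add: power_mult_distrib)
  also have "\<dots> \<le> 1" using assms by (intro power_le_one) (auto simp: algebra_simps mult_le_one)
  finally show ?thesis .
qed

text \<open>The correctors are \<open>y (1 - y) ^ (2 N + 1)\<close> and its reflection: the slope at one wall stays
  1 while the \<open>H\<^sup>1\<close> norm tends to 0 as \<open>N\<close> grows.\<close>

lemma boundary_corrector_bound:
  fixes y :: real
  assumes y: "0 \<le> y" "y \<le> 1"
  shows "\<bar>y * (1 - y) ^ (2 * N + 1)\<bar> \<le> 3 * (1 - y) ^ N"
    and "\<bar>(1 - y) ^ (2 * N + 1) - real (2 * N + 1) * y * (1 - y) ^ (2 * N)\<bar> \<le> 3 * (1 - y) ^ N"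
proof -
  have a: "(1 - y) ^ (2 * N) \<le> (1 - y) ^ N" "(1 - y) ^ (2 * N + 1) \<le> (1 - y) ^ N"
    "0 \<le> (1 - y) ^ N" "0 \<le> (1 - y) ^ (2 * N)" "0 \<le> (1 - y) ^ (2 * N + 1)"
    by (rule power_decreasing zero_le_power; use y in simp)+
  have "\<bar>y * A\<bar> \<le> 3 * B" if "0 \<le> A" "A \<le> B" for A B :: real
    using mult_left_le_one_le[OF that(1) y] mult_nonneg_nonneg[OF y(1) that(1)] that by simp
  from this[OF a(5,2)] show "\<bar>y * (1 - y) ^ (2 * N + 1)\<bar> \<le> 3 * (1 - y) ^ N" .
  \<comment> \<open>The exponent 2 N is split in two: one half absorbs the factor N, the other
    remains as (1 - y)^N, whose L2 norm 1 / sqrt (2 N + 1) tends to 0.\<close>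
  have b: "real (2 * N + 1) * y * (1 - y) ^ (2 * N)
      = 2 * ((real N * y * (1 - y) ^ N) * (1 - y) ^ N) + y * (1 - y) ^ (2 * N)"
  proof -
    have e: "(1 - y) ^ (2 * N) = (1 - y) ^ N * (1 - y) ^ N" by (simp flip: power_add mult_2)
    show ?thesis unfolding e by (simp add: algebra_simps)
  qed
  have "(real N * y * (1 - y) ^ N) * (1 - y) ^ N \<le> 1 * (1 - y) ^ N"
    by (intro mult_right_mono mult_power_one_minus_le y a)
  moreover have "y * (1 - y) ^ (2 * N) \<le> (1 - y) ^ (2 * N)"
    using y a by (intro mult_left_le_one_le) auto
  ultimately have "real (2 * N + 1) * y * (1 - y) ^ (2 * N) \<le> 3 * (1 - y) ^ N"
    unfolding b using a by linarith
  moreover have "0 \<le> real (2 * N + 1) * y * (1 - y) ^ (2 * N)" using y a by auto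
  ultimately show "\<bar>(1 - y) ^ (2 * N + 1) - real (2 * N + 1) * y * (1 - y) ^ (2 * N)\<bar> \<le> 3 * (1 - y) ^ N"
    using a by linarith
qed

lemma deriv01_power:
  "deriv01 (\<lambda>y::real. y ^ n) (\<lambda>y. real n * y ^ (n - 1))"
  "deriv01 (\<lambda>y::real. (1 - y) ^ n) (\<lambda>y. - (real n * (1 - y) ^ (n - 1)))"
  by (intro deriv01I; auto intro!: derivative_eq_intros)+

lemma integral_power01:
  "integral {0..1} (\<lambda>y::real. (y ^ N)^2) = 1 / real (2 * N + 1)"
  "integral {0..1} (\<lambda>y::real. ((1 - y) ^ N)^2) = 1 / real (2 * N + 1)"
proof -
  have "((\<lambda>y::real. real (2 * N + 1) * (y ^ N)^2) has_integral 1) {0..1}"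
    using deriv01_integral[OF deriv01_power(1)[of "2 * N + 1"]]
    by (simp add: power_mult[symmetric] mult_ac)
  from has_integral_mult_right[OF this, of "1 / real (2 * N + 1)"]
  show "integral {0..1} (\<lambda>y::real. (y ^ N)^2) = 1 / real (2 * N + 1)"
    by (simp add: integral_unique del: of_nat_Suc of_nat_add of_nat_mult)
  have "((\<lambda>y::real. - (real (2 * N + 1) * ((1 - y) ^ N)^2)) has_integral -1) {0..1}"
    using deriv01_integral[OF deriv01_power(2)[of "2 * N + 1"]]
    by (simp add: power_mult[symmetric] mult_ac)
  from has_integral_mult_right[OF this, of "- 1 / real (2 * N + 1)"]
  show "integral {0..1} (\<lambda>y::real. ((1 - y) ^ N)^2) = 1 / real (2 * N + 1)"
    by (simp add: integral_unique del: of_nat_Suc of_nat_add of_nat_mult)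
qed

lemma boundary_correctors:
  fixes \<eta> :: real
  assumes "\<eta> > 0"
  obtains a a1 a2 b b1 b2 :: "real \<Rightarrow> complex" where
    "deriv01 a a1" "deriv01 a1 a2" "continuous_on {0..1} a2"
    "a 0 = 0" "a 1 = 0" "a1 0 = 1" "a1 1 = 0" "L2 a \<le> \<eta>" "L2 a1 \<le> \<eta>"
    "deriv01 b b1" "deriv01 b1 b2" "continuous_on {0..1} b2"
    "b 0 = 0" "b 1 = 0" "b1 0 = 0" "b1 1 = 1" "L2 b \<le> \<eta>" "L2 b1 \<le> \<eta>"
proof -
  obtain N0 :: nat where N0: "(3 / \<eta>)^2 < real N0" using reals_Archimedean2 by blast
  \<comment> \<open>\<open>Suc\<close> keeps the exponent 2 N positive: for N = 0 the value 0 ^ 0 =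
    1 would give the corrector a nonzero slope at the far wall.\<close>
  define N where "N = Suc N0"
  have N: "N \<ge> 1" "(3 / \<eta>)^2 < real (2 * N + 1)" using N0 by (auto simp: N_def)
  have small: "3 * sqrt (1 / real (2 * N + 1)) \<le> \<eta>"
  proof -
    have "3 / \<eta> \<le> sqrt (real (2 * N + 1))"
      using N(2) by (intro real_le_rsqrt) simp
    then show ?thesis using assms by (simp add: real_sqrt_divide field_simps)
  qed
  \<comment> \<open>The minus sign in \<open>q\<close> makes its slope at the right wall +1 instead
    of -1.\<close>
  define p p1 p2 q q1 q2 :: "real \<Rightarrow> real" where
    "p y = y * (1 - y) ^ (2 * N + 1)"
    and "p1 y = (1 - y) ^ (2 * N + 1) - real (2 * N + 1) * y * (1 - y) ^ (2 * N)"
    and "p2 y = - 2 * real (2 * N + 1) * (1 - y) ^ (2 * N)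
                + real (2 * N + 1) * y * (real (2 * N) * (1 - y) ^ (2 * N - 1))"
    and "q y = - (1 - y) * y ^ (2 * N + 1)"
    and "q1 y = y ^ (2 * N + 1) - real (2 * N + 1) * (1 - y) * y ^ (2 * N)"
    and "q2 y = 2 * real (2 * N + 1) * y ^ (2 * N)
                - real (2 * N + 1) * (1 - y) * (real (2 * N) * y ^ (2 * N - 1))" for y
  have id: "deriv01 (\<lambda>y::real. y) (\<lambda>y. 1)" "deriv01 (\<lambda>y::real. 1 - y) (\<lambda>y. -1)"
    by (intro deriv01I; auto intro!: derivative_eq_intros)+
  note d = deriv01_mult[OF id(1) deriv01_power(2)] deriv01_mult[OF id(2) deriv01_power(1)]
  have pd: "deriv01 p p1"
    by (rule deriv01_cong[OF d(1)[of "2 * N + 1"]]) (simp_all add: p_def p1_def algebra_simps)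
  have qd: "deriv01 q q1"
    by (rule deriv01_cong[OF deriv01_cmult[where c = "-1", OF d(2)[of "2 * N + 1"]]])
      (simp_all add: q_def q1_def algebra_simps)
  have pd1: "deriv01 p1 p2"
    by (rule deriv01_cong[OF deriv01_diff[OF deriv01_power(2)[of "2 * N + 1"]
           deriv01_cmult[where c = "real (2 * N + 1)", OF d(1)[of "2 * N"]]]])
      (simp_all add: p1_def p2_def algebra_simps)
  have qd1: "deriv01 q1 q2"
    by (rule deriv01_cong[OF deriv01_diff[OF deriv01_power(1)[of "2 * N + 1"]
           deriv01_cmult[where c = "real (2 * N + 1)", OF d(2)[of "2 * N"]]]])
      (simp_all add: q1_def q2_def algebra_simps)
  have cont: "continuous_on {0..1} p1" "continuous_on {0..1} p2"
     "continuous_on {0..1} q1" "continuous_on {0..1} q2" "continuous_on {0..1} p" "continuous_on {0..1} q"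
    unfolding p1_def p2_def q1_def q2_def p_def q_def by (intro continuous_intros)+
  have est: "L2 (\<lambda>y. of_real (f y)) \<le> \<eta>"
    if "continuous_on {0..1} f" "\<And>y. y \<in> {0..1} \<Longrightarrow> \<bar>f y\<bar> \<le> 3 * h y" "\<And>y. y \<in> {0..1} \<Longrightarrow> h y \<ge> 0"
      "continuous_on {0..1} h" "integral {0..1} (\<lambda>y. (h y)^2) = 1 / real (2 * N + 1)" for f h :: "real \<Rightarrow> real"
  proof -
    have "L2 (\<lambda>y. of_real (f y)) \<le> 3 * sqrt (integral {0..1} (\<lambda>y. (h y)^2))"
      using that by (intro L2_le) (auto intro!: continuous_intros)
    then show ?thesis using small that by simp
  qed
  have bounds: "\<bar>p y\<bar> \<le> 3 * (1 - y) ^ N" "\<bar>p1 y\<bar> \<le> 3 * (1 - y) ^ N"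
    "\<bar>q y\<bar> \<le> 3 * y ^ N" "\<bar>q1 y\<bar> \<le> 3 * y ^ N" if "y \<in> {0..1}" for y
    using boundary_corrector_bound[of y N] boundary_corrector_bound[of "1 - y" N] that
    by (auto simp: p_def p1_def q_def q1_def abs_mult)
  show thesis
  proof (rule that[of "\<lambda>y. of_real (p y)" "\<lambda>y. of_real (p1 y)" "\<lambda>y. of_real (p2 y)"
        "\<lambda>y. of_real (q y)" "\<lambda>y. of_real (q1 y)" "\<lambda>y. of_real (q2 y)"])
    show "deriv01 (\<lambda>y. complex_of_real (p y)) (\<lambda>y. of_real (p1 y))"
      "deriv01 (\<lambda>y. complex_of_real (p1 y)) (\<lambda>y. of_real (p2 y))"
      "deriv01 (\<lambda>y. complex_of_real (q y)) (\<lambda>y. of_real (q1 y))"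
      "deriv01 (\<lambda>y. complex_of_real (q1 y)) (\<lambda>y. of_real (q2 y))"
      by (intro deriv01_of_real pd pd1 qd qd1)+
    show "continuous_on {0..1} (\<lambda>y. complex_of_real (p2 y))"
      "continuous_on {0..1} (\<lambda>y. complex_of_real (q2 y))"
      by (intro continuous_on_of_real cont)+
    have c: "continuous_on {0..1} (\<lambda>y::real. (1 - y) ^ N)" "continuous_on {0..1} (\<lambda>y::real. y ^ N)"
      by (intro continuous_intros)+
    show "L2 (\<lambda>y. of_real (p y)) \<le> \<eta>"
      by (rule est[OF cont(5) bounds(1) _ c(1) integral_power01(2)]) auto
    show "L2 (\<lambda>y. of_real (p1 y)) \<le> \<eta>"
      by (rule est[OF cont(1) bounds(2) _ c(1) integral_power01(2)]) auto
    show "L2 (\<lambda>y. of_real (q y)) \<le> \<eta>"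
      by (rule est[OF cont(6) bounds(3) _ c(2) integral_power01(1)]) auto
    show "L2 (\<lambda>y. of_real (q1 y)) \<le> \<eta>"
      by (rule est[OF cont(3) bounds(4) _ c(2) integral_power01(1)]) auto
  qed (use N in \<open>simp_all add: p_def p1_def q_def q1_def\<close>)
qed

section \<open>Auxiliary facts on systems, parameter dependence and limits\<close>

lemma deriv01_fst: "deriv01 x x' \<Longrightarrow> deriv01 (\<lambda>y. fst (x y)) (\<lambda>y. fst (x' y))"
  unfolding deriv01_def
  by (auto intro: bounded_linear.has_vector_derivative[OF bounded_linear_fst])

lemma deriv01_snd: "deriv01 x x' \<Longrightarrow> deriv01 (\<lambda>y. snd (x y)) (\<lambda>y. snd (x' y))"
  unfolding deriv01_def
  by (auto intro: bounded_linear.has_vector_derivative[OF bounded_linear_snd])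

lemma deriv01_Pair: "deriv01 f f' \<Longrightarrow> deriv01 g g' \<Longrightarrow> deriv01 (\<lambda>y. (f y, g y)) (\<lambda>y. (f' y, g' y))"
  unfolding deriv01_def by (auto intro: has_vector_derivative_Pair)

text \<open>Dependence on the spectral parameter is shown by guessing the derivative from the
  formally differentiated equation and bounding the remainder to second order. Both
  \<open>D0\<close> and the functionals of the Orr-Sommerfeld solution are treated in this
  way.\<close>

lemma has_field_derivative_if_quadratic_remainder:
  fixes F :: "complex \<Rightarrow> complex"
  assumes "r > 0"
    and le: "\<And>z. cmod (z - a) < r \<Longrightarrow> cmod (F z - F a - (z - a) * d) \<le> C * (cmod (z - a))^2"
  shows "(F has_field_derivative d) (at a)"
proof -
  have "((\<lambda>z. (F z - F a) / (z - a) - d) \<longlongrightarrow> 0) (at a)"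
  proof (rule Lim_null_comparison)
    show "\<forall>\<^sub>F z in at a. norm ((F z - F a) / (z - a) - d) \<le> C * cmod (z - a)"
      unfolding eventually_at
    proof (intro exI conjI ballI impI)
      fix z assume z: "z \<noteq> a \<and> dist z a < r"
      have "(F z - F a) / (z - a) - d = (F z - F a - (z - a) * d) / (z - a)"
        using z by (simp add: field_simps)
      then have "norm ((F z - F a) / (z - a) - d) = norm (F z - F a - (z - a) * d) / norm (z - a)"
        by (simp add: norm_divide)
      also have "\<dots> \<le> C * (cmod (z - a))^2 / norm (z - a)"
        using le[of z] z by (intro divide_right_mono) (auto simp: dist_norm)
      finally show "norm ((F z - F a) / (z - a) - d) \<le> C * cmod (z - a)"
        using z by (simp add: power2_eq_square)
    qed fact
    have "((\<lambda>z. C * cmod (z - a)) \<longlongrightarrow> C * cmod (a - a)) (at a)"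
      by (intro tendsto_intros)
    then show "((\<lambda>z. C * cmod (z - a)) \<longlongrightarrow> 0) (at a)" by simp
  qed
  then show ?thesis by (simp add: has_field_derivative_iff LIM_zero_iff)
qed

text \<open>If t exceeded the bound, then t > X, hence X^2 + M t X \<le> (1 + M) X t < m t^2. The
  constant is not sharp, but it avoids the roots of the quadratic.\<close>

lemma le_if_square_le:
  fixes t X m M :: real
  assumes "m > 0" "M \<ge> 0" "X \<ge> 0" "t \<ge> 0" and le: "m * t^2 \<le> X^2 + M * t * X"
  shows "t \<le> (1 + M + m) / m * X"
proof (rule ccontr)
  assume "\<not> ?thesis"
  then have t: "t > (1 + M + m) / m * X" by simp
  moreover have "(1 + M + m) / m * X \<ge> X" using assms by (simp add: field_simps)
  ultimately have "t > X" by simp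
  then have "t > 0" using assms by simp
  have "(1 + M + m) * X < m * t" using t assms by (simp add: field_simps)
  then have "(1 + M + m) * X * t < m * t * t" using \<open>t > 0\<close> by simp
  moreover have "X * X \<le> X * t" using \<open>t > X\<close> assms by (intro mult_left_mono) auto
  moreover have "0 \<le> m * X * t" using assms by simp
  ultimately show False using le by (simp add: power2_eq_square algebra_simps)
qed

lemma finite_times_small:
  fixes K \<gamma> :: real
  assumes "K \<ge> 0" "\<gamma> > 0"
  shows "\<exists>\<epsilon>1>0. \<forall>\<epsilon>. 0 < \<epsilon> \<and> \<epsilon> < \<epsilon>1 \<longrightarrow> sqrt \<epsilon> * K \<le> \<gamma>"
proof (intro exI conjI allI impI)
  show "(\<gamma> / (K + 1))^2 > 0" using assms by simp
  fix \<epsilon> assume \<epsilon>: "0 < \<epsilon> \<and> \<epsilon> < (\<gamma> / (K + 1))^2"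
  then have "sqrt \<epsilon> \<le> \<gamma> / (K + 1)"
    using assms by (intro real_le_lsqrt) auto
  then have "sqrt \<epsilon> * (K + 1) \<le> \<gamma>" using assms by (simp add: field_simps)
  moreover have "sqrt \<epsilon> * K \<le> sqrt \<epsilon> * (K + 1)" using \<epsilon> by (intro mult_left_mono) auto
  ultimately show "sqrt \<epsilon> * K \<le> \<gamma>" by simp
qed

lemma deriv01_zero:
  fixes f :: "real \<Rightarrow> complex"
  assumes "deriv01 f f'" "\<And>y. y \<in> {0..1} \<Longrightarrow> f y = 0" "y \<in> {0..1}"
  shows "f' y = 0"
proof -
  have "deriv01 (\<lambda>_. 0::complex) f'" by (rule deriv01_cong[OF assms(1)]) (use assms(2) in auto)
  then show ?thesis using deriv01_D01[OF _ assms(3)] deriv01_const[of "0::complex"] by metis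
qed

lemma singular_2x2:
  fixes a b a1 b1 :: complex
  assumes "a * b1 - b * a1 = 0"
  shows "\<exists>x y. (x \<noteq> 0 \<or> y \<noteq> 0) \<and> x * a + y * b = 0 \<and> x * a1 + y * b1 = 0"
proof (cases "b1 = 0 \<and> a1 = 0")
  case False
  then show ?thesis using assms by (intro exI[of _ b1] exI[of _ "- a1"]) (auto simp: algebra_simps)
next
  case True
  show ?thesis
  proof (cases "a = 0 \<and> b = 0")
    case True
    then show ?thesis using \<open>b1 = 0 \<and> a1 = 0\<close> by (intro exI[of _ 1] exI[of _ 0]) auto
  next
    case False
    then show ?thesis using True by (intro exI[of _ b] exI[of _ "- a"]) auto
  qed
qed

lemma norm_quadruple:
  fixes x :: "complex \<times> complex \<times> complex \<times> complex"
  shows "cmod (fst x) \<le> norm x" "cmod (fst (snd x)) \<le> norm x" "cmod (fst (snd (snd x))) \<le> norm x"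
    "cmod (snd (snd (snd x))) \<le> norm x"
    "norm x \<le> cmod (fst x) + cmod (fst (snd x)) + cmod (fst (snd (snd x))) + cmod (snd (snd (snd x)))"
proof -
  obtain a b p s where x: "x = (a, b, p, s)" by (cases x) auto
  show "cmod (fst x) \<le> norm x" "cmod (fst (snd x)) \<le> norm x" "cmod (fst (snd (snd x))) \<le> norm x"
    "cmod (snd (snd (snd x))) \<le> norm x"
    unfolding x fst_conv snd_conv
    using norm_fst_le[of a "(b, p, s)"] norm_snd_le[of "(b, p, s)" a] norm_fst_le[of b "(p, s)"]
      norm_snd_le[of "(p, s)" b] norm_fst_le[of p s] norm_snd_le[of s p] by linarith+
  show "norm x \<le> cmod (fst x) + cmod (fst (snd x)) + cmod (fst (snd (snd x))) + cmod (snd (snd (snd x)))"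
    unfolding x fst_conv snd_conv
    using norm_Pair_le[of a "(b, p, s)"] norm_Pair_le[of b "(p, s)"] norm_Pair_le[of p s] by linarith
qed

text \<open>The assumption gives, for each radius, eigenvalues below a threshold that depends on the
  radius; the theorem asks for one function of \<epsilon>. It picks an eigenvalue whose distance
  from \<open>a\<close> is within \<epsilon> of the infimum: the infimum need not be attained, and
  the slack disappears in the limit.\<close>

lemma nearby_selection:
  fixes E :: "real \<Rightarrow> 'a::metric_space \<Rightarrow> bool"
  assumes near: "\<And>r. r > 0 \<Longrightarrow> \<exists>\<epsilon>1>0. \<forall>\<epsilon>. 0 < \<epsilon> \<and> \<epsilon> < \<epsilon>1 \<longrightarrow> (\<exists>c. dist c a < r \<and> E \<epsilon> c)"
  shows "\<exists>\<epsilon>0>0. \<exists>s. (\<forall>\<epsilon>. 0 < \<epsilon> \<and> \<epsilon> < \<epsilon>0 \<longrightarrow> E \<epsilon> (s \<epsilon>)) \<and> (s \<longlongrightarrow> a) (at_right 0)"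
proof -
  obtain \<epsilon>0 where \<epsilon>0: "\<epsilon>0 > 0" "\<And>\<epsilon>. 0 < \<epsilon> \<Longrightarrow> \<epsilon> < \<epsilon>0 \<Longrightarrow> \<exists>c. E \<epsilon> c"
    using near[OF zero_less_one] by blast
  define d where "d \<epsilon> = Inf {dist c a |c. E \<epsilon> c}" for \<epsilon>
  have bdd: "bdd_below {dist c a |c. E \<epsilon> c}" for \<epsilon> by (rule bdd_belowI[of _ 0]) auto
  have "\<exists>c. 0 < \<epsilon> \<and> \<epsilon> < \<epsilon>0 \<longrightarrow> E \<epsilon> c \<and> dist c a < d \<epsilon> + \<epsilon>" for \<epsilon>
  proof (cases "0 < \<epsilon> \<and> \<epsilon> < \<epsilon>0")
    case True
    then have "{dist c a |c. E \<epsilon> c} \<noteq> {}" using \<epsilon>0 by auto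
    moreover have "Inf {dist c a |c. E \<epsilon> c} < d \<epsilon> + \<epsilon>" using True by (simp add: d_def)
    ultimately have "\<exists>x\<in>{dist c a |c. E \<epsilon> c}. x < d \<epsilon> + \<epsilon>" using cInf_less_iff[OF _ bdd] by blast
    then show ?thesis by auto
  qed auto
  then obtain s where s: "\<And>\<epsilon>. 0 < \<epsilon> \<Longrightarrow> \<epsilon> < \<epsilon>0 \<Longrightarrow> E \<epsilon> (s \<epsilon>) \<and> dist (s \<epsilon>) a < d \<epsilon> + \<epsilon>" by metis
  have "(s \<longlongrightarrow> a) (at_right 0)"
  proof (rule tendstoI)
    fix e :: real assume e: "e > 0"
    obtain \<epsilon>1 where \<epsilon>1: "\<epsilon>1 > 0" "\<And>\<epsilon>. 0 < \<epsilon> \<Longrightarrow> \<epsilon> < \<epsilon>1 \<Longrightarrow> \<exists>c. dist c a < e / 2 \<and> E \<epsilon> c"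
      using near[OF half_gt_zero[OF e]] by blast
    define b where "b = min \<epsilon>0 (min \<epsilon>1 (e / 2))"
    have b: "b > 0" using \<epsilon>0 \<epsilon>1 e by (simp add: b_def)
    have "dist (s \<epsilon>) a < e" if "0 < \<epsilon>" "\<epsilon> < b" for \<epsilon>
    proof -
      have "\<epsilon> < \<epsilon>1" using that by (simp add: b_def)
      from \<epsilon>1(2)[OF \<open>0 < \<epsilon>\<close> this] obtain c where c: "dist c a < e / 2" "E \<epsilon> c" by blast
      have "d \<epsilon> \<le> dist c a" unfolding d_def by (rule cInf_lower[OF _ bdd]) (use c in auto)
      then show ?thesis using s[of \<epsilon>] c that by (auto simp: b_def)
    qed
    then show "\<forall>\<^sub>F x in at_right 0. dist (s x) a < e"
      using eventually_at_right_field b by fastforce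
  qed
  then show ?thesis using s \<epsilon>0 by blast
qed

lemma D01_congruent: "deriv01 f f' \<Longrightarrow> (\<And>y. y \<in> {0..1} \<Longrightarrow> g y = f y) \<Longrightarrow> y \<in> {0..1} \<Longrightarrow> D01 g y = f' y"
  using deriv01_D01[of g f' y] deriv01_cong[of f f' g f'] by blast

section \<open>Rayleigh equation in the upper half plane\<close>

locale shear_flow =
  fixes U U1 U2 :: "real \<Rightarrow> real" and \<alpha> :: real
  assumes \<alpha>: "\<alpha> > 0"
    and U: "deriv01 U U1" and U1: "deriv01 U1 U2" and U2: "continuous_on {0..1} U2"
begin

definition M :: real where
  "M = (SOME M. M > 0 \<and> (\<forall>y\<in>{0..1}. \<bar>U y\<bar> \<le> M \<and> \<bar>U1 y\<bar> \<le> M \<and> \<bar>U2 y\<bar> \<le> M))"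

lemma M: "M > 0" and U_le: "y \<in> {0..1} \<Longrightarrow> \<bar>U y\<bar> \<le> M"
  and U1_le: "y \<in> {0..1} \<Longrightarrow> \<bar>U1 y\<bar> \<le> M" and U2_le: "y \<in> {0..1} \<Longrightarrow> \<bar>U2 y\<bar> \<le> M"
proof -
  obtain M0 where M0: "M0 > 0" "\<And>y. y \<in> {0..1} \<Longrightarrow> norm (U y) \<le> M0"
    using bounded_continuous01[OF deriv01_continuous[OF U]] by metis
  obtain M1 where M1: "M1 > 0" "\<And>y. y \<in> {0..1} \<Longrightarrow> norm (U1 y) \<le> M1"
    using bounded_continuous01[OF deriv01_continuous[OF U1]] by metis
  obtain M2 where M2: "M2 > 0" "\<And>y. y \<in> {0..1} \<Longrightarrow> norm (U2 y) \<le> M2"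
    using bounded_continuous01[OF U2] by metis
  have "\<exists>M. M > 0 \<and> (\<forall>y\<in>{0..1}. \<bar>U y\<bar> \<le> M \<and> \<bar>U1 y\<bar> \<le> M \<and> \<bar>U2 y\<bar> \<le> M)"
    using M0 M1 M2 by (intro exI[of _ "M0 + M1 + M2"]) (fastforce intro: add_increasing add_increasing2)
  from someI_ex[OF this]
  have "M > 0 \<and> (\<forall>y\<in>{0..1}. \<bar>U y\<bar> \<le> M \<and> \<bar>U1 y\<bar> \<le> M \<and> \<bar>U2 y\<bar> \<le> M)" by (simp add: M_def)
  then show "M > 0" "y \<in> {0..1} \<Longrightarrow> \<bar>U y\<bar> \<le> M" "y \<in> {0..1} \<Longrightarrow> \<bar>U1 y\<bar> \<le> M" "y \<in> {0..1} \<Longrightarrow> \<bar>U2 y\<bar> \<le> M"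
    by auto
qed

lemma U_continuous: "continuous_on {0..1} U" "continuous_on {0..1} U1" "continuous_on {0..1} U2"
  using deriv01_continuous U U1 U2 by auto

text \<open>Division by U - c, which has no zero when Im c > 0, turns the Rayleigh equation into w''
  = q w.\<close>

definition q :: "complex \<Rightarrow> real \<Rightarrow> complex" where
  "q c y = of_real (\<alpha>^2) + of_real (U2 y) / (of_real (U y) - c)"

lemma U_minus_ge: "Im c \<le> cmod (of_real (U y) - c)"
  using abs_Im_le_cmod[of "of_real (U y) - c"] by auto

lemma U_minus_nz: "Im c > 0 \<Longrightarrow> of_real (U y) - c \<noteq> 0"
  by (auto simp: complex_eq_iff)

lemma inverse_U_minus_le: "0 < m \<Longrightarrow> m \<le> Im c \<Longrightarrow> cmod (inverse (of_real (U y) - c)) \<le> 1 / m"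
  using U_minus_ge[of c y] by (auto simp: norm_inverse norm_divide inverse_eq_divide intro!: divide_left_mono mult_pos_pos)

lemma q_continuous: "Im c > 0 \<Longrightarrow> continuous_on {0..1} (q c)"
  unfolding q_def by (intro continuous_intros U_continuous) (use U_minus_nz in auto)

text \<open>A Lipschitz constant for the first order system of w and w': Q m - 1 bounds
  \<open>q\<close> when m \<le> Im c, and the remaining 1 comes from the equation for w.\<close>

definition Q :: "real \<Rightarrow> real" where "Q m = 1 + \<alpha>^2 + M / m"

lemma Q: "m > 0 \<Longrightarrow> Q m \<ge> 1"
  using M by (simp add: Q_def)

lemma q_le:
  assumes "0 < m" "m \<le> Im c" and y: "y \<in> {0..1}"
  shows "cmod (q c y) \<le> Q m - 1"
proof -
  have "cmod (q c y) \<le> \<alpha>^2 + cmod (of_real (U2 y) * inverse (of_real (U y) - c))"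
    unfolding q_def using norm_triangle_ineq[of "complex_of_real (\<alpha>^2)"]
    by (metis divide_inverse norm_of_real abs_power2)
  also have "cmod (of_real (U2 y) * inverse (of_real (U y) - c)) \<le> M * (1 / m)"
    unfolding norm_mult using U2_le[OF y] inverse_U_minus_le[OF assms(1,2)] M
    by (intro mult_mono) auto
  finally show ?thesis by (simp add: Q_def)
qed

text \<open>The source is normalized by - w'' + q w = g. This is the transposed Rayleigh operator
  applied to w / (U - c), so g is what gets paired with \<phi> in the weak equation.\<close>

definition ray :: "complex \<Rightarrow> (real \<Rightarrow> complex) \<Rightarrow> (real \<Rightarrow> complex) \<Rightarrow> (real \<Rightarrow> complex) \<Rightarrow> bool" where
  "ray c g w w1 \<longleftrightarrow> deriv01 w w1 \<and> deriv01 w1 (\<lambda>y. q c y * w y - g y)"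

lemma ray_exists:
  assumes c: "Im c > 0" and g: "continuous_on {0..1} g"
  shows "\<exists>w w1. ray c g w w1 \<and> w 0 = a \<and> w1 0 = b"
proof -
  define G where "G y x = (snd x, q c y * fst x - g y)" for y and x :: "complex \<times> complex"
  have fst_snd: "cmod (fst x) \<le> norm x" "cmod (snd x) \<le> norm x" for x :: "complex \<times> complex"
    using norm_fst_le[of "fst x" "snd x"] norm_snd_le[of "snd x" "fst x"] by auto
  have "continuous_on ({0..1} \<times> UNIV) (\<lambda>(y, x). G y x)"
    unfolding G_def split_beta
    by (intro continuous_intros continuous_on_compose2[OF q_continuous[OF c]] continuous_on_compose2[OF g]) auto
  moreover have "norm (G y x - G y z) \<le> Q (Im c) * norm (x - z)" if y: "y \<in> {0..1}" for y x z
  proof -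
    have "norm (G y x - G y z) = norm (snd (x - z), q c y * fst (x - z))"
      by (simp add: G_def algebra_simps)
    also have "\<dots> \<le> norm (snd (x - z)) + norm (q c y * fst (x - z))" by (rule norm_Pair_le)
    also have "\<dots> \<le> norm (x - z) + (Q (Im c) - 1) * norm (x - z)"
      unfolding norm_mult using q_le[of "Im c" c, OF c _ y] Q[OF c]
      by (intro add_mono mult_mono fst_snd) auto
    finally show ?thesis by (simp add: algebra_simps)
  qed
  ultimately obtain x where x: "x 0 = (a, b)" "deriv01 x (\<lambda>y. G y (x y))"
    using ivp_exists[of G "Q (Im c)" "(a, b)"] Q[OF c] by auto
  have "ray c g (\<lambda>y. fst (x y)) (\<lambda>y. snd (x y))"
    unfolding ray_def using deriv01_fst[OF x(2)] deriv01_snd[OF x(2)] by (simp add: G_def)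
  then show ?thesis using x(1) by (intro exI[of _ "\<lambda>y. fst (x y)"] exI[of _ "\<lambda>y. snd (x y)"]) auto
qed

lemma ray_continuous:
  assumes "ray c g w w1"
  shows "continuous_on {0..1} w" "continuous_on {0..1} w1"
  using assms deriv01_continuous unfolding ray_def by auto

definition B :: "real \<Rightarrow> real" where "B m = 2 * exp (2 * Q m)"

lemma B: "B m > 0" by (simp add: B_def)

lemma ray_bound:
  assumes w: "ray c g w w1" and g: "continuous_on {0..1} g" and m: "0 < m" "m \<le> Im c" and y: "y \<in> {0..1}"
  shows "cmod (w y) \<le> B m * (cmod (w 0) + cmod (w1 0) + integral {0..1} (\<lambda>y. cmod (g y)))"
    and "cmod (w1 y) \<le> B m * (cmod (w 0) + cmod (w1 0) + integral {0..1} (\<lambda>y. cmod (g y)))"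
proof -
  have "norm (w y, w1 y) \<le> 2 * exp (2 * Q m) * (norm (w 0, w1 0) + integral {0..1} (\<lambda>y. cmod (g y)))"
  proof (rule ivp_bound[where x = "\<lambda>y. (w y, w1 y)" and x' = "\<lambda>y. (w1 y, q c y * w y - g y)"])
    show "deriv01 (\<lambda>y. (w y, w1 y)) (\<lambda>y. (w1 y, q c y * w y - g y))"
      using w unfolding ray_def by (intro deriv01_Pair) auto
    show "continuous_on {0..1} (\<lambda>y. (w1 y, q c y * w y - g y))"
      using q_continuous[of c] ray_continuous[OF w] g m by (intro continuous_intros) auto
    fix y :: real assume y: "y \<in> {0..1}"
    have "norm (w1 y, q c y * w y - g y) \<le> norm (w1 y) + norm (q c y * w y - g y)"
      by (rule norm_Pair_le)
    also have "\<dots> \<le> norm (w1 y) + (norm (q c y) * norm (w y) + norm (g y))"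
      using norm_triangle_ineq4[of "q c y * w y" "g y"] by (simp add: norm_mult)
    also have "\<dots> \<le> norm (w y, w1 y) + ((Q m - 1) * norm (w y, w1 y) + norm (g y))"
      using q_le[OF m y] Q[OF m(1)] norm_fst_le[of "w y" "w1 y"] norm_snd_le[where x = "w y" and y = "w1 y"]
      by (intro add_mono mult_mono) auto
    finally show "norm (w1 y, q c y * w y - g y) \<le> Q m * norm (w y, w1 y) + cmod (g y)"
      by (simp add: algebra_simps)
  qed (use g y Q[OF m(1)] in \<open>auto intro!: continuous_intros\<close>)
  also have "\<dots> \<le> B m * (cmod (w 0) + cmod (w1 0) + integral {0..1} (\<lambda>y. cmod (g y)))"
    unfolding B_def by (intro mult_left_mono add_right_mono norm_Pair_le) auto
  finally show "cmod (w y) \<le> B m * (cmod (w 0) + cmod (w1 0) + integral {0..1} (\<lambda>y. cmod (g y)))"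
    "cmod (w1 y) \<le> B m * (cmod (w 0) + cmod (w1 0) + integral {0..1} (\<lambda>y. cmod (g y)))"
    using norm_fst_le[of "w y" "w1 y"] norm_snd_le[where x = "w y" and y = "w1 y"] by auto
qed

lemma ray_lincomb:
  assumes "ray c g w w1" "ray c g' w' w1'"
  shows "ray c (\<lambda>y. g y + k * g' y) (\<lambda>y. w y + k * w' y) (\<lambda>y. w1 y + k * w1' y)"
proof -
  note a = assms[unfolded ray_def]
  have "deriv01 (\<lambda>y. w1 y + k * w1' y) (\<lambda>y. (q c y * w y - g y) + k * (q c y * w' y - g' y))"
    using a by (intro deriv01_add deriv01_cmult) auto
  then have "deriv01 (\<lambda>y. w1 y + k * w1' y) (\<lambda>y. q c y * (w y + k * w' y) - (g y + k * g' y))"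
    by (simp add: algebra_simps)
  then show ?thesis unfolding ray_def using a by (auto intro: deriv01_add deriv01_cmult)
qed

text \<open>The resolvent identity: a change of c becomes a source, so solutions for different c can
  be subtracted as solutions of problems with the same operator.\<close>

lemma ray_shift:
  assumes "ray c g w w1"
  shows "ray c' (\<lambda>y. g y + (q c' y - q c y) * w y) w w1"
proof -
  have "(\<lambda>y. q c y * w y - g y) = (\<lambda>y. q c' y * w y - (g y + (q c' y - q c y) * w y))"
    by (auto simp: algebra_simps)
  then show ?thesis using assms unfolding ray_def by simp
qed

section \<open>The shooting function and its zeros\<close>

definition ray_shoot :: "complex \<Rightarrow> (real \<Rightarrow> complex) \<times> (real \<Rightarrow> complex)" where
  "ray_shoot c = (SOME p. ray c (\<lambda>_. 0) (fst p) (snd p) \<and> fst p 0 = 0 \<and> snd p 0 = 1)"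

text \<open>The characteristic function of the Dirichlet problem: for Im c > 0 it vanishes exactly
  at the Rayleigh eigenvalues. As the shooting solution is picked by \<open>SOME\<close> separately
  for each c, regularity in c has to come from estimates valid for every solution.\<close>

definition D0 :: "complex \<Rightarrow> complex" where "D0 c = fst (ray_shoot c) 1"

lemma ray_shoot:
  assumes "Im c > 0"
  shows "ray c (\<lambda>_. 0) (fst (ray_shoot c)) (snd (ray_shoot c))"
    and "fst (ray_shoot c) 0 = 0" "snd (ray_shoot c) 0 = 1"
proof -
  have "\<exists>p. ray c (\<lambda>_. 0) (fst p) (snd p) \<and> fst p 0 = 0 \<and> snd p 0 = 1"
    using ray_exists[OF assms, of "\<lambda>_. 0" 0 1] by auto
  from someI_ex[OF this]
  show "ray c (\<lambda>_. 0) (fst (ray_shoot c)) (snd (ray_shoot c))"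
    and "fst (ray_shoot c) 0 = 0" "snd (ray_shoot c) 0 = 1" by (auto simp: ray_shoot_def)
qed

lemma ray_shoot_bound:
  assumes "0 < m" "m \<le> Im c" "y \<in> {0..1}"
  shows "cmod (fst (ray_shoot c) y) \<le> B m" "cmod (snd (ray_shoot c) y) \<le> B m"
  using ray_bound[OF ray_shoot(1) _ assms] ray_shoot(2,3)[of c] assms by auto

text \<open>By uniqueness a mode is \<open>w1 0\<close> times the shooting solution, and
  \<open>w1 0\<close> is nonzero because zero Cauchy data at the left wall force w = 0.\<close>

lemma ray_D0:
  assumes "Im c > 0" and w: "ray c (\<lambda>_. 0) w w1" and "w 0 = 0" "w 1 = 0" and nz: "\<exists>y\<in>{0..1}. w y \<noteq> 0"
  shows "D0 c = 0"
proof -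
  have zero: "w' y = 0" if "ray c (\<lambda>_. 0) w' w1'" "w' 0 = 0" "w1' 0 = 0" "y \<in> {0..1}" for w' w1' y
    using ray_bound(1)[OF that(1) _ \<open>Im c > 0\<close> _ that(4)] that by simp
  have "w1 0 \<noteq> 0" using zero[OF w \<open>w 0 = 0\<close>] nz by blast
  moreover have "w 1 + (- w1 0) * fst (ray_shoot c) 1 = 0"
    using zero[OF ray_lincomb[OF w ray_shoot(1)[OF \<open>Im c > 0\<close>], where k = "- w1 0", simplified], of 1]
      ray_shoot(2,3)[OF \<open>Im c > 0\<close>] assms by simp
  ultimately show ?thesis using \<open>w 1 = 0\<close> by (simp add: D0_def)
qed

lemma ray_diff_bound:
  assumes w: "ray c g w w1" and g: "continuous_on {0..1} g" "\<And>y. y \<in> {0..1} \<Longrightarrow> cmod (g y) \<le> S"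
    and "w 0 = 0" "w1 0 = 0" and m: "0 < m" "m \<le> Im c" and y: "y \<in> {0..1}"
  shows "cmod (w y) \<le> B m * S"
proof -
  have "cmod (w y) \<le> B m * integral {0..1} (\<lambda>y. cmod (g y))"
    using ray_bound(1)[OF w g(1) m y] assms by simp
  also have "\<dots> \<le> B m * integral {0..1} (\<lambda>y::real. S)"
    using g B by (intro mult_left_mono integral_le integrable01) (auto intro!: continuous_intros simp: less_imp_le)
  finally show ?thesis by simp
qed

lemma D0_holomorphic: "D0 holomorphic_on {c. Im c > 0}"
proof -
  have "\<exists>d. (D0 has_field_derivative d) (at a)" if a: "Im a > 0" for a
  proof -
    \<comment> \<open>The disc of radius m around a stays in Im z \<ge> m, so one set of constants
      serves for all z in it.\<close>
    define m where "m = Im a / 2"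
    have m: "0 < m" "m \<le> Im a" using a by (auto simp: m_def)
    define w where "w z = fst (ray_shoot z)" for z
    define w1 where "w1 z = snd (ray_shoot z)" for z
    \<comment> \<open>Differentiating - w'' + q w = 0 formally in c shows that the derivative of w
      solves the same problem with source - (dq/dc) w, where dq/dc = U'' / (U - c)^2. Its value at 1
      is the candidate for the derivative of \<open>D0\<close>.\<close>
    define s where "s y = - (of_real (U2 y) * (inverse (of_real (U y) - a))^2) * w a y" for y
    have wa: "ray a (\<lambda>_. 0) (w a) (w1 a)" "w a 0 = 0" "w1 a 0 = 1"
      using ray_shoot[OF a] by (auto simp: w_def w1_def)
    have s_cont: "continuous_on {0..1} s"
      unfolding s_def using ray_continuous[OF wa(1)] U_minus_nz[OF a]
      by (intro continuous_intros U_continuous) auto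
    obtain x x1 where x: "ray a s x x1" "x 0 = 0" "x1 0 = 0"
      using ray_exists[OF a s_cont] by metis
    define C where "C = B m * (M * (1/m) * (1/m) * (B m * (M * (1/m) * (1/m) * B m)) + M * (1/m)^2 * (1/m) * B m)"
    have "cmod (D0 z - D0 a - (z - a) * x 1) \<le> C * (cmod (z - a))^2" if z: "cmod (z - a) < m" for z
    proof -
      have "\<bar>Im (z - a)\<bar> < m" using abs_Im_le_cmod[of "z - a"] z by linarith
      then have z1: "m \<le> Im z" "0 < Im z" using a unfolding m_def minus_complex.sel by linarith+
      define h where "h = cmod (z - a)"
      define ra where "ra y = inverse (of_real (U y) - a)" for y
      define rz where "rz y = inverse (of_real (U y) - z)" for y
      have r: "cmod (ra y) \<le> 1/m" "cmod (rz y) \<le> 1/m" for y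
        using inverse_U_minus_le[OF m] inverse_U_minus_le[OF m(1) z1(1)] by (auto simp: ra_def rz_def)
      have qd: "q a y - q z y = - ((z - a) * of_real (U2 y) * ra y * rz y)" for y
        using U_minus_nz[OF a, of y] U_minus_nz[OF z1(2), of y]
        by (simp add: q_def ra_def rz_def divide_simps) (simp add: algebra_simps)
      have qd_le: "cmod (q a y - q z y) \<le> h * M * (1/m) * (1/m)" if "y \<in> {0..1}" for y
        unfolding qd norm_minus_cancel norm_mult h_def using r[of y] U2_le[OF that] M m
        by (intro mult_mono mult_nonneg_nonneg) auto
      have wz: "ray z (\<lambda>_. 0) (w z) (w1 z)" "w z 0 = 0" "w1 z 0 = 1"
        using ray_shoot[OF z1(2)] by (auto simp: w_def w1_def)
      have wb: "cmod (w a y) \<le> B m" "cmod (w z y) \<le> B m" if "y \<in> {0..1}" for y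
        using ray_shoot_bound(1)[OF m that] ray_shoot_bound(1)[OF m(1) z1(1) that] by (auto simp: w_def)
      note cont = ray_continuous(1)[OF wa(1)] ray_continuous(1)[OF wz(1)] q_continuous[OF a] q_continuous[OF z1(2)]
      have d: "ray a (\<lambda>y. (q a y - q z y) * w z y) (\<lambda>y. w z y - w a y) (\<lambda>y. w1 z y - w1 a y)"
        using ray_lincomb[OF ray_shift[OF wz(1), of a] wa(1), where k = "-1"] by simp
      have d_le: "cmod (w z y - w a y) \<le> B m * (h * M * (1/m) * (1/m) * B m)" if "y \<in> {0..1}" for y
      proof (rule ray_diff_bound[OF d _ _ _ _ m that])
        show "cmod ((q a y - q z y) * w z y) \<le> h * M * (1/m) * (1/m) * B m" if "y \<in> {0..1}" for y
          unfolding norm_mult using qd_le[OF that] wb[OF that] m M B[of m]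
          by (intro mult_mono) (auto simp: h_def)
      qed (use wa wz cont in \<open>auto intro!: continuous_intros\<close>)
      have f: "ray a (\<lambda>y. (q a y - q z y) * w z y + - (z - a) * s y) (\<lambda>y. (w z y - w a y) + - (z - a) * x y)
            (\<lambda>y. (w1 z y - w1 a y) + - (z - a) * x1 y)"
        by (rule ray_lincomb[OF d x(1)])
      have "cmod ((w z 1 - w a 1) + - (z - a) * x 1)
            \<le> B m * (h * M * (1/m) * (1/m) * (B m * (h * M * (1/m) * (1/m) * B m)) + h * h * M * (1/m)^2 * (1/m) * B m)"
      proof (rule ray_diff_bound[OF f _ _ _ _ m])
        fix y :: real assume y: "y \<in> {0..1}"
        have "- (z - a) * of_real (U2 y) * ra y * rz y + (z - a) * of_real (U2 y) * (ra y)^2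
              = - ((z - a) * (z - a) * of_real (U2 y) * (ra y)^2 * rz y)"
          using U_minus_nz[OF a, of y] U_minus_nz[OF z1(2), of y]
          by (simp add: ra_def rz_def power2_eq_square divide_simps) (simp add: algebra_simps)
        note id = this
        \<comment> \<open>With the linear part removed, both summands are of order h^2: the first is
          a product of two differences of order h, the second contains the Taylor remainder of q in
          c.\<close>
        have eq: "(q a y - q z y) * w z y + - (z - a) * s y
            = (q a y - q z y) * (w z y - w a y) + (- ((z - a) * (z - a) * of_real (U2 y) * (ra y)^2 * rz y)) * w a y"
          unfolding id[symmetric] unfolding qd s_def ra_def[symmetric] by (simp add: algebra_simps)
        have "cmod (\<dots>) \<le> cmod ((q a y - q z y) * (w z y - w a y))
            + cmod (- ((z - a) * (z - a) * of_real (U2 y) * (ra y)^2 * rz y) * w a y)"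
          by (rule norm_triangle_ineq)
        also have "cmod ((q a y - q z y) * (w z y - w a y)) \<le> h * M * (1/m) * (1/m) * (B m * (h * M * (1/m) * (1/m) * B m))"
          unfolding norm_mult using qd_le[OF y] d_le[OF y] m M by (intro mult_mono) (auto simp: h_def)
        also have "cmod (- ((z - a) * (z - a) * of_real (U2 y) * (ra y)^2 * rz y) * w a y)
            \<le> h * h * M * (1/m)^2 * (1/m) * B m"
          unfolding norm_minus_cancel norm_mult norm_power h_def[symmetric]
          using r[of y] U2_le[OF y] M m wb[OF y]
          by (intro mult_mono power_mono mult_nonneg_nonneg) (auto simp: h_def)
        finally show "cmod ((q a y - q z y) * w z y + - (z - a) * s y)
           \<le> h * M * (1/m) * (1/m) * (B m * (h * M * (1/m) * (1/m) * B m)) + h * h * M * (1/m)^2 * (1/m) * B m"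
          unfolding eq by simp
      qed (use wa wz x cont s_cont in \<open>auto intro!: continuous_intros\<close>)
      also have "\<dots> = C * h^2" by (simp add: C_def power2_eq_square algebra_simps)
      finally show ?thesis by (simp add: h_def D0_def w_def algebra_simps)
    qed
    then show ?thesis using has_field_derivative_if_quadratic_remainder[OF m(1)] by blast
  qed
  then show ?thesis
    unfolding holomorphic_on_def field_differentiable_def
    by (auto intro: has_field_derivative_at_within)
qed

text \<open>Multiplying by cnj w, integrating and taking real parts gives a vanishing integral of
  |w'|^2 + Re q |w|^2. For such c the integrand is nonnegative, hence zero, which contradicts w'(0)
  = 1. The lemma excludes that \<open>D0\<close> vanishes identically, so its zeros are
  isolated.\<close>

lemma D0_nonzero:
  assumes c: "Im c > M / \<alpha>^2"
  shows "D0 c \<noteq> 0"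
proof
  assume "D0 c = 0"
  have c0: "Im c > 0" using c M \<alpha> by (meson divide_pos_pos less_trans zero_less_power)
  define w where "w = fst (ray_shoot c)"
  define w1 where "w1 = snd (ray_shoot c)"
  have w: "ray c (\<lambda>_. 0) w w1" "w 0 = 0" "w1 0 = 1" "w 1 = 0"
    using ray_shoot[OF c0] \<open>D0 c = 0\<close> by (auto simp: w_def w1_def D0_def)
  note cont = ray_continuous[OF w(1)] q_continuous[OF c0]
  define F where "F y = (cmod (w1 y))^2 + Re (q c y) * (cmod (w y))^2" for y
  have "deriv01 (\<lambda>y. w1 y * cnj (w y)) (\<lambda>y. w1 y * cnj (w1 y) + (q c y * w y - 0) * cnj (w y))"
    using w(1) unfolding ray_def by (intro deriv01_mult deriv01_cnj) auto
  from deriv01_integral[OF this] have "((\<lambda>y. w1 y * cnj (w1 y) + q c y * w y * cnj (w y)) has_integral 0) {0..1}"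
    using w by simp
  from has_integral_linear[OF this bounded_linear_Re]
  have "(F has_integral 0) {0..1}"
    by (simp add: o_def F_def[abs_def] mult.assoc complex_mult_cnj cmod_power2)
  then have int: "integral {0..1} F = 0" by (rule integral_unique)
  have Fc: "continuous_on {0..1} F" unfolding F_def using cont by (intro continuous_intros)
  have "F y \<ge> 0" if y: "y \<in> {0..1}" for y
  proof -
    have "cmod (of_real (U2 y) * inverse (of_real (U y) - c)) \<le> M * (1 / Im c)"
      unfolding norm_mult using U2_le[OF y] inverse_U_minus_le[OF c0 order_refl] M
      by (intro mult_mono) auto
    also have "\<dots> \<le> \<alpha>^2" using c c0 \<alpha> by (simp add: field_simps)
    finally have "Re (q c y) \<ge> 0"
      using abs_Re_le_cmod[of "of_real (U2 y) * inverse (of_real (U y) - c)"]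
      by (simp add: q_def divide_inverse)
    then show ?thesis by (simp add: F_def)
  qed
  then have "F 0 = 0" using integral_eq_0_iff[OF Fc] int by auto
  then show False using w by (simp add: F_def)
qed

lemma D0_isolated:
  assumes c: "Im c > 0" "D0 c = 0"
  obtains r where "r > 0" "\<And>z. z \<in> ball c r \<Longrightarrow> Im z > 0" "\<And>z. z \<in> ball c r - {c} \<Longrightarrow> D0 z \<noteq> 0"
proof -
  have op: "open {c. 0 < Im c}" using open_halfspace_Im_gt[of 0] by simp
  have con: "connected {c. 0 < Im c}" by (intro convex_connected convex_halfspace_Im_gt)
  have "D0 (\<i> * of_real (M / \<alpha>^2 + 1)) \<noteq> 0" by (rule D0_nonzero) (simp flip: of_real_divide of_real_power)
  moreover have "\<i> * of_real (M / \<alpha>^2 + 1) \<in> {c. 0 < Im c}" using M \<alpha> by (simp add: add_pos_pos flip: of_real_divide of_real_power)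
  ultimately obtain r where "0 < r" "ball c r \<subseteq> {c. 0 < Im c}" "\<And>z. z \<in> ball c r - {c} \<Longrightarrow> D0 z \<noteq> 0"
    using isolated_zeros[OF D0_holomorphic op con _ c(2)] c(1) by blast
  then show ?thesis using that by blast
qed

text \<open>A particular solution with zero data at the left wall is corrected by a multiple of the
  shooting solution. Meeting the condition at the right wall requires division by
  \<open>D0 c\<close>, which is where \<kappa> enters the bound.\<close>

lemma ray_bvp:
  assumes m: "0 < m" "m \<le> Im c" and \<kappa>: "0 < \<kappa>" "\<kappa> \<le> cmod (D0 c)" and g: "continuous_on {0..1} g"
  shows "\<exists>w w1. ray c g w w1 \<and> w 0 = 0 \<and> w 1 = 0 \<and>
    (\<forall>y\<in>{0..1}. cmod (w y) \<le> (B m + B m * B m / \<kappa>) * integral {0..1} (\<lambda>y. cmod (g y)) \<and>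
                cmod (w1 y) \<le> (B m + B m * B m / \<kappa>) * integral {0..1} (\<lambda>y. cmod (g y)))"
proof -
  have c: "Im c > 0" using m by simp
  obtain x x1 where x: "ray c g x x1" "x 0 = 0" "x1 0 = 0" using ray_exists[OF c g] by metis
  define G where "G = integral {0..1} (\<lambda>y. cmod (g y))"
  have G: "G \<ge> 0" unfolding G_def using g by (intro integral_nonneg01 continuous_intros) auto
  have xb: "cmod (x y) \<le> B m * G" "cmod (x1 y) \<le> B m * G" if "y \<in> {0..1}" for y
    using ray_bound[OF x(1) g m that] x by (auto simp: G_def)
  define k where "k = - x 1 / D0 c"
  have k: "cmod k \<le> B m * G / \<kappa>"
    unfolding k_def using xb(1)[of 1] \<kappa> B[of m] G by (auto simp: norm_divide intro!: frac_le)
  define w where "w y = x y + k * fst (ray_shoot c) y" for y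
  define w1 where "w1 y = x1 y + k * snd (ray_shoot c) y" for y
  have "ray c g w w1"
    using ray_lincomb[OF x(1) ray_shoot(1)[OF c], where k = k] unfolding w_def w1_def by simp
  moreover have "w 0 = 0" using x ray_shoot(2)[OF c] by (simp add: w_def)
  moreover have "w 1 = 0" using \<kappa> by (auto simp: w_def k_def D0_def)
  moreover have "cmod (w y) \<le> (B m + B m * B m / \<kappa>) * G \<and> cmod (w1 y) \<le> (B m + B m * B m / \<kappa>) * G" if y: "y \<in> {0..1}" for y
  proof -
    have "cmod (x' + k * s) \<le> (B m + B m * B m / \<kappa>) * G" if "cmod x' \<le> B m * G" "cmod s \<le> B m" for x' s
    proof -
      have "cmod (x' + k * s) \<le> cmod x' + cmod k * cmod s"
        by (metis norm_triangle_ineq norm_mult)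
      also have "\<dots> \<le> B m * G + (B m * G / \<kappa>) * B m"
        using that k B[of m] G \<kappa> by (intro add_mono mult_mono) auto
      finally show ?thesis by (simp add: algebra_simps)
    qed
    then show ?thesis unfolding w_def w1_def using xb[OF y] ray_shoot_bound[OF m y] by blast
  qed
  ultimately show ?thesis unfolding G_def by blast
qed

section \<open>Weak form of the Orr-Sommerfeld equation\<close>

text \<open>The multiplier \<open>\<psi> = w / (U - c)\<close> turns the inviscid part of the equation into the
  Rayleigh operator acting on \<open>w\<close>; the corrector \<open>e\<close> makes \<open>v = \<psi> - e\<close> satisfy
  the no-slip conditions and is small in \<open>H\<^sup>1\<close>.\<close>

lemma test_functions:
  assumes m: "0 < m" and \<eta>: "0 < \<eta>"
  shows "\<exists>C\<ge>0. \<forall>c g w w1 S. m \<le> Im c \<longrightarrow> ray c g w w1 \<longrightarrow> continuous_on {0..1} g \<longrightarrow>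
    w 0 = 0 \<longrightarrow> w 1 = 0 \<longrightarrow> (\<forall>y\<in>{0..1}. cmod (w y) \<le> S \<and> cmod (w1 y) \<le> S) \<longrightarrow>
    (\<exists>v v1 v2 e e1. deriv01 v v1 \<and> deriv01 v1 v2 \<and> continuous_on {0..1} v2 \<and>
       v 0 = 0 \<and> v 1 = 0 \<and> v1 0 = 0 \<and> v1 1 = 0 \<and>
       deriv01 e e1 \<and> e 0 = 0 \<and> e 1 = 0 \<and> continuous_on {0..1} e1 \<and>
       (\<forall>y\<in>{0..1}. v y = w y * inverse (of_real (U y) - c) - e y) \<and>
       L2 (\<lambda>y. v2 y - of_real (\<alpha>^2) * v y) \<le> C * (S + L2 g) \<and> L2 e \<le> \<eta> * S \<and> L2 e1 \<le> \<eta> * S)"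
proof -
  define k where "k = 1 / m"
  have k: "k > 0" using m by (simp add: k_def)
  \<comment> \<open>Bounds |\<psi>'| in units of S, where \<psi> = w r with r = 1 / (U - c): |r|
    \<le> k and |r'| \<le> M k^2.\<close>
  define P where "P = M * k^2 + k"
  have P: "P > 0" using k M by (auto simp: P_def intro!: add_pos_pos mult_pos_pos)
  \<comment> \<open>There are two correctors, each multiplied by a wall slope of size at most S P;
    each may use half of \<eta> S.\<close>
  define \<eta>' where "\<eta>' = \<eta> / (2 * P)"
  have \<eta>': "\<eta>' > 0" "P * \<eta>' = \<eta> / 2" using \<eta> P by (auto simp: \<eta>'_def)
  \<comment> \<open>The correctors are fixed before c, g and w are known, so C depends only on m and
    \<eta>. Their possibly large second derivatives enter C through \<open>A\<close> and
    \<open>A'\<close>.\<close>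
  obtain a a1 a2 b b1 b2 where
    a: "deriv01 a a1" "deriv01 a1 a2" "continuous_on {0..1} a2"
      "a 0 = 0" "a 1 = 0" "a1 0 = 1" "a1 1 = 0" "L2 a \<le> \<eta>'" "L2 a1 \<le> \<eta>'" and
    b: "deriv01 b b1" "deriv01 b1 b2" "continuous_on {0..1} b2"
      "b 0 = 0" "b 1 = 0" "b1 0 = 0" "b1 1 = 1" "L2 b \<le> \<eta>'" "L2 b1 \<le> \<eta>'"
    by (rule boundary_correctors[OF \<eta>'(1)])
  have conts: "continuous_on {0..1} a" "continuous_on {0..1} a1" "continuous_on {0..1} b" "continuous_on {0..1} b1"
    using a b deriv01_continuous by auto
  define A where "A = L2 (\<lambda>y. a2 y - of_real (\<alpha>^2) * a y)"
  define A' where "A' = L2 (\<lambda>y. b2 y - of_real (\<alpha>^2) * b y)"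
  have A: "A \<ge> 0" "A' \<ge> 0" unfolding A_def A'_def
    by (intro L2_nonneg continuous_intros conts a b)+
  define C1 where "C1 = (2 * M^2 * k^3 + M * k^2) + 2 * (M * k^2) + Q m * k + \<alpha>^2 * k"
  define C where "C = C1 + k + P * (A + A')"
  have C1: "C1 \<ge> 0" using k M Q[OF m] by (auto simp: C1_def intro!: add_nonneg_nonneg mult_nonneg_nonneg)
  have C: "C \<ge> 0" using C1 k P A by (auto simp: C_def intro!: add_nonneg_nonneg mult_nonneg_nonneg)
  show ?thesis
  proof (intro exI[of _ C] conjI allI impI, fact C)
    fix c g w w1 S
    assume c: "m \<le> Im c" and w: "ray c g w w1" and g: "continuous_on {0..1} g"
      and w0: "w 0 = 0" "w 1 = 0" and S': "\<forall>y\<in>{0..1}. cmod (w y) \<le> S \<and> cmod (w1 y) \<le> S"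
    have S: "cmod (w y) \<le> S" "cmod (w1 y) \<le> S" if "y \<in> {0..1}" for y using S' that by auto
    have S0: "S \<ge> 0" using S(1)[of 0] norm_ge_zero[of "w 0"] by (simp del: norm_ge_zero)
    have c0: "Im c > 0" using c m by simp
    define u where "u y = complex_of_real (U y)" for y
    define u1 where "u1 y = complex_of_real (U1 y)" for y
    define u2 where "u2 y = complex_of_real (U2 y)" for y
    define r where "r y = inverse (u y - c)" for y
    define r1 where "r1 y = - (u1 y * (r y * r y))" for y
    define r2 where "r2 y = - (u1 y * (r y * r1 y + r1 y * r y) + u2 y * (r y * r y))" for y
    define w2 where "w2 y = q c y * w y - g y" for y
    have u: "deriv01 u u1" "deriv01 u1 u2" "continuous_on {0..1} u2"
      unfolding u_def[abs_def] u1_def[abs_def] u2_def[abs_def]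
      by (auto intro!: deriv01_of_real U U1 continuous_on_of_real U2)
    have r: "deriv01 r r1"
    proof (rule deriv01_cong[OF deriv01_inverse[of "\<lambda>y. u y - c" u1]])
      show "deriv01 (\<lambda>y. u y - c) u1" using deriv01_diff[OF u(1) deriv01_const[of c]] by simp
    qed (use U_minus_nz[OF c0] in \<open>auto simp: r_def r1_def u_def power2_eq_square divide_simps\<close>)
    have r1: "deriv01 r1 r2"
      by (rule deriv01_cong[OF deriv01_cmult[where c = "-1", OF deriv01_mult[OF u(2) deriv01_mult[OF r r]]]])
        (auto simp: r1_def r2_def)
    have w': "deriv01 w w1" "deriv01 w1 w2" using w unfolding ray_def w2_def by auto
    define \<psi> where "\<psi> y = w y * r y" for y
    define \<psi>1 where "\<psi>1 y = w y * r1 y + w1 y * r y" for y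
    define \<psi>2 where "\<psi>2 y = (w y * r2 y + w1 y * r1 y) + (w1 y * r1 y + w2 y * r y)" for y
    have \<psi>: "deriv01 \<psi> \<psi>1" "deriv01 \<psi>1 \<psi>2"
      unfolding \<psi>_def[abs_def] \<psi>1_def[abs_def] \<psi>2_def[abs_def]
      by (intro deriv01_add deriv01_mult w' r r1)+
    have w2c: "continuous_on {0..1} w2" unfolding w2_def
      using ray_continuous[OF w] q_continuous[OF c0] g by (intro continuous_intros)
    have r2c: "continuous_on {0..1} r2" unfolding r2_def
      using u(2,3) r r1 deriv01_continuous by (intro continuous_intros) auto
    note cont = deriv01_continuous[OF \<psi>(1)] deriv01_continuous[OF \<psi>(2)]
      deriv01_continuous[OF r] deriv01_continuous[OF r1] ray_continuous[OF w] w2c r2c g conts a(3) b(3)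
    have rb: "cmod (r y) \<le> k" for y using inverse_U_minus_le[OF m c] by (simp add: r_def u_def k_def)
    have r1b: "cmod (r1 y) \<le> M * k^2" if y: "y \<in> {0..1}" for y
      unfolding r1_def norm_minus_cancel norm_mult power2_eq_square
      using rb[of y] U1_le[OF y] k M by (intro mult_mono mult_nonneg_nonneg) (auto simp: u1_def)
    have r2b: "cmod (r2 y) \<le> 2 * M^2 * k^3 + M * k^2" if y: "y \<in> {0..1}" for y
    proof -
      have eq: "r2 y = 2 * (u1 y * (- r1 y * r y)) + (- u2 y) * (r y * r y)"
        by (simp add: r2_def algebra_simps)
      have "cmod (r2 y) \<le> cmod (2 * (u1 y * (- r1 y * r y))) + cmod ((- u2 y) * (r y * r y))"
        unfolding eq by (rule norm_triangle_ineq)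
      also have "cmod (2 * (u1 y * (- r1 y * r y))) \<le> 2 * (M * (M * k^2 * k))"
        unfolding norm_minus_cancel norm_mult
        using rb[of y] r1b[OF y] U1_le[OF y] k M by (intro mult_mono mult_nonneg_nonneg) (auto simp: u1_def)
      also have "cmod ((- u2 y) * (r y * r y)) \<le> M * (k * k)"
        unfolding norm_minus_cancel norm_mult
        using rb[of y] U2_le[OF y] k M by (intro mult_mono mult_nonneg_nonneg) (auto simp: u2_def)
      finally show ?thesis by (simp add: power2_eq_square power3_eq_cube mult_ac)
    qed
    have \<psi>1b: "cmod (\<psi>1 y) \<le> S * P" if y: "y \<in> {0..1}" for y
    proof -
      have "cmod (\<psi>1 y) \<le> cmod (w y * r1 y) + cmod (w1 y * r y)"
        unfolding \<psi>1_def by (rule norm_triangle_ineq)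
      also have "\<dots> \<le> S * (M * k^2) + S * k"
        unfolding norm_mult using S[OF y] rb[of y] r1b[OF y] S0 by (intro add_mono mult_mono) auto
      finally show ?thesis by (simp add: P_def algebra_simps)
    qed
    \<comment> \<open>After w'' = q w - g is inserted, X collects the terms of \<psi>'' - \<alpha>^2
      \<psi> that S bounds pointwise. The rest, - g r, is controlled in mean square only, hence the
      sum S + L2 g in the final bound.\<close>
    define X where "X y = w y * r2 y + 2 * (w1 y * r1 y) + q c y * w y * r y - of_real (\<alpha>^2) * (w y * r y)" for y
    have Xb: "cmod (X y) \<le> C1 * S" if y: "y \<in> {0..1}" for y
    proof -
      have "cmod (X y) \<le> cmod (w y * r2 y) + cmod (2 * (w1 y * r1 y)) + cmod (q c y * w y * r y) + cmod (of_real (\<alpha>^2) * (w y * r y))"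
        unfolding X_def by (meson norm_triangle_ineq norm_triangle_ineq4 order_trans add_right_mono)
      also have "cmod (w y * r2 y) \<le> S * (2 * M^2 * k^3 + M * k^2)"
        unfolding norm_mult using S[OF y] r2b[OF y] S0 by (intro mult_mono) auto
      also have "cmod (2 * (w1 y * r1 y)) \<le> 2 * (S * (M * k^2))"
        unfolding norm_mult using S[OF y] r1b[OF y] S0 by (intro mult_mono) auto
      also have "cmod (q c y * w y * r y) \<le> Q m * S * k"
        unfolding norm_mult using S[OF y] rb[of y] S0 q_le[OF m c y] Q[OF m]
        by (intro mult_mono mult_nonneg_nonneg) auto
      also have "cmod (of_real (\<alpha>^2) * (w y * r y)) \<le> \<alpha>^2 * (S * k)"
        unfolding norm_mult using S[OF y] rb[of y] S0 by (intro mult_mono mult_nonneg_nonneg) (auto simp: norm_power)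
      finally show ?thesis by (simp add: C1_def algebra_simps)
    qed
    have qc: "continuous_on {0..1} (q c)" by (rule q_continuous[OF c0])
    have Xc: "continuous_on {0..1} X" unfolding X_def using cont qc by (intro continuous_intros)
    have gr: "continuous_on {0..1} (\<lambda>y. g y * r y)" using cont by (intro continuous_intros)
    have "(\<lambda>y. \<psi>2 y - of_real (\<alpha>^2) * \<psi> y) = (\<lambda>y. X y - g y * r y)"
      by (auto simp: \<psi>2_def \<psi>_def X_def w2_def algebra_simps)
    moreover have "L2 (\<lambda>y. X y - g y * r y) \<le> L2 X + L2 (\<lambda>y. g y * r y)"
      by (rule L2_diff[OF Xc gr])
    moreover have "L2 X \<le> C1 * S" by (rule L2_le_const[OF Xc Xb])
    moreover have "L2 (\<lambda>y. g y * r y) \<le> k * L2 g"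
      using rb k by (intro L2_le_L2 gr g) (auto simp: norm_mult mult.commute[of k] intro!: mult_left_mono)
    ultimately have \<psi>L: "L2 (\<lambda>y. \<psi>2 y - of_real (\<alpha>^2) * \<psi> y) \<le> C1 * S + k * L2 g" by simp
    \<comment> \<open>Since w vanishes at the walls, so does \<psi>; only its two wall slopes have
      to be cancelled.\<close>
    define e where "e y = \<psi>1 0 * a y + \<psi>1 1 * b y" for y
    define e1 where "e1 y = \<psi>1 0 * a1 y + \<psi>1 1 * b1 y" for y
    define e2 where "e2 y = \<psi>1 0 * a2 y + \<psi>1 1 * b2 y" for y
    have e: "deriv01 e e1" "deriv01 e1 e2"
      unfolding e_def[abs_def] e1_def[abs_def] e2_def[abs_def]
      by (intro deriv01_add deriv01_cmult a b)+
    have lin: "L2 (\<lambda>y. \<psi>1 0 * p y + \<psi>1 1 * s y) \<le> S * P * (p' + s')"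
      if "continuous_on {0..1} p" "continuous_on {0..1} s" "L2 p \<le> p'" "L2 s \<le> s'" for p s p' s'
    proof -
      have "L2 (\<lambda>y. \<psi>1 0 * p y + \<psi>1 1 * s y) \<le> L2 (\<lambda>y. \<psi>1 0 * p y) + L2 (\<lambda>y. \<psi>1 1 * s y)"
        using that by (intro L2_add continuous_intros)
      also have "\<dots> \<le> S * P * p' + S * P * s'"
        unfolding L2_cmult using \<psi>1b[of 0] \<psi>1b[of 1] that S0 P L2_nonneg[of p] L2_nonneg[of s]
        by (intro add_mono mult_mono) auto
      finally show ?thesis by (simp add: algebra_simps)
    qed
    have sp: "S * P * (\<eta>' + \<eta>') = \<eta> * S" using \<eta>'(2) by (simp add: algebra_simps)
    have eL: "L2 e \<le> \<eta> * S" "L2 e1 \<le> \<eta> * S"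
      unfolding e_def[abs_def] e1_def[abs_def] using lin[of a b \<eta>' \<eta>', unfolded sp] lin[of a1 b1 \<eta>' \<eta>', unfolded sp] conts a b by auto
    have e2L: "L2 (\<lambda>y. e2 y - of_real (\<alpha>^2) * e y) \<le> S * P * (A + A')"
    proof -
      have eq: "(\<lambda>y. e2 y - of_real (\<alpha>^2) * e y)
         = (\<lambda>y. \<psi>1 0 * (a2 y - of_real (\<alpha>^2) * a y) + \<psi>1 1 * (b2 y - of_real (\<alpha>^2) * b y))"
        by (auto simp: e2_def e_def algebra_simps)
      show ?thesis unfolding eq
        by (rule lin) (auto simp: A_def A'_def intro!: continuous_intros conts a b)
    qed
    have e2c: "continuous_on {0..1} e2" unfolding e2_def using cont by (intro continuous_intros)
    have \<psi>2c: "continuous_on {0..1} \<psi>2" unfolding \<psi>2_def using cont by (intro continuous_intros)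
    have ec: "continuous_on {0..1} e" "continuous_on {0..1} e1" using e deriv01_continuous by auto
    define v where "v y = \<psi> y - e y" for y
    define v1 where "v1 y = \<psi>1 y - e1 y" for y
    define v2 where "v2 y = \<psi>2 y - e2 y" for y
    have vL: "L2 (\<lambda>y. v2 y - of_real (\<alpha>^2) * v y) \<le> C * (S + L2 g)"
    proof -
      have eq: "(\<lambda>y. v2 y - of_real (\<alpha>^2) * v y)
         = (\<lambda>y. (\<psi>2 y - of_real (\<alpha>^2) * \<psi> y) - (e2 y - of_real (\<alpha>^2) * e y))"
        by (auto simp: v2_def v_def algebra_simps)
      have "L2 (\<lambda>y. v2 y - of_real (\<alpha>^2) * v y)
          \<le> L2 (\<lambda>y. \<psi>2 y - of_real (\<alpha>^2) * \<psi> y) + L2 (\<lambda>y. e2 y - of_real (\<alpha>^2) * e y)"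
        unfolding eq using \<psi>2c e2c ec cont by (intro L2_diff continuous_intros)
      also have "\<dots> \<le> (C1 * S + k * L2 g) + S * P * (A + A')" using \<psi>L e2L by simp
      also have "\<dots> \<le> C * (S + L2 g)"
      proof -
        have "0 \<le> k * S" "0 \<le> C1 * L2 g" "0 \<le> P * (A + A') * L2 g"
          using k S0 C1 L2_nonneg[OF g] P A by auto
        then show ?thesis by (simp add: C_def algebra_simps)
      qed
      finally show ?thesis .
    qed
    have "deriv01 v v1" "deriv01 v1 v2"
      unfolding v_def[abs_def] v1_def[abs_def] v2_def[abs_def] by (intro deriv01_diff \<psi> e)+
    moreover have "continuous_on {0..1} v2" unfolding v2_def using \<psi>2c e2c by (intro continuous_intros)
    moreover have "v 0 = 0" "v 1 = 0" "v1 0 = 0" "v1 1 = 0"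
      using w0 a b by (auto simp: v_def v1_def e_def e1_def \<psi>_def)
    moreover have "e 0 = 0" "e 1 = 0" using a b by (auto simp: e_def)
    moreover have "\<forall>y\<in>{0..1}. v y = w y * inverse (of_real (U y) - c) - e y"
      by (auto simp: v_def \<psi>_def r_def u_def)
    ultimately show "\<exists>v v1 v2 e e1. deriv01 v v1 \<and> deriv01 v1 v2 \<and> continuous_on {0..1} v2 \<and>
       v 0 = 0 \<and> v 1 = 0 \<and> v1 0 = 0 \<and> v1 1 = 0 \<and>
       deriv01 e e1 \<and> e 0 = 0 \<and> e 1 = 0 \<and> continuous_on {0..1} e1 \<and>
       (\<forall>y\<in>{0..1}. v y = w y * inverse (of_real (U y) - c) - e y) \<and>
       L2 (\<lambda>y. v2 y - of_real (\<alpha>^2) * v y) \<le> C * (S + L2 g) \<and> L2 e \<le> \<eta> * S \<and> L2 e1 \<le> \<eta> * S"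
      using vL eL e ec by blast
  qed
qed

definition \<delta> :: "real \<Rightarrow> complex" where "\<delta> \<epsilon> = of_real \<epsilon> / (\<i> * of_real \<alpha>)"

lemma \<delta>: "\<delta> \<epsilon> = - \<i> * of_real (\<epsilon> / \<alpha>)" "cmod (\<delta> \<epsilon>) = \<bar>\<epsilon>\<bar> / \<alpha>" "\<epsilon> \<noteq> 0 \<Longrightarrow> \<delta> \<epsilon> \<noteq> 0"
  using \<alpha> by (auto simp: \<delta>_def field_simps norm_divide norm_mult)

text \<open>The Orr-Sommerfeld equation with right-hand side \<open>f\<close>, as a first order system for
  \<open>\<phi>\<close>, \<open>\<phi>'\<close>, \<open>\<omega> = \<phi>'' - \<alpha>\<^sup>2 \<phi>\<close> and \<open>\<omega>'\<close>.\<close>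

definition os :: "real \<Rightarrow> complex \<Rightarrow> (real \<Rightarrow> complex) \<Rightarrow> (real \<Rightarrow> complex) \<Rightarrow> (real \<Rightarrow> complex) \<Rightarrow>
    (real \<Rightarrow> complex) \<Rightarrow> (real \<Rightarrow> complex) \<Rightarrow> bool" where
  "os \<epsilon> c f \<phi> \<phi>1 \<omega> \<omega>1 \<longleftrightarrow> deriv01 \<phi> \<phi>1 \<and> deriv01 \<phi>1 (\<lambda>y. of_real (\<alpha>^2) * \<phi> y + \<omega> y) \<and> deriv01 \<omega> \<omega>1 \<and>
     deriv01 \<omega>1 (\<lambda>y. of_real (\<alpha>^2) * \<omega> y
        + (f y - of_real (U2 y) * \<phi> y + (of_real (U y) - c) * \<omega> y) / \<delta> \<epsilon>)"

definition no_slip :: "(real \<Rightarrow> complex) \<Rightarrow> (real \<Rightarrow> complex) \<Rightarrow> bool" where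
  "no_slip \<phi> \<phi>1 \<longleftrightarrow> \<phi> 0 = 0 \<and> \<phi> 1 = 0 \<and> \<phi>1 0 = 0 \<and> \<phi>1 1 = 0"

lemma os_continuous:
  assumes "os \<epsilon> c f \<phi> \<phi>1 \<omega> \<omega>1"
  shows "continuous_on {0..1} \<phi>" "continuous_on {0..1} \<phi>1" "continuous_on {0..1} \<omega>" "continuous_on {0..1} \<omega>1"
  using assms deriv01_continuous unfolding os_def by auto

text \<open>The inviscid operator on \<phi> paired with the corrector, after one integration by
  parts. The form contains \<phi> and \<phi>' but not \<omega>, because \<omega> has no bound
  uniform in \<epsilon> while the energy estimate controls \<phi>'.\<close>

definition bform :: "complex \<Rightarrow> (real \<Rightarrow> complex) \<Rightarrow> (real \<Rightarrow> complex) \<Rightarrow> (real \<Rightarrow> complex) \<Rightarrow> (real \<Rightarrow> complex) \<Rightarrow> complex" where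
  "bform c \<phi> \<phi>1 e e1 = integral {0..1} (\<lambda>y. of_real (U2 y) * \<phi> y * e y + of_real (U1 y) * \<phi>1 y * e y
      + of_real (\<alpha>^2) * (of_real (U y) - c) * \<phi> y * e y + (of_real (U y) - c) * \<phi>1 y * e1 y)"

text \<open>The equation is tested with v = \<psi> - e. The viscous part moves onto v, whose values
  and slopes vanish at the walls. Against \<psi> the inviscid part is Green's formula for \<phi> and
  w, because (U - c) \<psi> = w, and leaves the integral of \<phi> g. Against e it gives
  \<open>bform\<close>.\<close>

lemma weak_identity:
  assumes os: "os \<epsilon> c f \<phi> \<phi>1 \<omega> \<omega>1" and \<epsilon>: "\<epsilon> > 0" and f: "continuous_on {0..1} f" and \<phi>: "\<phi> 0 = 0" "\<phi> 1 = 0"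
    and ray: "ray c g w w1" and c: "Im c > 0" and g: "continuous_on {0..1} g" and w: "w 0 = 0" "w 1 = 0"
    and v: "deriv01 v v1" "deriv01 v1 v2" "continuous_on {0..1} v2" "v 0 = 0" "v 1 = 0" "v1 0 = 0" "v1 1 = 0"
    and e: "deriv01 e e1" "e 0 = 0" "e 1 = 0" "continuous_on {0..1} e1"
    and ve: "\<forall>y\<in>{0..1}. v y = w y * inverse (of_real (U y) - c) - e y"
  shows "integral {0..1} (\<lambda>y. \<phi> y * g y) = integral {0..1} (\<lambda>y. f y * v y)
     - \<delta> \<epsilon> * integral {0..1} (\<lambda>y. \<omega> y * (v2 y - of_real (\<alpha>^2) * v y)) + bform c \<phi> \<phi>1 e e1"
proof -
  define u where "u y = complex_of_real (U y)" for y
  define u1 where "u1 y = complex_of_real (U1 y)" for y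
  define u2 where "u2 y = complex_of_real (U2 y)" for y
  define A where "A = complex_of_real (\<alpha>^2)"
  have u: "deriv01 u u1" "deriv01 u1 u2" "continuous_on {0..1} u2"
    unfolding u_def[abs_def] u1_def[abs_def] u2_def[abs_def]
    by (auto intro!: deriv01_of_real U U1 continuous_on_of_real U2)
  have uc: "deriv01 (\<lambda>y. u y - c) u1" using deriv01_diff[OF u(1) deriv01_const[of c]] by simp
  define d where "d = \<delta> \<epsilon>"
  have d: "d \<noteq> 0" using \<delta>(3) \<epsilon> by (simp add: d_def)
  define \<omega>2 where "\<omega>2 y = A * \<omega> y + (f y - u2 y * \<phi> y + (u y - c) * \<omega> y) / d" for y
  have o: "deriv01 \<phi> \<phi>1" "deriv01 \<phi>1 (\<lambda>y. A * \<phi> y + \<omega> y)" "deriv01 \<omega> \<omega>1" "deriv01 \<omega>1 \<omega>2"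
    using os unfolding os_def \<omega>2_def A_def u_def u2_def d_def by auto
  have r: "deriv01 w w1" "deriv01 w1 (\<lambda>y. q c y * w y - g y)" using ray unfolding ray_def by auto
  \<comment> \<open>The three integrations by parts, as integrals of the derivatives of d (\<omega>'
    v - \<omega> v'), of \<phi>' w - \<phi> w' and of (U - c) \<phi>' e. All three primitives vanish
    at both walls.\<close>
  note i1 = deriv01_integral[OF deriv01_cmult[where c = d, OF deriv01_diff[OF deriv01_mult[OF o(4) v(1)] deriv01_mult[OF o(3) v(2)]]]]
  note i2 = deriv01_integral[OF deriv01_diff[OF deriv01_mult[OF o(2) r(1)] deriv01_mult[OF o(1) r(2)]]]
  note i3 = deriv01_integral[OF deriv01_mult[OF deriv01_mult[OF uc o(2)] e(1)]]
  note i = has_integral_add[OF has_integral_diff[OF i1 i2] i3]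
  define T1 where "T1 y = f y * v y" for y
  define T2 where "T2 y = \<omega> y * (v2 y - A * v y)" for y
  define T3 where "T3 y = \<phi> y * g y" for y
  define T4 where "T4 y = u2 y * \<phi> y * e y + u1 y * \<phi>1 y * e y + A * (u y - c) * \<phi> y * e y + (u y - c) * \<phi>1 y * e1 y" for y
  have "((\<lambda>y. T1 y - d * T2 y - T3 y + T4 y) has_integral 0) {0..1}"
  proof (rule has_integral_eq)
    show "((\<lambda>y. d * (\<omega>1 y * v1 y + \<omega>2 y * v y - (\<omega> y * v2 y + \<omega>1 y * v1 y)) -
          (\<phi>1 y * w1 y + (A * \<phi> y + \<omega> y) * w y - (\<phi> y * (q c y * w y - g y) + \<phi>1 y * w1 y)) +
          ((u y - c) * \<phi>1 y * e1 y + ((u y - c) * (A * \<phi> y + \<omega> y) + u1 y * \<phi>1 y) * e y)) has_integral 0) {0..1}"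
      using i \<phi> w v e by simp
    fix y :: real assume y: "y \<in> {0..1}"
    define \<psi> where "\<psi> = w y * inverse (u y - c)"
    have nz: "u y - c \<noteq> 0" using U_minus_nz[OF c] by (simp add: u_def)
    then have wy: "w y = (u y - c) * \<psi>" by (simp add: \<psi>_def)
    have vy: "v y = \<psi> - e y" using ve y by (simp add: \<psi>_def u_def)
    have qy: "q c y * w y = A * w y + u2 y * \<psi>" using nz unfolding q_def wy A_def u2_def u_def by (simp add: distrib_right)
    have oy: "d * \<omega>2 y = d * A * \<omega> y + (f y - u2 y * \<phi> y + (u y - c) * \<omega> y)"
      using d by (simp add: \<omega>2_def field_simps)
    have "d * (\<omega>1 y * v1 y + \<omega>2 y * v y - (\<omega> y * v2 y + \<omega>1 y * v1 y)) = (d * \<omega>2 y) * v y - d * \<omega> y * v2 y"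
      by (simp add: algebra_simps)
    also have "\<dots> = T1 y - d * T2 y - u2 y * \<phi> y * v y + (u y - c) * \<omega> y * v y"
      unfolding oy by (simp add: T1_def T2_def algebra_simps)
    finally have 1: "d * (\<omega>1 y * v1 y + \<omega>2 y * v y - (\<omega> y * v2 y + \<omega>1 y * v1 y)) = \<dots>" .
    have 2: "\<phi>1 y * w1 y + (A * \<phi> y + \<omega> y) * w y - (\<phi> y * (q c y * w y - g y) + \<phi>1 y * w1 y)
        = \<omega> y * w y - \<phi> y * u2 y * \<psi> + T3 y"
      unfolding qy by (simp add: T3_def algebra_simps)
    show "d * (\<omega>1 y * v1 y + \<omega>2 y * v y - (\<omega> y * v2 y + \<omega>1 y * v1 y)) -
          (\<phi>1 y * w1 y + (A * \<phi> y + \<omega> y) * w y - (\<phi> y * (q c y * w y - g y) + \<phi>1 y * w1 y)) +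
          ((u y - c) * \<phi>1 y * e1 y + ((u y - c) * (A * \<phi> y + \<omega> y) + u1 y * \<phi>1 y) * e y)
        = T1 y - d * T2 y - T3 y + T4 y"
      unfolding 1 2 unfolding vy wy by (simp add: T4_def algebra_simps)
  qed
  then have "integral {0..1} (\<lambda>y. T1 y - d * T2 y - T3 y + T4 y) = 0" by (rule integral_unique)
  moreover have "integral {0..1} (\<lambda>y. T1 y - d * T2 y - T3 y + T4 y)
     = integral {0..1} T1 - d * integral {0..1} T2 - integral {0..1} T3 + integral {0..1} T4"
  proof -
    have t: "T1 integrable_on {0..1}" "T2 integrable_on {0..1}" "T3 integrable_on {0..1}" "T4 integrable_on {0..1}"
      unfolding T1_def T2_def T3_def T4_def
      by (intro integrable01 continuous_intros os_continuous[OF os] f g v(3) e(4) u(3)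
          deriv01_continuous[OF v(1)] deriv01_continuous[OF e(1)] deriv01_continuous[OF u(1)] deriv01_continuous[OF u(2)])+
    note t = t[THEN integrable_integral]
    show ?thesis
      by (intro integral_unique has_integral_add has_integral_diff has_integral_mult_right t)
  qed
  ultimately have "integral {0..1} T3 = integral {0..1} T1 - d * integral {0..1} T2 + integral {0..1} T4"
    by (simp add: algebra_simps)
  then show ?thesis
    by (simp only: T1_def[abs_def] T2_def[abs_def] T3_def[abs_def] T4_def[abs_def] bform_def
        u_def u1_def u2_def A_def d_def)
qed

lemma bform_le:
  assumes \<phi>: "continuous_on {0..1} \<phi>" "continuous_on {0..1} \<phi>1" and e: "continuous_on {0..1} e" "continuous_on {0..1} e1"
    and c: "cmod c \<le> R"
  shows "cmod (bform c \<phi> \<phi>1 e e1) \<le> (2 * M + (M + R) * (\<alpha>^2 + 1)) * ((L2 \<phi> + L2 \<phi>1) * (L2 e + L2 e1))"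
proof -
  have R: "R \<ge> 0" using c norm_ge_zero[of c] by linarith
  have CS: "integral {0..1} (\<lambda>y. cmod (p y) * cmod (s y)) \<le> L2 p * L2 s"
    if "continuous_on {0..1} p" "continuous_on {0..1} s" for p s
    using L2_Cauchy_Schwarz_norm[OF that] .
  define K where "K = M + (M + R) * \<alpha>^2"
  have K: "K \<ge> 0" using M R by (simp add: K_def)
  have uc: "cmod (of_real (U y) - c) \<le> M + R" if "y \<in> {0..1}" for y
    using norm_triangle_ineq4[of "complex_of_real (U y)" c] U_le[OF that] c by simp
  have "cmod (bform c \<phi> \<phi>1 e e1) \<le> integral {0..1} (\<lambda>y. K * (cmod (\<phi> y) * cmod (e y))
      + (M * (cmod (\<phi>1 y) * cmod (e y)) + (M + R) * (cmod (\<phi>1 y) * cmod (e1 y))))"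
    unfolding bform_def
  proof (rule norm_integral_le01)
    fix y :: real assume y: "y \<in> {0..1}"
    have "cmod (of_real (U2 y) * \<phi> y * e y + of_real (U1 y) * \<phi>1 y * e y
      + of_real (\<alpha>^2) * (of_real (U y) - c) * \<phi> y * e y + (of_real (U y) - c) * \<phi>1 y * e1 y)
      \<le> cmod (of_real (U2 y) * \<phi> y * e y) + cmod (of_real (U1 y) * \<phi>1 y * e y)
      + cmod (of_real (\<alpha>^2) * (of_real (U y) - c) * \<phi> y * e y) + cmod ((of_real (U y) - c) * \<phi>1 y * e1 y)"
      by (meson norm_triangle_ineq order_trans add_right_mono)
    also have "\<dots> \<le> M * cmod (\<phi> y) * cmod (e y) + M * cmod (\<phi>1 y) * cmod (e y)
       + \<alpha>^2 * (M + R) * cmod (\<phi> y) * cmod (e y) + (M + R) * cmod (\<phi>1 y) * cmod (e1 y)"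
      unfolding norm_mult using U1_le[OF y] U2_le[OF y] uc[OF y] M R
      by (intro add_mono mult_mono mult_nonneg_nonneg) (auto simp: norm_power)
    finally show "cmod (of_real (U2 y) * \<phi> y * e y + of_real (U1 y) * \<phi>1 y * e y
      + of_real (\<alpha>^2) * (of_real (U y) - c) * \<phi> y * e y + (of_real (U y) - c) * \<phi>1 y * e1 y)
      \<le> K * (cmod (\<phi> y) * cmod (e y)) + (M * (cmod (\<phi>1 y) * cmod (e y)) + (M + R) * (cmod (\<phi>1 y) * cmod (e1 y)))"
      by (simp add: K_def algebra_simps)
  qed (intro continuous_intros \<phi> e U_continuous)+
  also have "\<dots> = K * integral {0..1} (\<lambda>y. cmod (\<phi> y) * cmod (e y)) + (M * integral {0..1} (\<lambda>y. cmod (\<phi>1 y) * cmod (e y))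
      + (M + R) * integral {0..1} (\<lambda>y. cmod (\<phi>1 y) * cmod (e1 y)))"
    by (subst integral_add, (intro integrable01 continuous_intros \<phi> e)+)+ simp
  also have "\<dots> \<le> K * (L2 \<phi> * L2 e) + (M * (L2 \<phi>1 * L2 e) + (M + R) * (L2 \<phi>1 * L2 e1))"
    using M R K by (intro add_mono mult_left_mono CS \<phi> e) auto
  also have "\<dots> \<le> (2 * M + (M + R) * (\<alpha>^2 + 1)) * (L2 \<phi> * L2 e) + ((2 * M + (M + R) * (\<alpha>^2 + 1)) * (L2 \<phi>1 * L2 e)
      + (2 * M + (M + R) * (\<alpha>^2 + 1)) * (L2 \<phi>1 * L2 e1))"
    using M R by (intro add_mono mult_right_mono mult_nonneg_nonneg L2_nonneg \<phi> e) (auto simp: K_def algebra_simps)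
  also have "\<dots> = (2 * M + (M + R) * (\<alpha>^2 + 1)) * (L2 \<phi> * L2 e + L2 \<phi>1 * L2 e + L2 \<phi>1 * L2 e1)"
    by (simp only: distrib_left add.assoc)
  also have "\<dots> \<le> (2 * M + (M + R) * (\<alpha>^2 + 1)) * ((L2 \<phi> + L2 \<phi>1) * (L2 e + L2 e1))"
    using M R mult_nonneg_nonneg[OF L2_nonneg[OF \<phi>(1)] L2_nonneg[OF e(2)]]
    by (intro mult_left_mono) (auto simp: algebra_simps)
  finally show ?thesis .
qed

section \<open>A priori estimate\<close>

text \<open>Test with cnj \<phi> and take imaginary parts. Since \<delta> \<epsilon> = - i
  \<epsilon> / \<alpha> and Im c > 0, the dissipation and the term Im c |\<phi>'|^2 come with the
  same sign. The term U'' |\<phi>|^2 is real and drops out, so the shear contributes only U' \<phi>'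
  cnj \<phi>.\<close>

lemma energy_estimate:
  assumes os: "os \<epsilon> c f \<phi> \<phi>1 \<omega> \<omega>1" and \<epsilon>: "\<epsilon> > 0" and f: "continuous_on {0..1} f" and ns: "no_slip \<phi> \<phi>1"
    and c: "Im c > 0"
  shows "\<epsilon> / \<alpha> * (L2 \<omega>)^2 + Im c * (L2 \<phi>1)^2 \<le> L2 f * L2 \<phi> + M * L2 \<phi>1 * L2 \<phi>"
proof -
  define u where "u y = complex_of_real (U y)" for y
  define u1 where "u1 y = complex_of_real (U1 y)" for y
  define u2 where "u2 y = complex_of_real (U2 y)" for y
  define A where "A = complex_of_real (\<alpha>^2)"
  have u: "deriv01 u u1" "deriv01 u1 u2" "continuous_on {0..1} u2"
    unfolding u_def[abs_def] u1_def[abs_def] u2_def[abs_def]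
    by (auto intro!: deriv01_of_real U U1 continuous_on_of_real U2)
  have uc: "deriv01 (\<lambda>y. u y - c) u1" using deriv01_diff[OF u(1) deriv01_const[of c]] by simp
  define d where "d = \<delta> \<epsilon>"
  have d: "d \<noteq> 0" using \<delta>(3) \<epsilon> by (simp add: d_def)
  define \<omega>2 where "\<omega>2 y = A * \<omega> y + (f y - u2 y * \<phi> y + (u y - c) * \<omega> y) / d" for y
  have o: "deriv01 \<phi> \<phi>1" "deriv01 \<phi>1 (\<lambda>y. A * \<phi> y + \<omega> y)" "deriv01 \<omega> \<omega>1" "deriv01 \<omega>1 \<omega>2"
    using os unfolding os_def \<omega>2_def A_def u_def u2_def d_def by auto
  note cn = deriv01_cnj[OF o(1)] deriv01_cnj[OF o(2)]
  note i1 = deriv01_integral[OF deriv01_cmult[where c = d, OF deriv01_diff[OF deriv01_mult[OF o(4) cn(1)] deriv01_mult[OF o(3) cn(2)]]]]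
  note i2 = deriv01_integral[OF deriv01_mult[OF deriv01_mult[OF uc o(2)] cn(1)]]
  note i = has_integral_diff[OF i1 i2]
  have "((\<lambda>y. f y * cnj (\<phi> y) - u1 y * \<phi>1 y * cnj (\<phi> y) - u2 y * (cmod (\<phi> y))^2 - d * (cmod (\<omega> y))^2
      - (u y - c) * (A * (cmod (\<phi> y))^2 + (cmod (\<phi>1 y))^2)) has_integral 0) {0..1}"
  proof (rule has_integral_eq)
    show "((\<lambda>y. d * (\<omega>1 y * cnj (\<phi>1 y) + \<omega>2 y * cnj (\<phi> y) - (\<omega> y * cnj (A * \<phi> y + \<omega> y) + \<omega>1 y * cnj (\<phi>1 y))) -
          ((u y - c) * \<phi>1 y * cnj (\<phi>1 y) + ((u y - c) * (A * \<phi> y + \<omega> y) + u1 y * \<phi>1 y) * cnj (\<phi> y))) has_integral 0) {0..1}"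
      using i ns by (simp add: no_slip_def)
    fix y :: real assume y: "y \<in> {0..1}"
    have sq: "complex_of_real ((cmod z)^2) = z * cnj z" for z by (metis complex_norm_square of_real_power)
    have cA: "cnj A = A" by (simp add: A_def)
    have oy: "d * \<omega>2 y = d * A * \<omega> y + (f y - u2 y * \<phi> y + (u y - c) * \<omega> y)"
      using d by (simp add: \<omega>2_def field_simps)
    have "d * (\<omega>1 y * cnj (\<phi>1 y) + \<omega>2 y * cnj (\<phi> y) - (\<omega> y * cnj (A * \<phi> y + \<omega> y) + \<omega>1 y * cnj (\<phi>1 y)))
       = (d * \<omega>2 y) * cnj (\<phi> y) - d * \<omega> y * (A * cnj (\<phi> y) + cnj (\<omega> y))"
      by (simp add: algebra_simps cA)
    then show "d * (\<omega>1 y * cnj (\<phi>1 y) + \<omega>2 y * cnj (\<phi> y) - (\<omega> y * cnj (A * \<phi> y + \<omega> y) + \<omega>1 y * cnj (\<phi>1 y))) -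
          ((u y - c) * \<phi>1 y * cnj (\<phi>1 y) + ((u y - c) * (A * \<phi> y + \<omega> y) + u1 y * \<phi>1 y) * cnj (\<phi> y))
        = f y * cnj (\<phi> y) - u1 y * \<phi>1 y * cnj (\<phi> y) - u2 y * (cmod (\<phi> y))^2 - d * (cmod (\<omega> y))^2
      - (u y - c) * (A * (cmod (\<phi> y))^2 + (cmod (\<phi>1 y))^2)"
      unfolding oy of_real_power[symmetric] sq by (simp add: algebra_simps)
  qed
  note h = has_integral_linear[OF this bounded_linear_Im]
  define E where "E y = Im (f y * cnj (\<phi> y)) - Im (u1 y * \<phi>1 y * cnj (\<phi> y)) + \<epsilon> / \<alpha> * (cmod (\<omega> y))^2
      + Im c * (\<alpha>^2 * (cmod (\<phi> y))^2 + (cmod (\<phi>1 y))^2)" for y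
  have E0: "(E has_integral 0) {0..1}"
    by (rule has_integral_eq[OF _ h[unfolded zero_complex.sel]])
      (simp add: E_def o_def u_def u1_def u2_def A_def d_def \<delta> del: of_real_power flip: of_real_power of_real_mult of_real_add)
  note cont = os_continuous[OF os] f deriv01_continuous[OF u(1)] deriv01_continuous[OF u(2)]
  have sq_int: "((\<lambda>y. (cmod (p y))^2) has_integral (L2 p)^2) {0..1}" if "continuous_on {0..1} p" for p
    unfolding L2_square[OF that] by (intro integrable_integral integrable01 continuous_intros that)
  have mult_int: "((\<lambda>y. cmod (p y) * cmod (r y)) has_integral integral {0..1} (\<lambda>y. cmod (p y) * cmod (r y))) {0..1}"
    if "continuous_on {0..1} p" "continuous_on {0..1} r" for p r :: "real \<Rightarrow> complex"
    by (intro integrable_integral integrable01 continuous_intros that)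
  have "\<epsilon> / \<alpha> * (L2 \<omega>)^2 + Im c * (L2 \<phi>1)^2
      \<le> integral {0..1} (\<lambda>y. cmod (f y) * cmod (\<phi> y)) + M * integral {0..1} (\<lambda>y. cmod (\<phi>1 y) * cmod (\<phi> y)) + 0"
  proof (rule has_integral_le)
    show "((\<lambda>y. \<epsilon> / \<alpha> * (cmod (\<omega> y))^2 + Im c * (cmod (\<phi>1 y))^2) has_integral
       (\<epsilon> / \<alpha> * (L2 \<omega>)^2 + Im c * (L2 \<phi>1)^2)) {0..1}"
      by (intro has_integral_add has_integral_mult_right sq_int cont)
    show "((\<lambda>y. cmod (f y) * cmod (\<phi> y) + M * (cmod (\<phi>1 y) * cmod (\<phi> y)) + E y) has_integral
       (integral {0..1} (\<lambda>y. cmod (f y) * cmod (\<phi> y)) + M * integral {0..1} (\<lambda>y. cmod (\<phi>1 y) * cmod (\<phi> y)) + 0)) {0..1}"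
      by (intro has_integral_add has_integral_mult_right mult_int E0 cont)
    fix y :: real assume y: "y \<in> {0..1}"
    have "- (cmod (f y) * cmod (\<phi> y)) \<le> Im (f y * cnj (\<phi> y))"
      using abs_Im_le_cmod[of "f y * cnj (\<phi> y)"] by (simp only: norm_mult complex_mod_cnj abs_le_iff) linarith
    moreover have "cmod (u1 y * \<phi>1 y * cnj (\<phi> y)) \<le> M * (cmod (\<phi>1 y) * cmod (\<phi> y))"
      unfolding norm_mult complex_mod_cnj mult.assoc using U1_le[OF y] by (intro mult_right_mono) (auto simp: u1_def)
    moreover have "Im (u1 y * \<phi>1 y * cnj (\<phi> y)) \<le> cmod (u1 y * \<phi>1 y * cnj (\<phi> y))"
      using abs_Im_le_cmod[of "u1 y * \<phi>1 y * cnj (\<phi> y)"] by linarith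
    moreover have "0 \<le> Im c * (\<alpha>^2 * (cmod (\<phi> y))^2)" using c by simp
    ultimately show "\<epsilon> / \<alpha> * (cmod (\<omega> y))^2 + Im c * (cmod (\<phi>1 y))^2
      \<le> cmod (f y) * cmod (\<phi> y) + M * (cmod (\<phi>1 y) * cmod (\<phi> y)) + E y"
      unfolding E_def distrib_left[of "Im c"] by linarith
  qed
  also have "\<dots> \<le> L2 f * L2 \<phi> + M * (L2 \<phi>1 * L2 \<phi>)"
    using L2_Cauchy_Schwarz_norm[OF cont(5,1)] L2_Cauchy_Schwarz_norm[OF cont(2,1)] M by (simp add: mult_left_mono add_mono)
  finally show ?thesis by (simp add: mult.assoc)
qed

text \<open>The energy inequality is quadratic in the norm of \<phi>'; solving it and inserting the
  result again bounds the dissipation. The weight sqrt \<epsilon> on \<omega> suffices, because the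
  viscous term of the weak identity carries the full factor \<epsilon> and keeps a spare sqrt
  \<epsilon>.\<close>

lemma energy_bounds:
  assumes os: "os \<epsilon> c f \<phi> \<phi>1 \<omega> \<omega>1" and \<epsilon>: "\<epsilon> > 0" and f: "continuous_on {0..1} f" and ns: "no_slip \<phi> \<phi>1"
    and m: "0 < m" "m \<le> Im c"
  defines "K \<equiv> (1 + M + m) / m"
  shows "L2 \<phi>1 \<le> K * (L2 \<phi> + L2 f)" "sqrt \<epsilon> * L2 \<omega> \<le> sqrt (\<alpha> * (1 + M * K)) * (L2 \<phi> + L2 f)"
proof -
  define X where "X = L2 \<phi> + L2 f"
  note cont = os_continuous[OF os] f
  note nn = L2_nonneg[OF cont(1)] L2_nonneg[OF cont(2)] L2_nonneg[OF cont(3)] L2_nonneg[OF cont(5)]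
  have X: "X \<ge> 0" using nn by (simp add: X_def)
  have "L2 f * L2 \<phi> \<le> X * X" using nn by (intro mult_mono) (auto simp: X_def)
  moreover have "M * L2 \<phi>1 * L2 \<phi> \<le> M * L2 \<phi>1 * X" using nn M by (intro mult_left_mono) (auto simp: X_def)
  moreover have "m * (L2 \<phi>1)^2 \<le> Im c * (L2 \<phi>1)^2" using m by (intro mult_right_mono) auto
  moreover note energy_estimate[OF os \<epsilon> f ns]
  ultimately have e: "\<epsilon> / \<alpha> * (L2 \<omega>)^2 + m * (L2 \<phi>1)^2 \<le> X^2 + M * L2 \<phi>1 * X"
    using m by (simp add: power2_eq_square)
  moreover have "0 \<le> \<epsilon> / \<alpha> * (L2 \<omega>)^2" using \<epsilon> \<alpha> by simp
  ultimately have "m * (L2 \<phi>1)^2 \<le> X^2 + M * L2 \<phi>1 * X" by linarith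
  then have 1: "L2 \<phi>1 \<le> K * X"
    unfolding K_def using m M X nn by (intro le_if_square_le) auto
  then show "L2 \<phi>1 \<le> K * (L2 \<phi> + L2 f)" by (simp add: X_def)
  have "M * L2 \<phi>1 * X \<le> M * (K * X) * X" using 1 M X by (intro mult_right_mono mult_left_mono) auto
  moreover have "0 \<le> m * (L2 \<phi>1)^2" using m by simp
  ultimately have "\<epsilon> / \<alpha> * (L2 \<omega>)^2 \<le> X^2 + M * (K * X) * X" using e by linarith
  then have "\<epsilon> * (L2 \<omega>)^2 \<le> \<alpha> * (1 + M * K) * X^2"
    using \<alpha> by (simp add: field_simps power2_eq_square)
  then have "sqrt (\<epsilon> * (L2 \<omega>)^2) \<le> sqrt (\<alpha> * (1 + M * K) * X^2)" by (rule real_sqrt_le_mono)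
  then show "sqrt \<epsilon> * L2 \<omega> \<le> sqrt (\<alpha> * (1 + M * K)) * (L2 \<phi> + L2 f)"
    using nn X by (simp add: real_sqrt_mult X_def)
qed

text \<open>Testing with the multiplier whose Rayleigh source is \<open>cnj \<phi>\<close> bounds \<open>\<phi>\<close> itself, up to
  viscous and corrector terms that the energy estimate makes small.\<close>

lemma apriori_estimate:
  assumes m: "0 < m" and \<kappa>: "0 < \<kappa>" and R: "0 \<le> R"
  shows "\<exists>\<epsilon>1>0. \<exists>C\<ge>0. \<forall>\<epsilon> c f \<phi> \<phi>1 \<omega> \<omega>1. 0 < \<epsilon> \<longrightarrow> \<epsilon> < \<epsilon>1 \<longrightarrow> m \<le> Im c \<longrightarrow> \<kappa> \<le> cmod (D0 c) \<longrightarrow> cmod c \<le> R \<longrightarrow>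
     continuous_on {0..1} f \<longrightarrow> os \<epsilon> c f \<phi> \<phi>1 \<omega> \<omega>1 \<longrightarrow> no_slip \<phi> \<phi>1 \<longrightarrow>
     L2 \<phi> \<le> C * L2 f \<and> L2 \<phi>1 \<le> C * L2 f \<and> sqrt \<epsilon> * L2 \<omega> \<le> C * L2 f"
proof -
  define Cr where "Cr = B m + B m * B m / \<kappa>"
  have Cr: "Cr > 0" using B[of m] \<kappa> by (auto simp: Cr_def intro!: add_pos_pos)
  define Kb where "Kb = 2 * M + (M + R) * (\<alpha>^2 + 1)"
  have Kb: "Kb > 0" using M R by (auto simp: Kb_def intro!: add_pos_nonneg)
  define K1 where "K1 = (1 + M + m) / m"
  have K1: "K1 > 0" using M m by (simp add: K1_def)
  define K2 where "K2 = sqrt (\<alpha> * (1 + M * K1))"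
  have K2: "K2 \<ge> 0" using M K1 \<alpha> by (simp add: K2_def)
  \<comment> \<open>With n = L2 \<phi> and F = L2 f, the corrector term will be at most 2 Kb (1 +
    K1) Cr \<eta> (n + F) n, and \<eta> brings its factor below 1/4. The cap 1 gives L2 e \<le> Cr n
    when v is estimated.\<close>
  define \<eta> where "\<eta> = min 1 (1 / (8 * (Kb * (1 + K1) * Cr)))"
  have kpos: "Kb * (1 + K1) * Cr > 0" using Kb K1 Cr by simp
  have \<eta>: "0 < \<eta>" "\<eta> \<le> 1" using kpos by (auto simp: \<eta>_def)
  have "\<eta> \<le> 1 / (8 * (Kb * (1 + K1) * Cr))" by (simp add: \<eta>_def)
  then have "\<eta> * (8 * (Kb * (1 + K1) * Cr)) \<le> 1" using kpos by (subst (asm) pos_le_divide_eq) auto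
  then have \<eta>K: "2 * Kb * (1 + K1) * Cr * \<eta> \<le> 1 / 4" by (simp add: algebra_simps)
  obtain Ct where Ct: "Ct \<ge> 0" and test: "\<And>c g w w1 S. m \<le> Im c \<Longrightarrow> ray c g w w1 \<Longrightarrow> continuous_on {0..1} g \<Longrightarrow>
    w 0 = 0 \<Longrightarrow> w 1 = 0 \<Longrightarrow> (\<forall>y\<in>{0..1}. cmod (w y) \<le> S \<and> cmod (w1 y) \<le> S) \<Longrightarrow>
    (\<exists>v v1 v2 e e1. deriv01 v v1 \<and> deriv01 v1 v2 \<and> continuous_on {0..1} v2 \<and>
       v 0 = 0 \<and> v 1 = 0 \<and> v1 0 = 0 \<and> v1 1 = 0 \<and>
       deriv01 e e1 \<and> e 0 = 0 \<and> e 1 = 0 \<and> continuous_on {0..1} e1 \<and>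
       (\<forall>y\<in>{0..1}. v y = w y * inverse (of_real (U y) - c) - e y) \<and>
       L2 (\<lambda>y. v2 y - of_real (\<alpha>^2) * v y) \<le> Ct * (S + L2 g) \<and> L2 e \<le> \<eta> * S \<and> L2 e1 \<le> \<eta> * S)"
    using test_functions[OF m \<eta>(1)] by blast
  have "K2 / \<alpha> * Ct * (Cr + 1) \<ge> 0" using K2 \<alpha> Ct Cr by simp
  \<comment> \<open>\<open>Ct\<close> is fixed by now, however large the choice of \<eta> made it,
    so a small \<epsilon> brings the viscous term below 1/4 (n + F) n.\<close>
  then obtain \<epsilon>1 where \<epsilon>1: "\<epsilon>1 > 0" "\<And>\<epsilon>. 0 < \<epsilon> \<Longrightarrow> \<epsilon> < \<epsilon>1 \<Longrightarrow> sqrt \<epsilon> * (K2 / \<alpha> * Ct * (Cr + 1)) \<le> 1 / 4"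
    using finite_times_small[of "K2 / \<alpha> * Ct * (Cr + 1)" "1 / 4"] by auto
  \<comment> \<open>Comes from n \<le> (1/m + 1) Cr F + (n + F) / 2, solved for n; the last term is
    the sum of the two quarters.\<close>
  define C0 where "C0 = 2 * ((1 / m + 1) * Cr) + 1"
  have C0: "C0 \<ge> 0" using m Cr by (simp add: C0_def)
  define C where "C = C0 + K1 * (C0 + 1) + K2 * (C0 + 1)"
  have C: "C \<ge> 0" using C0 K1 K2 by (simp add: C_def)
  show ?thesis
  proof (rule exI[of _ \<epsilon>1], rule conjI[OF \<epsilon>1(1)], rule exI[of _ C], rule conjI[OF C], intro allI impI)
    fix \<epsilon> c f \<phi> \<phi>1 \<omega> \<omega>1
    assume \<epsilon>: "0 < \<epsilon>" "\<epsilon> < \<epsilon>1" and c: "m \<le> Im c" "\<kappa> \<le> cmod (D0 c)" "cmod c \<le> R"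
      and f: "continuous_on {0..1} f" and os: "os \<epsilon> c f \<phi> \<phi>1 \<omega> \<omega>1" and ns: "no_slip \<phi> \<phi>1"
    note cont = os_continuous[OF os] f
    define n where "n = L2 \<phi>"
    define F where "F = L2 f"
    have n: "n \<ge> 0" "F \<ge> 0" using L2_nonneg cont by (auto simp: n_def F_def)
    have e1: "L2 \<phi>1 \<le> K1 * (n + F)" and e2: "sqrt \<epsilon> * L2 \<omega> \<le> K2 * (n + F)"
      using energy_bounds[OF os \<epsilon>(1) f ns m c(1)] by (auto simp: n_def F_def K1_def K2_def)
    have n_le: "n \<le> C0 * F"
    proof (cases "n = 0")
      case False
      then have npos: "n > 0" using n by simp
      define g where "g y = cnj (\<phi> y)" for y
      have g: "continuous_on {0..1} g" unfolding g_def using cont by (intro continuous_intros)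
      have gn: "L2 g = n" unfolding n_def by (rule L2_cong) (simp add: g_def)
      obtain w w1 where w: "ray c g w w1" "w 0 = 0" "w 1 = 0" and wb: "\<forall>y\<in>{0..1}.
          cmod (w y) \<le> Cr * integral {0..1} (\<lambda>y. cmod (g y)) \<and> cmod (w1 y) \<le> Cr * integral {0..1} (\<lambda>y. cmod (g y))"
        using ray_bvp[OF m c(1) \<kappa> c(2) g] unfolding Cr_def by blast
      have "Cr * integral {0..1} (\<lambda>y. cmod (g y)) \<le> Cr * n"
        using integral_norm_le_L2[OF g] gn Cr by simp
      then have wb: "\<forall>y\<in>{0..1}. cmod (w y) \<le> Cr * n \<and> cmod (w1 y) \<le> Cr * n" using wb by fastforce
      obtain v v1 v2 e e1 where v: "deriv01 v v1" "deriv01 v1 v2" "continuous_on {0..1} v2"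
         "v 0 = 0" "v 1 = 0" "v1 0 = 0" "v1 1 = 0"
        and e: "deriv01 e e1" "e 0 = 0" "e 1 = 0" "continuous_on {0..1} e1"
        and ve: "\<forall>y\<in>{0..1}. v y = w y * inverse (of_real (U y) - c) - e y"
        and vL: "L2 (\<lambda>y. v2 y - of_real (\<alpha>^2) * v y) \<le> Ct * (Cr * n + n)" and eL: "L2 e \<le> \<eta> * (Cr * n)" "L2 e1 \<le> \<eta> * (Cr * n)"
        using test[OF c(1) w(1) g w(2,3) wb] gn by auto
      have c0: "Im c > 0" using m c by simp
      note vc = deriv01_continuous[OF v(1)] deriv01_continuous[OF e(1)] v(3) e(4) deriv01_continuous[OF v(2)]
      have wc: "continuous_on {0..1} (\<lambda>y. w y * inverse (of_real (U y) - c))"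
        using U_minus_nz[OF c0] by (intro continuous_intros ray_continuous[OF w(1)] U_continuous) auto
      have id: "integral {0..1} (\<lambda>y. \<phi> y * g y) = integral {0..1} (\<lambda>y. f y * v y)
         - \<delta> \<epsilon> * integral {0..1} (\<lambda>y. \<omega> y * (v2 y - of_real (\<alpha>^2) * v y)) + bform c \<phi> \<phi>1 e e1"
        using ns by (intro weak_identity[OF os \<epsilon>(1) f _ _ w(1) c0 g w(2,3) v e ve]) (auto simp: no_slip_def)
      have "integral {0..1} (\<lambda>y. \<phi> y * g y) = integral {0..1} (\<lambda>y. complex_of_real ((cmod (\<phi> y))^2))"
        by (rule integral_cong) (simp add: g_def flip: complex_norm_square)
      also have "\<dots> = complex_of_real (integral {0..1} (\<lambda>y. (cmod (\<phi> y))^2))"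
      proof -
        have "continuous_on {0..1} (\<lambda>y. (cmod (\<phi> y))^2)" by (intro continuous_intros cont)
        from integral_linear[OF integrable01[OF this] bounded_linear_of_real, where 'a1 = complex]
        show ?thesis by (simp add: o_def)
      qed
      also have "\<dots> = complex_of_real (n^2)" unfolding n_def L2_square[OF cont(1)] ..
      finally have "n^2 = cmod (integral {0..1} (\<lambda>y. \<phi> y * g y))" by (simp add: norm_power)
      also have "\<dots> \<le> cmod (integral {0..1} (\<lambda>y. f y * v y))
         + cmod (\<delta> \<epsilon> * integral {0..1} (\<lambda>y. \<omega> y * (v2 y - of_real (\<alpha>^2) * v y))) + cmod (bform c \<phi> \<phi>1 e e1)"
        unfolding id by (meson norm_triangle_ineq norm_triangle_ineq4 order_trans add_right_mono)
      also have "cmod (integral {0..1} (\<lambda>y. f y * v y)) \<le> F * ((1 / m + 1) * Cr * n)"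
      proof -
        have "L2 v = L2 (\<lambda>y. w y * inverse (of_real (U y) - c) - e y)" using ve by (intro L2_cong) auto
        also have "\<dots> \<le> L2 (\<lambda>y. w y * inverse (of_real (U y) - c)) + L2 e"
          by (rule L2_diff[OF wc vc(2)])
        also have "L2 (\<lambda>y. w y * inverse (of_real (U y) - c)) \<le> Cr * n * (1 / m)"
        proof (rule L2_le_const[OF wc])
          show "cmod (w y * inverse (of_real (U y) - c)) \<le> Cr * n * (1 / m)" if "y \<in> {0..1}" for y
            unfolding norm_mult using wb that inverse_U_minus_le[OF m c(1)] Cr n by (intro mult_mono) auto
        qed
        also have "L2 e \<le> 1 * (Cr * n)"
          by (rule order_trans[OF eL(1)]) (use \<eta>(2) Cr n in \<open>intro mult_right_mono, auto\<close>)
        finally have "L2 v \<le> (1 / m + 1) * Cr * n" by (simp add: algebra_simps)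
        then show ?thesis using L2_Cauchy_Schwarz[OF f vc(1)] n mult_left_mono[of "L2 v" "(1 / m + 1) * Cr * n" F]
          by (simp add: F_def)
      qed
      also have "cmod (\<delta> \<epsilon> * integral {0..1} (\<lambda>y. \<omega> y * (v2 y - of_real (\<alpha>^2) * v y))) \<le> 1 / 4 * (n + F) * n"
      proof -
        have "cmod (integral {0..1} (\<lambda>y. \<omega> y * (v2 y - of_real (\<alpha>^2) * v y))) \<le> L2 \<omega> * L2 (\<lambda>y. v2 y - of_real (\<alpha>^2) * v y)"
          by (intro L2_Cauchy_Schwarz continuous_intros cont vc)
        also have "\<dots> \<le> L2 \<omega> * (Ct * (Cr * n + n))" using vL L2_nonneg[OF cont(3)] by (intro mult_left_mono) auto
        finally have 1: "cmod (\<delta> \<epsilon> * integral {0..1} (\<lambda>y. \<omega> y * (v2 y - of_real (\<alpha>^2) * v y))) \<le> \<epsilon> / \<alpha> * (L2 \<omega> * (Ct * (Cr * n + n)))"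
          unfolding norm_mult \<delta>(2) using \<epsilon> \<alpha> by (simp add: mult_left_mono divide_right_mono)
        have "\<epsilon> / \<alpha> * (L2 \<omega> * (Ct * (Cr * n + n))) = (sqrt \<epsilon> * L2 \<omega>) * (sqrt \<epsilon> / \<alpha> * Ct * (Cr + 1) * n)"
        proof -
          have "s * s / \<alpha> * (L2 \<omega> * (Ct * (Cr * n + n))) = (s * L2 \<omega>) * (s / \<alpha> * Ct * (Cr + 1) * n)" for s
            using \<alpha> by (simp add: field_simps)
          from this[of "sqrt \<epsilon>"] show ?thesis using \<epsilon> by simp
        qed
        also have "\<dots> \<le> (K2 * (n + F)) * (sqrt \<epsilon> / \<alpha> * Ct * (Cr + 1) * n)"
          using e2 \<epsilon> \<alpha> Ct Cr n by (intro mult_right_mono) auto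
        also have "\<dots> = (sqrt \<epsilon> * (K2 / \<alpha> * Ct * (Cr + 1))) * ((n + F) * n)" by simp
        also have "\<dots> \<le> 1 / 4 * ((n + F) * n)" using \<epsilon>1(2)[OF \<epsilon>] n by (intro mult_right_mono) auto
        finally show ?thesis using 1 by (simp only: mult.assoc)
      qed
      also have "cmod (bform c \<phi> \<phi>1 e e1) \<le> 1 / 4 * (n + F) * n"
      proof -
        have "cmod (bform c \<phi> \<phi>1 e e1) \<le> Kb * ((L2 \<phi> + L2 \<phi>1) * (L2 e + L2 e1))"
          unfolding Kb_def by (rule bform_le[OF cont(1,2) vc(2,4) c(3)])
        also have "\<dots> \<le> Kb * (((n + F) + K1 * (n + F)) * (\<eta> * (Cr * n) + \<eta> * (Cr * n)))"
          using e1 eL Kb K1 n L2_nonneg[OF vc(2)] L2_nonneg[OF vc(4)]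
          by (intro mult_left_mono mult_mono add_mono) (auto simp: n_def)
        also have "\<dots> = (2 * Kb * (1 + K1) * Cr * \<eta>) * ((n + F) * n)" by (simp add: algebra_simps)
        also have "\<dots> \<le> 1 / 4 * ((n + F) * n)" using \<eta>K n by (intro mult_right_mono) auto
        finally show ?thesis by simp
      qed
      finally have "n * n \<le> (F * ((1 / m + 1) * Cr) + 1 / 4 * (n + F) + 1 / 4 * (n + F)) * n"
        by (simp only: power2_eq_square distrib_right mult.assoc)
      then have "n \<le> F * ((1 / m + 1) * Cr) + 1 / 4 * (n + F) + 1 / 4 * (n + F)"
        using npos by (simp only: mult_le_cancel_right)
      then have "n \<le> 2 * (F * ((1 / m + 1) * Cr)) + F" by argo
      also have "\<dots> = C0 * F" by (simp add: C0_def algebra_simps)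
      finally show ?thesis .
    qed (use C0 n in simp)
    have X: "n + F \<le> (C0 + 1) * F" using n_le by (simp add: algebra_simps)
    have "K1 * (n + F) \<le> K1 * ((C0 + 1) * F)" "K2 * (n + F) \<le> K2 * ((C0 + 1) * F)"
      using X K1 K2 by (auto intro!: mult_left_mono)
    moreover have "0 \<le> C0 * F" "0 \<le> K1 * ((C0 + 1) * F)" "0 \<le> K2 * ((C0 + 1) * F)" using C0 K1 K2 n by auto
    moreover have "C * F = C0 * F + K1 * ((C0 + 1) * F) + K2 * ((C0 + 1) * F)" by (simp add: C_def algebra_simps)
    ultimately show "L2 \<phi> \<le> C * L2 f \<and> L2 \<phi>1 \<le> C * L2 f \<and> sqrt \<epsilon> * L2 \<omega> \<le> C * L2 f"
      using n_le e1 e2 unfolding n_def[symmetric] F_def[symmetric] by linarith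
  qed
qed

section \<open>Solvability away from the spectrum\<close>

definition os_rhs :: "real \<Rightarrow> complex \<Rightarrow> real \<Rightarrow> complex \<Rightarrow> complex \<Rightarrow> complex \<Rightarrow> complex" where
  "os_rhs \<epsilon> c y g a p = of_real (\<alpha>^2) * p + (g - of_real (U2 y) * a + (of_real (U y) - c) * p) / \<delta> \<epsilon>"

text \<open>A Lipschitz constant for the first order system. Its growth like 1 / \<epsilon> is
  harmless, because it serves at fixed \<epsilon> only, for solvability and differentiability in c;
  uniformity in \<epsilon> comes from the a priori estimate.\<close>

definition Ko :: "real \<Rightarrow> complex \<Rightarrow> real" where
  "Ko \<epsilon> c = 3 + 2 * \<alpha>^2 + (2 * M + cmod c) * (\<alpha> / \<epsilon>)"

lemma os_rhs_le:
  fixes a b p s g :: complex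
  assumes \<epsilon>: "\<epsilon> > 0" and y: "y \<in> {0..1}"
  shows "norm (b, of_real (\<alpha>^2) * a + p, s, os_rhs \<epsilon> c y g a p) \<le> Ko \<epsilon> c * norm (a, b, p, s) + \<alpha> / \<epsilon> * cmod g"
proof -
  define N where "N = norm (a, b, p, s)"
  have N: "cmod a \<le> N" "cmod b \<le> N" "cmod p \<le> N" "cmod s \<le> N"
    using norm_quadruple(1-4)[of "(a, b, p, s)"] by (auto simp: N_def)
  have uc: "cmod (of_real (U y) - c) \<le> M + cmod c"
    using norm_triangle_ineq4[of "complex_of_real (U y)" c] U_le[OF y] by simp
  have i: "1 / cmod (\<delta> \<epsilon>) = \<alpha> / \<epsilon>" using \<delta>(2) \<epsilon> by simp
  have "cmod (of_real (\<alpha>^2) * a + p) \<le> cmod (of_real (\<alpha>^2) * a) + cmod p" by (rule norm_triangle_ineq)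
  also have "\<dots> \<le> \<alpha>^2 * N + N"
    unfolding norm_mult using N by (intro add_mono mult_mono) (auto simp: norm_power)
  finally have 1: "cmod (of_real (\<alpha>^2) * a + p) \<le> \<alpha>^2 * N + N" .
  have "cmod (g - of_real (U2 y) * a + (of_real (U y) - c) * p)
      \<le> cmod g + cmod (of_real (U2 y) * a) + cmod ((of_real (U y) - c) * p)"
    by (meson norm_triangle_ineq norm_triangle_ineq4 order_trans add_right_mono)
  also have "\<dots> \<le> cmod g + M * N + (M + cmod c) * N"
    unfolding norm_mult using N uc U2_le[OF y] M by (intro add_mono mult_mono) auto
  finally have "cmod (g - of_real (U2 y) * a + (of_real (U y) - c) * p) * (1 / cmod (\<delta> \<epsilon>))
      \<le> (cmod g + M * N + (M + cmod c) * N) * (1 / cmod (\<delta> \<epsilon>))" by (intro mult_right_mono) auto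
  then have 2: "cmod ((g - of_real (U2 y) * a + (of_real (U y) - c) * p) / \<delta> \<epsilon>)
      \<le> (cmod g + M * N + (M + cmod c) * N) * (\<alpha> / \<epsilon>)"
    unfolding i[symmetric] by (simp add: norm_divide)
  have "cmod (os_rhs \<epsilon> c y g a p) \<le> cmod (of_real (\<alpha>^2) * p) + cmod ((g - of_real (U2 y) * a + (of_real (U y) - c) * p) / \<delta> \<epsilon>)"
    unfolding os_rhs_def by (rule norm_triangle_ineq)
  also have "cmod (of_real (\<alpha>^2) * p) \<le> \<alpha>^2 * N" unfolding norm_mult using N by (intro mult_mono) (auto simp: norm_power)
  finally have 3: "cmod (os_rhs \<epsilon> c y g a p) \<le> \<alpha>^2 * N + (cmod g + M * N + (M + cmod c) * N) * (\<alpha> / \<epsilon>)"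
    using 2 by linarith
  have "norm (b, of_real (\<alpha>^2) * a + p, s, os_rhs \<epsilon> c y g a p)
      \<le> cmod b + cmod (of_real (\<alpha>^2) * a + p) + cmod s + cmod (os_rhs \<epsilon> c y g a p)"
    using norm_quadruple(5)[of "(b, of_real (\<alpha>^2) * a + p, s, os_rhs \<epsilon> c y g a p)"] by simp
  also have "\<dots> \<le> N + (\<alpha>^2 * N + N) + N + (\<alpha>^2 * N + (cmod g + M * N + (M + cmod c) * N) * (\<alpha> / \<epsilon>))"
    using N 1 3 by linarith
  also have "\<dots> = Ko \<epsilon> c * N + \<alpha> / \<epsilon> * cmod g" by (simp add: Ko_def algebra_simps add_divide_distrib)
  finally show ?thesis by (simp add: N_def)
qed

lemma Ko: "\<epsilon> > 0 \<Longrightarrow> Ko \<epsilon> c > 0"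
  using M \<alpha> by (auto simp: Ko_def intro!: add_pos_nonneg mult_nonneg_nonneg)

lemma os_alt: "os \<epsilon> c f \<phi> \<phi>1 \<omega> \<omega>1 \<longleftrightarrow> deriv01 \<phi> \<phi>1 \<and> deriv01 \<phi>1 (\<lambda>y. of_real (\<alpha>^2) * \<phi> y + \<omega> y) \<and> deriv01 \<omega> \<omega>1 \<and>
     deriv01 \<omega>1 (\<lambda>y. os_rhs \<epsilon> c y (f y) (\<phi> y) (\<omega> y))"
  by (simp add: os_def os_rhs_def)

lemma os_exists:
  assumes \<epsilon>: "\<epsilon> > 0" and f: "continuous_on {0..1} f"
  shows "\<exists>\<phi> \<phi>1 \<omega> \<omega>1. os \<epsilon> c f \<phi> \<phi>1 \<omega> \<omega>1 \<and> \<phi> 0 = a \<and> \<phi>1 0 = b \<and> \<omega> 0 = p \<and> \<omega>1 0 = s"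
proof -
  define G where "G y x = (fst (snd x), of_real (\<alpha>^2) * fst x + fst (snd (snd x)), snd (snd (snd x)),
      os_rhs \<epsilon> c y (f y) (fst x) (fst (snd (snd x))))" for y and x :: "complex \<times> complex \<times> complex \<times> complex"
  have "continuous_on ({0..1} \<times> UNIV) (\<lambda>(y, x). G y x)"
    unfolding G_def split_beta os_rhs_def
    by (intro continuous_intros continuous_on_compose2[OF f] continuous_on_compose2[OF U_continuous(1)]
        continuous_on_compose2[OF U_continuous(3)]) (use \<delta>(3) \<epsilon> in auto)
  moreover have "norm (G y x - G y z) \<le> Ko \<epsilon> c * norm (x - z)" if y: "y \<in> {0..1}" for y x z
  proof -
    have "os_rhs \<epsilon> c y g a p - os_rhs \<epsilon> c y g a' p' = os_rhs \<epsilon> c y 0 (a - a') (p - p')" for a p a' p' g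
      using \<delta>(3) \<epsilon> by (simp add: os_rhs_def diff_divide_distrib add_divide_distrib algebra_simps)
    then have eq: "G y x - G y z = (fst (snd (x - z)), of_real (\<alpha>^2) * fst (x - z) + fst (snd (snd (x - z))),
        snd (snd (snd (x - z))), os_rhs \<epsilon> c y 0 (fst (x - z)) (fst (snd (snd (x - z)))))"
      by (simp add: G_def algebra_simps)
    show ?thesis unfolding eq
      using os_rhs_le[OF \<epsilon> y, of "fst (snd (x - z))" "fst (x - z)" "fst (snd (snd (x - z)))" "snd (snd (snd (x - z)))" c 0]
      by (simp only: prod.collapse norm_zero mult_zero_right add_0_right)
  qed
  ultimately obtain x where x: "x 0 = (a, b, p, s)" "deriv01 x (\<lambda>y. G y (x y))"
    using ivp_exists[of G "Ko \<epsilon> c" "(a, b, p, s)"] Ko[OF \<epsilon>] by auto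
  have "os \<epsilon> c f (\<lambda>y. fst (x y)) (\<lambda>y. fst (snd (x y))) (\<lambda>y. fst (snd (snd (x y)))) (\<lambda>y. snd (snd (snd (x y))))"
    unfolding os_alt
    using deriv01_fst[OF x(2)] deriv01_fst[OF deriv01_snd[OF x(2)]] deriv01_fst[OF deriv01_snd[OF deriv01_snd[OF x(2)]]]
      deriv01_snd[OF deriv01_snd[OF deriv01_snd[OF x(2)]]] by (simp add: G_def)
  then show ?thesis using x(1)
    by (intro exI[of _ "\<lambda>y. fst (x y)"] exI[of _ "\<lambda>y. fst (snd (x y))"] exI[of _ "\<lambda>y. fst (snd (snd (x y)))"]
        exI[of _ "\<lambda>y. snd (snd (snd (x y)))"]) auto
qed

lemma os_bound:
  assumes os: "os \<epsilon> c f \<phi> \<phi>1 \<omega> \<omega>1" and \<epsilon>: "\<epsilon> > 0" and f: "continuous_on {0..1} f"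
    and le: "cmod (\<phi> 0) + cmod (\<phi>1 0) + cmod (\<omega> 0) + cmod (\<omega>1 0) + \<alpha> / \<epsilon> * L2 f \<le> S" and y: "y \<in> {0..1}"
  defines "E \<equiv> 2 * exp (2 * Ko \<epsilon> c)"
  shows "cmod (\<phi> y) \<le> E * S" "cmod (\<phi>1 y) \<le> E * S" "cmod (\<omega> y) \<le> E * S" "cmod (\<omega>1 y) \<le> E * S"
proof -
  note o = os[unfolded os_alt]
  note cont = os_continuous[OF os]
  have "norm (\<phi> y, \<phi>1 y, \<omega> y, \<omega>1 y)
     \<le> 2 * exp (2 * Ko \<epsilon> c) * (norm (\<phi> 0, \<phi>1 0, \<omega> 0, \<omega>1 0) + integral {0..1} (\<lambda>y. \<alpha> / \<epsilon> * cmod (f y)))"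
  proof (rule ivp_bound[where x = "\<lambda>y. (\<phi> y, \<phi>1 y, \<omega> y, \<omega>1 y)"
        and x' = "\<lambda>y. (\<phi>1 y, of_real (\<alpha>^2) * \<phi> y + \<omega> y, \<omega>1 y, os_rhs \<epsilon> c y (f y) (\<phi> y) (\<omega> y))"])
    show "deriv01 (\<lambda>y. (\<phi> y, \<phi>1 y, \<omega> y, \<omega>1 y))
        (\<lambda>y. (\<phi>1 y, of_real (\<alpha>^2) * \<phi> y + \<omega> y, \<omega>1 y, os_rhs \<epsilon> c y (f y) (\<phi> y) (\<omega> y)))"
      using o by (intro deriv01_Pair) auto
    show "continuous_on {0..1} (\<lambda>y. (\<phi>1 y, of_real (\<alpha>^2) * \<phi> y + \<omega> y, \<omega>1 y, os_rhs \<epsilon> c y (f y) (\<phi> y) (\<omega> y)))"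
      unfolding os_rhs_def using \<delta>(3) \<epsilon> by (intro continuous_intros cont f U_continuous) auto
  qed (use Ko[OF \<epsilon>] os_rhs_le[OF \<epsilon>] f y \<alpha> \<epsilon> in \<open>auto intro!: continuous_intros\<close>)
  also have "\<dots> \<le> E * S"
    unfolding E_def
  proof (rule mult_left_mono)
    have "\<alpha> / \<epsilon> * integral {0..1} (\<lambda>y. cmod (f y)) \<le> \<alpha> / \<epsilon> * L2 f"
      using integral_norm_le_L2[OF f] \<alpha> \<epsilon> by (intro mult_left_mono) auto
    moreover have "norm (\<phi> 0, \<phi>1 0, \<omega> 0, \<omega>1 0) \<le> cmod (\<phi> 0) + cmod (\<phi>1 0) + cmod (\<omega> 0) + cmod (\<omega>1 0)"
      using norm_quadruple(5)[of "(\<phi> 0, \<phi>1 0, \<omega> 0, \<omega>1 0)"] by simp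
    ultimately show "norm (\<phi> 0, \<phi>1 0, \<omega> 0, \<omega>1 0) + integral {0..1} (\<lambda>y. \<alpha> / \<epsilon> * cmod (f y)) \<le> S"
      using le by (simp only: integral_mult_right)
  qed simp
  finally have "norm (\<phi> y, \<phi>1 y, \<omega> y, \<omega>1 y) \<le> E * S" .
  then show "cmod (\<phi> y) \<le> E * S" "cmod (\<phi>1 y) \<le> E * S" "cmod (\<omega> y) \<le> E * S" "cmod (\<omega>1 y) \<le> E * S"
    using norm_quadruple(1-4)[of "(\<phi> y, \<phi>1 y, \<omega> y, \<omega>1 y)"] by auto
qed

lemma os_lincomb:
  assumes "os \<epsilon> c f \<phi> \<phi>1 \<omega> \<omega>1" "os \<epsilon> c f' \<phi>' \<phi>1' \<omega>' \<omega>1'"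
  shows "os \<epsilon> c (\<lambda>y. f y + k * f' y) (\<lambda>y. \<phi> y + k * \<phi>' y) (\<lambda>y. \<phi>1 y + k * \<phi>1' y)
    (\<lambda>y. \<omega> y + k * \<omega>' y) (\<lambda>y. \<omega>1 y + k * \<omega>1' y)"
proof -
  note o = assms[unfolded os_alt]
  have "deriv01 (\<lambda>y. \<phi>1 y + k * \<phi>1' y) (\<lambda>y. (of_real (\<alpha>^2) * \<phi> y + \<omega> y) + k * (of_real (\<alpha>^2) * \<phi>' y + \<omega>' y))"
    using o by (intro deriv01_add deriv01_cmult) auto
  then have 1: "deriv01 (\<lambda>y. \<phi>1 y + k * \<phi>1' y) (\<lambda>y. of_real (\<alpha>^2) * (\<phi> y + k * \<phi>' y) + (\<omega> y + k * \<omega>' y))"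
    by (rule deriv01_cong) (auto simp: algebra_simps)
  have "deriv01 (\<lambda>y. \<omega>1 y + k * \<omega>1' y) (\<lambda>y. os_rhs \<epsilon> c y (f y) (\<phi> y) (\<omega> y) + k * os_rhs \<epsilon> c y (f' y) (\<phi>' y) (\<omega>' y))"
    using o by (intro deriv01_add deriv01_cmult) auto
  then have 2: "deriv01 (\<lambda>y. \<omega>1 y + k * \<omega>1' y) (\<lambda>y. os_rhs \<epsilon> c y (f y + k * f' y) (\<phi> y + k * \<phi>' y) (\<omega> y + k * \<omega>' y))"
    by (rule deriv01_cong) (auto simp: os_rhs_def algebra_simps add_divide_distrib diff_divide_distrib)
  show ?thesis unfolding os_alt using o 1 2 by (auto intro: deriv01_add deriv01_cmult)
qed

text \<open>The parameter c occurs only in - (U - c) \<omega>, so changing it adds a multiple of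
  \<omega> to the source.\<close>

lemma os_shift:
  assumes "os \<epsilon> c f \<phi> \<phi>1 \<omega> \<omega>1"
  shows "os \<epsilon> c' (\<lambda>y. f y + (c' - c) * \<omega> y) \<phi> \<phi>1 \<omega> \<omega>1"
proof -
  have "os_rhs \<epsilon> c y (f y) (\<phi> y) (\<omega> y) = os_rhs \<epsilon> c' y (f y + (c' - c) * \<omega> y) (\<phi> y) (\<omega> y)" for y
    by (simp add: os_rhs_def algebra_simps)
  then show ?thesis using assms by (simp add: os_alt)
qed

lemma no_slip_lincomb: "no_slip \<phi> \<phi>1 \<Longrightarrow> no_slip \<phi>' \<phi>1' \<Longrightarrow> no_slip (\<lambda>y. \<phi> y + k * \<phi>' y) (\<lambda>y. \<phi>1 y + k * \<phi>1' y)"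
  by (simp add: no_slip_def)

definition os_eig :: "real \<Rightarrow> complex \<Rightarrow> bool" where
  "os_eig \<epsilon> c \<longleftrightarrow> (\<exists>\<phi> \<phi>1 \<omega> \<omega>1. os \<epsilon> c (\<lambda>_. 0) \<phi> \<phi>1 \<omega> \<omega>1 \<and> no_slip \<phi> \<phi>1 \<and> (\<exists>y\<in>{0..1}. \<phi> y \<noteq> 0))"

text \<open>Each further component is determined by differentiating the earlier ones. Hence a
  nonzero vector of initial data has a nonzero first component, as \<open>os_eig\<close>
  requires.\<close>

lemma os_zero:
  assumes os: "os \<epsilon> c f \<phi> \<phi>1 \<omega> \<omega>1" and z: "\<And>y. y \<in> {0..1} \<Longrightarrow> \<phi> y = 0" and y: "y \<in> {0..1}"
  shows "\<phi>1 y = 0" "\<omega> y = 0" "\<omega>1 y = 0"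
proof -
  note o = os[unfolded os_alt]
  have 1: "\<phi>1 y = 0" if "y \<in> {0..1}" for y using deriv01_zero[of \<phi> \<phi>1 y] o z that by blast
  have 2: "\<omega> y = 0" if "y \<in> {0..1}" for y
    using deriv01_zero[of \<phi>1 "\<lambda>y. of_real (\<alpha>^2) * \<phi> y + \<omega> y" y] o z 1 that by auto
  have 3: "\<omega>1 y = 0" if "y \<in> {0..1}" for y using deriv01_zero[of \<omega> \<omega>1 y] o 2 that by blast
  show "\<phi>1 y = 0" "\<omega> y = 0" "\<omega>1 y = 0" using 1 2 3 y by auto
qed

lemma os_unique:
  assumes "\<not> os_eig \<epsilon> c" and os: "os \<epsilon> c f \<phi> \<phi>1 \<omega> \<omega>1" "os \<epsilon> c f \<phi>' \<phi>1' \<omega>' \<omega>1'"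
    and ns: "no_slip \<phi> \<phi>1" "no_slip \<phi>' \<phi>1'" and y: "y \<in> {0..1}"
  shows "\<phi> y = \<phi>' y" "\<phi>1 y = \<phi>1' y" "\<omega> y = \<omega>' y"
proof -
  have d: "os \<epsilon> c (\<lambda>_. 0) (\<lambda>y. \<phi> y + (-1) * \<phi>' y) (\<lambda>y. \<phi>1 y + (-1) * \<phi>1' y) (\<lambda>y. \<omega> y + (-1) * \<omega>' y) (\<lambda>y. \<omega>1 y + (-1) * \<omega>1' y)"
    using os_lincomb[OF os, of "-1"] by simp
  have z: "\<phi> y + (-1) * \<phi>' y = 0" if "y \<in> {0..1}" for y
    using assms(1) d no_slip_lincomb[OF ns, of "-1"] that unfolding os_eig_def by blast
  show "\<phi> y = \<phi>' y" "\<phi>1 y = \<phi>1' y" "\<omega> y = \<omega>' y"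
    using z[OF y] os_zero[OF d z y] by auto
qed

text \<open>The Fredholm alternative by shooting: two homogeneous solutions satisfy the conditions
  at the left wall, and the determinant W of their values and slopes at the right wall vanishes only
  at an eigenvalue. The constant may depend on \<epsilon> and c.\<close>

lemma os_solvable:
  assumes ne: "\<not> os_eig \<epsilon> c" and \<epsilon>: "\<epsilon> > 0"
  shows "\<exists>K\<ge>0. \<forall>f. continuous_on {0..1} f \<longrightarrow> (\<exists>\<phi> \<phi>1 \<omega> \<omega>1. os \<epsilon> c f \<phi> \<phi>1 \<omega> \<omega>1 \<and> no_slip \<phi> \<phi>1 \<and>
     L2 \<phi> \<le> K * L2 f \<and> L2 \<phi>1 \<le> K * L2 f \<and> L2 \<omega> \<le> K * L2 f)"
proof -
  have z: "continuous_on {0..1} (\<lambda>_. 0::complex)" by simp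
  obtain a a1 p p1 where a: "os \<epsilon> c (\<lambda>_. 0) a a1 p p1" "a 0 = 0" "a1 0 = 0" "p 0 = 1" "p1 0 = 0"
    using os_exists[OF \<epsilon> z] by metis
  obtain b b1 s s1 where b: "os \<epsilon> c (\<lambda>_. 0) b b1 s s1" "b 0 = 0" "b1 0 = 0" "s 0 = 0" "s1 0 = 1"
    using os_exists[OF \<epsilon> z] by metis
  define W where "W = a 1 * b1 1 - b 1 * a1 1"
  have W: "W \<noteq> 0"
  proof
    assume "W = 0"
    then obtain x y where xy: "x \<noteq> 0 \<or> y \<noteq> 0" "x * a 1 + y * b 1 = 0" "x * a1 1 + y * b1 1 = 0"
      using singular_2x2[of "a 1" "b1 1" "b 1" "a1 1"] by (auto simp: W_def)
    have za: "os \<epsilon> c (\<lambda>_. 0) (\<lambda>_. 0) (\<lambda>_. 0) (\<lambda>_. 0) (\<lambda>_. 0)"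
      using deriv01_const[of "0::complex"] by (simp add: os_alt os_rhs_def)
    note e = os_lincomb[OF os_lincomb[OF za a(1), of x] b(1), of y, simplified]
    have "no_slip (\<lambda>t. x * a t + y * b t) (\<lambda>t. x * a1 t + y * b1 t)"
      using xy a b by (simp add: no_slip_def)
    then have "\<And>t. t \<in> {0..1} \<Longrightarrow> x * a t + y * b t = 0"
      using ne e unfolding os_eig_def by blast
    \<comment> \<open>At the left wall the last two components of the combination are exactly x and
      y.\<close>
    from os_zero[OF e this, of 0] show False using a b xy by auto
  qed
  define E where "E = 2 * exp (2 * Ko \<epsilon> c)"
  have E: "E > 0" by (simp add: E_def)
  have ab: "cmod (a y) \<le> E" "cmod (a1 y) \<le> E" "cmod (p y) \<le> E" "cmod (b y) \<le> E" "cmod (b1 y) \<le> E" "cmod (s y) \<le> E"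
    if "y \<in> {0..1}" for y
    using os_bound[OF a(1) \<epsilon> z _ that, of 1] os_bound[OF b(1) \<epsilon> z _ that, of 1] a b
    by (auto simp: E_def L2_def)
  define K where "K = (E + 2 * (2 * (E * E) / cmod W) * E) * (\<alpha> / \<epsilon>)"
  have K: "K \<ge> 0" using E \<alpha> \<epsilon> by (auto simp: K_def intro!: mult_nonneg_nonneg add_nonneg_nonneg)
  show ?thesis
  proof (intro exI[of _ K] conjI allI impI, fact K)
    fix f :: "real \<Rightarrow> complex" assume f: "continuous_on {0..1} f"
    obtain h h1 o' o1 where h: "os \<epsilon> c f h h1 o' o1" "h 0 = 0" "h1 0 = 0" "o' 0 = 0" "o1 0 = 0"
      using os_exists[OF \<epsilon> f] by metis
    define S where "S = \<alpha> / \<epsilon> * L2 f"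
    have S: "S \<ge> 0" using L2_nonneg[OF f] \<alpha> \<epsilon> by (simp add: S_def)
    have hb: "cmod (h y) \<le> E * S" "cmod (h1 y) \<le> E * S" "cmod (o' y) \<le> E * S" if "y \<in> {0..1}" for y
      using os_bound[OF h(1) \<epsilon> f _ that, of S] h by (auto simp: E_def S_def)
    \<comment> \<open>Cramer's rule for the coefficients that make h + x a + y b and its derivative
      vanish at the right wall.\<close>
    define x where "x = (- h 1 * b1 1 + h1 1 * b 1) / W"
    define y where "y = (- a 1 * h1 1 + a1 1 * h 1) / W"
    have prod: "cmod (- u * v + u' * v') / cmod W \<le> 2 * (E * E) / cmod W * S"
      if "cmod u \<le> E * S" "cmod v \<le> E" "cmod u' \<le> E * S" "cmod v' \<le> E" for u v u' v'
    proof -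
      have "cmod (- u * v + u' * v') \<le> cmod u * cmod v + cmod u' * cmod v'"
        using norm_triangle_ineq[of "- u * v" "u' * v'"] by (simp add: norm_mult)
      also have "\<dots> \<le> (E * S) * E + (E * S) * E" using that E S by (intro add_mono mult_mono) auto
      finally have "cmod (- u * v + u' * v') \<le> 2 * (E * E) * S" by (simp add: algebra_simps)
      then show ?thesis by (simp add: divide_right_mono)
    qed
    have xb: "cmod x \<le> 2 * (E * E) / cmod W * S"
      unfolding x_def norm_divide using ab[of 1] hb[of 1] by (intro prod) auto
    have "y = (- h1 1 * a 1 + h 1 * a1 1) / W" by (simp add: y_def mult.commute)
    then have yb: "cmod y \<le> 2 * (E * E) / cmod W * S"
      unfolding norm_divide using prod[of "h1 1" "a 1" "h 1" "a1 1"] ab[of 1] hb[of 1] by (simp add: norm_divide)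
    define \<phi> where "\<phi> t = h t + x * a t + y * b t" for t
    define \<phi>1 where "\<phi>1 t = h1 t + x * a1 t + y * b1 t" for t
    define \<omega> where "\<omega> t = o' t + x * p t + y * s t" for t
    define \<omega>1 where "\<omega>1 t = o1 t + x * p1 t + y * s1 t" for t
    have os: "os \<epsilon> c f \<phi> \<phi>1 \<omega> \<omega>1"
      using os_lincomb[OF os_lincomb[OF h(1) a(1), of x] b(1), of y]
      unfolding \<phi>_def \<phi>1_def \<omega>_def \<omega>1_def by simp
    have "\<phi> 1 * W = 0" "\<phi>1 1 * W = 0"
      using W by (simp_all add: \<phi>_def \<phi>1_def x_def y_def W_def field_simps)
    then have ns: "no_slip \<phi> \<phi>1" using W h a b by (simp add: no_slip_def \<phi>_def \<phi>1_def)
    have comb: "cmod (u + x * v + y * v') \<le> K * L2 f" if "cmod u \<le> E * S" "cmod v \<le> E" "cmod v' \<le> E" for u v v'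
    proof -
      have "cmod (u + x * v + y * v') \<le> cmod u + cmod x * cmod v + cmod y * cmod v'"
        by (metis norm_triangle_ineq norm_mult order_trans add_right_mono)
      also have "\<dots> \<le> E * S + (2 * (E * E) / cmod W * S) * E + (2 * (E * E) / cmod W * S) * E"
        using that xb yb E S by (intro add_mono mult_mono) auto
      also have "\<dots> = K * L2 f" by (simp add: K_def S_def algebra_simps)
      finally show ?thesis .
    qed
    note cont = os_continuous[OF os]
    have "L2 \<phi> \<le> K * L2 f" "L2 \<phi>1 \<le> K * L2 f" "L2 \<omega> \<le> K * L2 f"
      by (rule L2_le_const[OF cont(1)] L2_le_const[OF cont(2)] L2_le_const[OF cont(3)];
          unfold \<phi>_def \<phi>1_def \<omega>_def; rule comb; use ab hb in blast)+
    then show "\<exists>\<phi> \<phi>1 \<omega> \<omega>1. os \<epsilon> c f \<phi> \<phi>1 \<omega> \<omega>1 \<and> no_slip \<phi> \<phi>1 \<and>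
     L2 \<phi> \<le> K * L2 f \<and> L2 \<phi>1 \<le> K * L2 f \<and> L2 \<omega> \<le> K * L2 f" using os ns by blast
  qed
qed

text \<open>Away from the spectrum, the resolvent identity turns the bound on the inverse at \<open>a\<close> into
  complex differentiability of the solution at \<open>a\<close>.\<close>

lemma os_functional_differentiable:
  fixes \<Lambda> :: "(real \<Rightarrow> complex) \<Rightarrow> (real \<Rightarrow> complex) \<Rightarrow> (real \<Rightarrow> complex) \<Rightarrow> complex"
  assumes ne: "\<not> os_eig \<epsilon> a" and \<epsilon>: "\<epsilon> > 0" and f: "continuous_on {0..1} f" and "r > 0"
    and sol: "\<And>z. cmod (z - a) < r \<Longrightarrow> os \<epsilon> z f (\<phi> z) (\<phi>1 z) (\<omega> z) (\<omega>1 z) \<and> no_slip (\<phi> z) (\<phi>1 z)"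
    and lin: "\<And>p p1 s p' p1' s' k. \<lbrakk>continuous_on {0..1} p; continuous_on {0..1} p1; continuous_on {0..1} s;
       continuous_on {0..1} p'; continuous_on {0..1} p1'; continuous_on {0..1} s'\<rbrakk> \<Longrightarrow>
       \<Lambda> (\<lambda>y. p y + k * p' y) (\<lambda>y. p1 y + k * p1' y) (\<lambda>y. s y + k * s' y) = \<Lambda> p p1 s + k * \<Lambda> p' p1' s'"
    and bd: "\<And>p p1 s. \<lbrakk>continuous_on {0..1} p; continuous_on {0..1} p1; continuous_on {0..1} s\<rbrakk> \<Longrightarrow>
       cmod (\<Lambda> p p1 s) \<le> L * (L2 p + L2 p1 + L2 s)" and L: "L \<ge> 0"
  shows "\<exists>d. ((\<lambda>z. \<Lambda> (\<phi> z) (\<phi>1 z) (\<omega> z)) has_field_derivative d) (at a)"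
proof -
  obtain K where K: "K \<ge> 0" and ex: "\<And>f. continuous_on {0..1} f \<Longrightarrow> \<exists>\<phi> \<phi>1 \<omega> \<omega>1. os \<epsilon> a f \<phi> \<phi>1 \<omega> \<omega>1 \<and> no_slip \<phi> \<phi>1 \<and>
     L2 \<phi> \<le> K * L2 f \<and> L2 \<phi>1 \<le> K * L2 f \<and> L2 \<omega> \<le> K * L2 f"
    using os_solvable[OF ne \<epsilon>] by blast
  \<comment> \<open>\<open>os_solvable\<close> bounds some solution; by uniqueness the bound holds
    for every one, in particular for differences of given solutions.\<close>
  have le: "L2 p \<le> K * L2 g \<and> L2 p1 \<le> K * L2 g \<and> L2 s \<le> K * L2 g"
    if os: "os \<epsilon> a g p p1 s s1" and ns: "no_slip p p1" and g: "continuous_on {0..1} g" for g p p1 s s1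
  proof -
    obtain p' p1' s' s1' where *: "os \<epsilon> a g p' p1' s' s1'" "no_slip p' p1'"
     "L2 p' \<le> K * L2 g" "L2 p1' \<le> K * L2 g" "L2 s' \<le> K * L2 g" using ex[OF g] by blast
    have "L2 p = L2 p'" "L2 p1 = L2 p1'" "L2 s = L2 s'"
      using os_unique[OF ne os *(1) ns *(2)] by (auto intro!: L2_cong)
    then show ?thesis using * by simp
  qed
  have sola: "os \<epsilon> a f (\<phi> a) (\<phi>1 a) (\<omega> a) (\<omega>1 a)" "no_slip (\<phi> a) (\<phi>1 a)" using sol[of a] \<open>r > 0\<close> by auto
  note ca = os_continuous[OF sola(1)]
  have wc: "continuous_on {0..1} (\<lambda>y. - \<omega> a y)" using ca by (intro continuous_intros)
  \<comment> \<open>The candidate derivative: differentiating - (U - c) \<omega> in c produces the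
    extra term \<omega>, which becomes the source - \<omega>.\<close>
  obtain x x1 t t1 where x: "os \<epsilon> a (\<lambda>y. - \<omega> a y) x x1 t t1" "no_slip x x1" using ex[OF wc] by blast
  note cx = os_continuous[OF x(1)]
  define F where "F = L2 f"
  have F: "F \<ge> 0" using L2_nonneg[OF f] by (simp add: F_def)
  \<comment> \<open>Ensures |h| K \<le> 1/2, so that the source term h \<omega> can be absorbed and
    L2 (\<omega> z) \<le> 2 K F holds uniformly near a.\<close>
  define r' where "r' = min r (1 / (2 * K + 1))"
  have r': "r' > 0" using \<open>r > 0\<close> K by (auto simp: r'_def)
  define C where "C = 6 * (L * (K * K * K * F))"
  have "cmod (\<Lambda> (\<phi> z) (\<phi>1 z) (\<omega> z) - \<Lambda> (\<phi> a) (\<phi>1 a) (\<omega> a) - (z - a) * \<Lambda> x x1 t) \<le> C * (cmod (z - a))^2"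
    if z: "cmod (z - a) < r'" for z
  proof -
    define h where "h = z - a"
    have hK: "cmod h * K \<le> 1 / 2"
    proof -
      have "cmod h * (2 * K + 1) \<le> 1" using z K by (simp add: h_def r'_def field_simps)
      moreover have "cmod h * (2 * K + 1) = 2 * (cmod h * K) + cmod h" by (simp add: algebra_simps)
      ultimately show ?thesis using norm_ge_zero[of h] by linarith
    qed
    have solz: "os \<epsilon> z f (\<phi> z) (\<phi>1 z) (\<omega> z) (\<omega>1 z)" "no_slip (\<phi> z) (\<phi>1 z)" using sol z by (auto simp: r'_def)
    note cz = os_continuous[OF solz(1)]
    have s1: "os \<epsilon> a (\<lambda>y. f y + (- h) * \<omega> z y) (\<phi> z) (\<phi>1 z) (\<omega> z) (\<omega>1 z)"
      using os_shift[OF solz(1), of a] by (simp add: h_def)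
    have c1: "continuous_on {0..1} (\<lambda>y. f y + (- h) * \<omega> z y)" by (intro continuous_intros f cz)
    have "L2 (\<lambda>y. f y + (- h) * \<omega> z y) \<le> F + cmod h * L2 (\<omega> z)"
    proof -
      have "continuous_on {0..1} (\<lambda>y. (- h) * \<omega> z y)" by (intro continuous_intros cz)
      from L2_add[OF f this] show ?thesis unfolding L2_cmult norm_minus_cancel F_def .
    qed
    then have "K * L2 (\<lambda>y. f y + (- h) * \<omega> z y) \<le> K * (F + cmod h * L2 (\<omega> z))"
      using K by (rule mult_left_mono)
    then have "L2 (\<omega> z) \<le> K * F + (cmod h * K) * L2 (\<omega> z)"
      using le[OF s1 solz(2) c1] by (simp add: algebra_simps)
    also have "(cmod h * K) * L2 (\<omega> z) \<le> 1 / 2 * L2 (\<omega> z)"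
      using hK L2_nonneg[OF cz(3)] by (rule mult_right_mono)
    finally have wz: "L2 (\<omega> z) \<le> 2 * (K * F)" by simp
    have s2: "os \<epsilon> a (\<lambda>y. (- h) * \<omega> z y) (\<lambda>y. \<phi> z y + (-1) * \<phi> a y) (\<lambda>y. \<phi>1 z y + (-1) * \<phi>1 a y)
        (\<lambda>y. \<omega> z y + (-1) * \<omega> a y) (\<lambda>y. \<omega>1 z y + (-1) * \<omega>1 a y)"
      using os_lincomb[OF s1 sola(1), of "-1"] by simp
    have c2: "continuous_on {0..1} (\<lambda>y. (- h) * \<omega> z y)" by (intro continuous_intros cz)
    note n2 = no_slip_lincomb[OF solz(2) sola(2), of "-1"]
    have "L2 (\<lambda>y. \<omega> z y + (-1) * \<omega> a y) \<le> K * (cmod h * L2 (\<omega> z))"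
      using le[OF s2 n2 c2] by (simp only: L2_cmult norm_minus_cancel)
    also have "\<dots> \<le> K * (cmod h * (2 * (K * F)))" using wz K by (intro mult_left_mono) auto
    finally have dw: "L2 (\<lambda>y. \<omega> z y + (-1) * \<omega> a y) \<le> K * (cmod h * (2 * (K * F)))" .
    have eq: "(\<lambda>y. (- h) * \<omega> z y + (- h) * (- \<omega> a y)) = (\<lambda>y. (- h) * (\<omega> z y + (-1) * \<omega> a y))"
      by (auto simp: algebra_simps)
    \<comment> \<open>The remainder after the linear term solves the problem at a with source - h
      (\<omega> z - \<omega> a), and \<omega> z - \<omega> a is itself of order h.\<close>
    note s3 = os_lincomb[OF s2 x(1), of "- h", unfolded eq]
    note n3 = no_slip_lincomb[OF n2 x(2), of "- h"]
    have c3: "continuous_on {0..1} (\<lambda>y. (- h) * (\<omega> z y + (-1) * \<omega> a y))" by (intro continuous_intros cz ca)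
    have "L2 (\<lambda>y. (- h) * (\<omega> z y + (-1) * \<omega> a y)) \<le> cmod h * (K * (cmod h * (2 * (K * F))))"
      unfolding L2_cmult norm_minus_cancel using dw by (rule mult_left_mono) simp
    then have Y: "K * L2 (\<lambda>y. (- h) * (\<omega> z y + (-1) * \<omega> a y)) \<le> K * (cmod h * (K * (cmod h * (2 * (K * F)))))"
      using K by (rule mult_left_mono)
    note c3' = os_continuous(1-3)[OF s3]
    have "\<Lambda> (\<phi> z) (\<phi>1 z) (\<omega> z) - \<Lambda> (\<phi> a) (\<phi>1 a) (\<omega> a) - h * \<Lambda> x x1 t
       = \<Lambda> (\<lambda>y. \<phi> z y + (-1) * \<phi> a y) (\<lambda>y. \<phi>1 z y + (-1) * \<phi>1 a y) (\<lambda>y. \<omega> z y + (-1) * \<omega> a y) + (- h) * \<Lambda> x x1 t"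
      by (simp only: lin[OF cz(1-3) ca(1-3), where k = "-1"]) simp
    also have "\<dots> = \<Lambda> (\<lambda>y. \<phi> z y + (-1) * \<phi> a y + (- h) * x y) (\<lambda>y. \<phi>1 z y + (-1) * \<phi>1 a y + (- h) * x1 y)
        (\<lambda>y. \<omega> z y + (-1) * \<omega> a y + (- h) * t y)"
      by (rule lin[OF os_continuous(1-3)[OF s2] cx(1-3), where k = "- h", symmetric])
    finally have id: "\<Lambda> (\<phi> z) (\<phi>1 z) (\<omega> z) - \<Lambda> (\<phi> a) (\<phi>1 a) (\<omega> a) - h * \<Lambda> x x1 t = \<dots>" .
    have "cmod (\<Lambda> (\<phi> z) (\<phi>1 z) (\<omega> z) - \<Lambda> (\<phi> a) (\<phi>1 a) (\<omega> a) - h * \<Lambda> x x1 t) \<le> L * (L2 (\<lambda>y. \<phi> z y + (-1) * \<phi> a y + (- h) * x y) + L2 (\<lambda>y. \<phi>1 z y + (-1) * \<phi>1 a y + (- h) * x1 y)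
        + L2 (\<lambda>y. \<omega> z y + (-1) * \<omega> a y + (- h) * t y))"
      unfolding id by (rule bd[OF c3'])
    also have "\<dots> \<le> L * (3 * (K * (cmod h * (K * (cmod h * (2 * (K * F)))))))"
    proof (rule mult_left_mono[OF _ L])
      have add3: "u \<le> X \<and> v \<le> X \<and> w \<le> X \<Longrightarrow> X \<le> Y \<Longrightarrow> u + v + w \<le> 3 * Y" for u v w X Y :: real
        by linarith
      show "L2 (\<lambda>y. \<phi> z y + (-1) * \<phi> a y + (- h) * x y) + L2 (\<lambda>y. \<phi>1 z y + (-1) * \<phi>1 a y + (- h) * x1 y)
        + L2 (\<lambda>y. \<omega> z y + (-1) * \<omega> a y + (- h) * t y) \<le> 3 * (K * (cmod h * (K * (cmod h * (2 * (K * F))))))"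
        by (rule add3[OF le[OF s3 n3 c3] Y])
    qed
    also have "\<dots> = C * (cmod h)^2" by (simp add: C_def power2_eq_square)
    finally show ?thesis by (simp only: h_def)
  qed
  then have "((\<lambda>z. \<Lambda> (\<phi> z) (\<phi>1 z) (\<omega> z)) has_field_derivative \<Lambda> x x1 t) (at a)"
    by (rule has_field_derivative_if_quadratic_remainder[OF r'])
  then show ?thesis by blast
qed

section \<open>Eigenvalues near a Rayleigh mode\<close>

lemma bform_lincomb:
  assumes "continuous_on {0..1} p" "continuous_on {0..1} p1" "continuous_on {0..1} p'" "continuous_on {0..1} p1'"
    "continuous_on {0..1} e" "continuous_on {0..1} e1"
  shows "bform c (\<lambda>y. p y + k * p' y) (\<lambda>y. p1 y + k * p1' y) e e1 = bform c p p1 e e1 + k * bform c p' p1' e e1"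
proof -
  define T where "T q q1 = (\<lambda>y. of_real (U2 y) * q y * e y + of_real (U1 y) * q1 y * e y
      + of_real (\<alpha>^2) * (of_real (U y) - c) * q y * e y + (of_real (U y) - c) * q1 y * e1 y)" for q q1
  have T: "(T q q1 has_integral integral {0..1} (T q q1)) {0..1}"
    if q: "continuous_on {0..1} q" "continuous_on {0..1} q1" for q q1
    unfolding T_def by (rule integrable_integral[OF integrable01], intro continuous_intros q assms(5,6) U_continuous)
  have "((\<lambda>y. T p p1 y + k * T p' p1' y) has_integral (integral {0..1} (T p p1) + k * integral {0..1} (T p' p1'))) {0..1}"
    by (rule has_integral_add[OF T[OF assms(1,2)] has_integral_mult_right[OF T[OF assms(3,4)]]])
  moreover have "(\<lambda>y. T p p1 y + k * T p' p1' y) = T (\<lambda>y. p y + k * p' y) (\<lambda>y. p1 y + k * p1' y)"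
    by (auto simp: T_def algebra_simps)
  moreover have "bform c q q1 e e1 = integral {0..1} (T q q1)" for q q1 by (simp only: bform_def T_def)
  ultimately show ?thesis by (simp only: integral_unique)
qed

text \<open>At c0 itself the a priori estimate gives nothing, because \<open>D0 c0 = 0\<close>. This
  is why a scalar functional of the solution is carried analytically from the circle, where the
  estimate applies, to the centre.\<close>

lemma os_eig_near:
  assumes c0: "Im c0 > 0" and w: "ray c0 (\<lambda>_. 0) w w1" "w 0 = 0" "w 1 = 0" "\<exists>y\<in>{0..1}. w y \<noteq> 0" and r: "r > 0"
  shows "\<exists>\<epsilon>1>0. \<forall>\<epsilon>. 0 < \<epsilon> \<and> \<epsilon> < \<epsilon>1 \<longrightarrow> (\<exists>c. dist c c0 < r \<and> Im c > 0 \<and> os_eig \<epsilon> c)"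
proof -
  obtain r0 where r0: "r0 > 0" "\<And>z. z \<in> ball c0 r0 \<Longrightarrow> Im z > 0" "\<And>z. z \<in> ball c0 r0 - {c0} \<Longrightarrow> D0 z \<noteq> 0"
    using D0_isolated[OF c0 ray_D0[OF c0 w]] by metis
  define r1 where "r1 = min r r0"
  define \<rho> where "\<rho> = r1 / 2"
  have \<rho>: "\<rho> > 0" "\<rho> < r1" "r1 \<le> r" "r1 \<le> r0" using r r0 by (auto simp: r1_def \<rho>_def)
  have cb: "z \<in> ball c0 r0" if "z \<in> cball c0 \<rho>" for z using that \<rho> by auto
  obtain m where m: "m > 0" "\<And>z. z \<in> cball c0 \<rho> \<Longrightarrow> m \<le> Im z"
  proof -
    have "continuous_on (cball c0 \<rho>) Im" by (intro continuous_intros)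
    moreover have "cball c0 \<rho> \<noteq> {}" using \<rho> by simp
    ultimately obtain z0 where "z0 \<in> cball c0 \<rho>" "\<forall>z\<in>cball c0 \<rho>. Im z0 \<le> Im z"
      using continuous_attains_inf[of "cball c0 \<rho>" Im] compact_cball by metis
    then show thesis using that[of "Im z0"] r0(2) cb by auto
  qed
  obtain \<kappa> where \<kappa>: "\<kappa> > 0" "\<And>z. z \<in> sphere c0 \<rho> \<Longrightarrow> \<kappa> \<le> cmod (D0 z)"
  proof -
    have "continuous_on (sphere c0 \<rho>) D0"
      by (rule continuous_on_subset[OF holomorphic_on_imp_continuous_on[OF D0_holomorphic]]) (use r0(2) \<rho> in auto)
    then have "continuous_on (sphere c0 \<rho>) (\<lambda>z. cmod (D0 z))" by (intro continuous_intros)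
    moreover have "sphere c0 \<rho> \<noteq> {}" using \<rho> by simp
    ultimately obtain z0 where z0: "z0 \<in> sphere c0 \<rho>" "\<forall>z\<in>sphere c0 \<rho>. cmod (D0 z0) \<le> cmod (D0 z)"
      using continuous_attains_inf[of "sphere c0 \<rho>" "\<lambda>z. cmod (D0 z)"] by auto
    then have "D0 z0 \<noteq> 0" using r0(3)[of z0] \<rho> by auto
    then show thesis using that[of "cmod (D0 z0)"] z0 by auto
  qed
  define R where "R = cmod c0 + \<rho>"
  have R: "R \<ge> 0" "\<And>z. z \<in> cball c0 \<rho> \<Longrightarrow> cmod z \<le> R"
    using \<rho> by (auto simp: R_def dist_norm) (metis norm_triangle_sub add.commute add_left_mono norm_minus_commute order_trans)
  obtain \<epsilon>1 C where \<epsilon>1: "\<epsilon>1 > 0" and C: "C \<ge> 0" and apriori: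
    "\<And>\<epsilon> c f \<phi> \<phi>1 \<omega> \<omega>1. 0 < \<epsilon> \<Longrightarrow> \<epsilon> < \<epsilon>1 \<Longrightarrow> m \<le> Im c \<Longrightarrow> \<kappa> \<le> cmod (D0 c) \<Longrightarrow> cmod c \<le> R \<Longrightarrow>
     continuous_on {0..1} f \<Longrightarrow> os \<epsilon> c f \<phi> \<phi>1 \<omega> \<omega>1 \<Longrightarrow> no_slip \<phi> \<phi>1 \<Longrightarrow>
     L2 \<phi> \<le> C * L2 f \<and> L2 \<phi>1 \<le> C * L2 f \<and> sqrt \<epsilon> * L2 \<omega> \<le> C * L2 f"
    using apriori_estimate[OF m(1) \<kappa>(1) R(1)] by blast
  define \<psi> where "\<psi> y = w y * inverse (of_real (U y) - c0)" for y
  have wc: "continuous_on {0..1} w" "continuous_on {0..1} w1" using ray_continuous[OF w(1)] by auto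
  have \<psi>c: "continuous_on {0..1} \<psi>"
    unfolding \<psi>_def using U_minus_nz[OF c0] by (intro continuous_intros wc U_continuous) auto
  define n where "n = L2 \<psi>"
  have n: "n > 0"
  proof -
    obtain y where y: "y \<in> {0..1}" "w y \<noteq> 0" using w(4) by blast
    then have "\<psi> y \<noteq> 0" using U_minus_nz[OF c0] by (auto simp: \<psi>_def)
    then show ?thesis using L2_eq_0[OF \<psi>c _ y(1)] L2_nonneg[OF \<psi>c] by (auto simp: n_def less_le)
  qed
  obtain S where S: "S > 0" "\<forall>y\<in>{0..1}. cmod (w y) \<le> S \<and> cmod (w1 y) \<le> S"
  proof -
    obtain A where A: "A > 0" "\<And>y. y \<in> {0..1} \<Longrightarrow> cmod (w y) \<le> A" using bounded_continuous01[OF wc(1)] by metis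
    obtain B where B: "B > 0" "\<And>y. y \<in> {0..1} \<Longrightarrow> cmod (w1 y) \<le> B" using bounded_continuous01[OF wc(2)] by metis
    show thesis using A B by (intro that[of "max A B"]) (auto simp: le_max_iff_disj)
  qed
  define Kb where "Kb = 2 * M + (M + R) * (\<alpha>^2 + 1)"
  have Kb: "Kb > 0" using M R by (auto simp: Kb_def intro!: add_pos_nonneg)
  \<comment> \<open>The final inequality has to read n^2 \<le> n^2 / 2. The viscous term takes n^2 /
    4; the correctors contribute n \<eta> S at c0 and 4 Kb C n \<eta> S on the circle, which
    together are the other n^2 / 4.\<close>
  define \<eta> where "\<eta> = n / (4 * (S * (1 + 4 * (Kb * C))))"
  have p: "S * (1 + 4 * (Kb * C)) > 0" using S Kb C by (auto intro!: mult_pos_pos add_pos_nonneg)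
  have \<eta>: "\<eta> > 0" using n p by (simp add: \<eta>_def)
  have \<eta>S: "\<eta> * (S * (1 + 4 * (Kb * C))) = n / 4"
  proof -
    have "n / (4 * P) * P = n / 4" if "P > 0" for P using that by simp
    from this[OF p] show ?thesis unfolding \<eta>_def .
  qed
  have mc0: "m \<le> Im c0" using m \<rho> by auto
  have z: "continuous_on {0..1} (\<lambda>_. 0::complex)" by simp
  have L20: "L2 (\<lambda>_. 0) = 0" by (simp add: L2_def)
  obtain Ct v v1 v2 e e1 where Ct: "Ct \<ge> 0" and v: "deriv01 v v1" "deriv01 v1 v2" "continuous_on {0..1} v2"
       "v 0 = 0" "v 1 = 0" "v1 0 = 0" "v1 1 = 0"
      and e: "deriv01 e e1" "e 0 = 0" "e 1 = 0" "continuous_on {0..1} e1"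
      and ve: "\<forall>y\<in>{0..1}. v y = w y * inverse (of_real (U y) - c0) - e y"
      and vL: "L2 (\<lambda>y. v2 y - of_real (\<alpha>^2) * v y) \<le> Ct * S" and eL: "L2 e \<le> \<eta> * S" "L2 e1 \<le> \<eta> * S"
  proof -
    obtain Ct where Ct: "Ct \<ge> 0" and test: "\<And>c g w w1 S. m \<le> Im c \<Longrightarrow> ray c g w w1 \<Longrightarrow> continuous_on {0..1} g \<Longrightarrow>
      w 0 = 0 \<Longrightarrow> w 1 = 0 \<Longrightarrow> (\<forall>y\<in>{0..1}. cmod (w y) \<le> S \<and> cmod (w1 y) \<le> S) \<Longrightarrow>
      (\<exists>v v1 v2 e e1. deriv01 v v1 \<and> deriv01 v1 v2 \<and> continuous_on {0..1} v2 \<and>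
         v 0 = 0 \<and> v 1 = 0 \<and> v1 0 = 0 \<and> v1 1 = 0 \<and>
         deriv01 e e1 \<and> e 0 = 0 \<and> e 1 = 0 \<and> continuous_on {0..1} e1 \<and>
         (\<forall>y\<in>{0..1}. v y = w y * inverse (of_real (U y) - c) - e y) \<and>
         L2 (\<lambda>y. v2 y - of_real (\<alpha>^2) * v y) \<le> Ct * (S + L2 g) \<and> L2 e \<le> \<eta> * S \<and> L2 e1 \<le> \<eta> * S)"
      using test_functions[OF m(1) \<eta>] by blast
    show thesis using test[OF mc0 w(1) z w(2,3) S(2)] that[OF Ct] unfolding L20 add_0_right by blast
  qed
  note vc = deriv01_continuous[OF v(1)] deriv01_continuous[OF e(1)] v(3) e(4)
  define X where "X y = v2 y - of_real (\<alpha>^2) * v y" for y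
  have Xc: "continuous_on {0..1} X" unfolding X_def by (intro continuous_intros vc)
  have XL: "L2 X \<le> Ct * S" using vL by (simp add: X_def[abs_def])
  \<comment> \<open>With this source the integral of f \<psi> is n^2, while L2 f is only n.\<close>
  define f where "f y = cnj (\<psi> y)" for y
  have f: "continuous_on {0..1} f" unfolding f_def using \<psi>c by (intro continuous_intros)
  have fn: "L2 f = n" unfolding n_def by (rule L2_cong) (simp add: f_def)
  have "C * n * Ct * S / \<alpha> \<ge> 0" using C n Ct S \<alpha> by simp
  then obtain \<epsilon>2 where \<epsilon>2: "\<epsilon>2 > 0" "\<And>\<epsilon>. 0 < \<epsilon> \<Longrightarrow> \<epsilon> < \<epsilon>2 \<Longrightarrow> sqrt \<epsilon> * (C * n * Ct * S / \<alpha>) \<le> n^2 / 4"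
    using finite_times_small[of "C * n * Ct * S / \<alpha>" "n^2 / 4"] n by auto
  show ?thesis
  proof (intro exI[of _ "min \<epsilon>1 \<epsilon>2"] conjI allI impI)
    show "min \<epsilon>1 \<epsilon>2 > 0" using \<epsilon>1 \<epsilon>2 by simp
    fix \<epsilon> assume "0 < \<epsilon> \<and> \<epsilon> < min \<epsilon>1 \<epsilon>2"
    then have \<epsilon>: "0 < \<epsilon>" "\<epsilon> < \<epsilon>1" "\<epsilon> < \<epsilon>2" by auto
    show "\<exists>c. dist c c0 < r \<and> Im c > 0 \<and> os_eig \<epsilon> c"
    proof (rule ccontr)
      assume none: "\<not> ?thesis"
      have ne: "\<not> os_eig \<epsilon> c" if "c \<in> ball c0 r1" for c
        using none r0(2)[of c] that \<rho> by (auto simp: dist_commute)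
      have "\<exists>s. os \<epsilon> c f (fst s) (fst (snd s)) (fst (snd (snd s))) (snd (snd (snd s))) \<and> no_slip (fst s) (fst (snd s))"
        if c: "c \<in> ball c0 r1" for c
      proof -
        obtain \<phi> \<phi>1 \<omega> \<omega>1 where "os \<epsilon> c f \<phi> \<phi>1 \<omega> \<omega>1" "no_slip \<phi> \<phi>1"
          using os_solvable[OF ne[OF c] \<epsilon>(1)] f by blast
        then show ?thesis by (intro exI[of _ "(\<phi>, \<phi>1, \<omega>, \<omega>1)"]) simp
      qed
      then obtain s where s: "\<And>c. c \<in> ball c0 r1 \<Longrightarrow>
          os \<epsilon> c f (fst (s c)) (fst (snd (s c))) (fst (snd (snd (s c)))) (snd (snd (snd (s c)))) \<and> no_slip (fst (s c)) (fst (snd (s c)))"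
        by metis
      \<comment> \<open>The functional is built with c0 even when the solution belongs to another c:
        it must not depend on c for \<open>os_functional_differentiable\<close> to apply. The weak
        identity is used at c0 only.\<close>
      define \<Lambda> where "\<Lambda> p p1 q = \<delta> \<epsilon> * integral {0..1} (\<lambda>y. q y * X y) - bform c0 p p1 e e1" for p p1 q
      define F where "F c = \<Lambda> (fst (s c)) (fst (snd (s c))) (fst (snd (snd (s c))))" for c
      have bd: "cmod (\<Lambda> p p1 q) \<le> \<epsilon> / \<alpha> * (L2 q * (Ct * S)) + Kb * ((L2 p + L2 p1) * (2 * (\<eta> * S)))"
        if "continuous_on {0..1} p" "continuous_on {0..1} p1" "continuous_on {0..1} q" for p p1 q
      proof -
        have "cmod (\<Lambda> p p1 q) \<le> cmod (\<delta> \<epsilon> * integral {0..1} (\<lambda>y. q y * X y)) + cmod (bform c0 p p1 e e1)"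
          unfolding \<Lambda>_def by (rule norm_triangle_ineq4)
        also have "cmod (\<delta> \<epsilon> * integral {0..1} (\<lambda>y. q y * X y)) \<le> \<epsilon> / \<alpha> * (L2 q * (Ct * S))"
        proof -
          have "cmod (integral {0..1} (\<lambda>y. q y * X y)) \<le> L2 q * L2 X" by (rule L2_Cauchy_Schwarz[OF that(3) Xc])
          also have "\<dots> \<le> L2 q * (Ct * S)" using XL L2_nonneg[OF that(3)] by (rule mult_left_mono)
          finally have "cmod (integral {0..1} (\<lambda>y. q y * X y)) \<le> L2 q * (Ct * S)" .
          then have "\<epsilon> / \<alpha> * cmod (integral {0..1} (\<lambda>y. q y * X y)) \<le> \<epsilon> / \<alpha> * (L2 q * (Ct * S))"
            using \<epsilon> \<alpha> by (intro mult_left_mono) auto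
          then show ?thesis unfolding norm_mult \<delta>(2) using \<epsilon> by simp
        qed
        also have "cmod (bform c0 p p1 e e1) \<le> Kb * ((L2 p + L2 p1) * (2 * (\<eta> * S)))"
        proof -
          have "cmod (bform c0 p p1 e e1) \<le> Kb * ((L2 p + L2 p1) * (L2 e + L2 e1))"
            unfolding Kb_def using \<rho> by (intro bform_le that vc R(2)) auto
          also have "\<dots> \<le> Kb * ((L2 p + L2 p1) * (2 * (\<eta> * S)))"
            using eL Kb L2_nonneg[OF that(1)] L2_nonneg[OF that(2)] by (intro mult_left_mono) auto
          finally show ?thesis .
        qed
        finally show ?thesis by simp
      qed
      define Lc where "Lc = \<epsilon> / \<alpha> * (Ct * S) + Kb * (2 * (\<eta> * S))"
      have Lc: "Lc \<ge> 0" using \<epsilon> \<alpha> Ct S Kb \<eta> by (simp add: Lc_def)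
      have bd': "cmod (\<Lambda> p p1 q) \<le> Lc * (L2 p + L2 p1 + L2 q)"
        if "continuous_on {0..1} p" "continuous_on {0..1} p1" "continuous_on {0..1} q" for p p1 q
      proof -
        have "0 \<le> \<epsilon> / \<alpha> * (Ct * S) * (L2 p + L2 p1)" "0 \<le> Kb * (2 * (\<eta> * S)) * L2 q"
          using \<epsilon> \<alpha> Ct S Kb \<eta> L2_nonneg[OF that(1)] L2_nonneg[OF that(2)] L2_nonneg[OF that(3)] by auto
        moreover have "Lc * (L2 p + L2 p1 + L2 q) = \<epsilon> / \<alpha> * (L2 q * (Ct * S)) + Kb * ((L2 p + L2 p1) * (2 * (\<eta> * S)))
            + \<epsilon> / \<alpha> * (Ct * S) * (L2 p + L2 p1) + Kb * (2 * (\<eta> * S)) * L2 q"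
          by (simp add: Lc_def algebra_simps add_divide_distrib)
        ultimately show ?thesis using bd[OF that] by linarith
      qed
      have lin: "\<Lambda> (\<lambda>y. p y + k * p' y) (\<lambda>y. p1 y + k * p1' y) (\<lambda>y. q y + k * q' y) = \<Lambda> p p1 q + k * \<Lambda> p' p1' q'"
        if "continuous_on {0..1} p" "continuous_on {0..1} p1" "continuous_on {0..1} q"
          "continuous_on {0..1} p'" "continuous_on {0..1} p1'" "continuous_on {0..1} q'" for p p1 q p' p1' q' k
      proof -
        have "((\<lambda>y. q y * X y + k * (q' y * X y)) has_integral (integral {0..1} (\<lambda>y. q y * X y) + k * integral {0..1} (\<lambda>y. q' y * X y))) {0..1}"
          by (intro has_integral_add has_integral_mult_right integrable_integral integrable01 continuous_intros that Xc)
        then have "integral {0..1} (\<lambda>y. (q y + k * q' y) * X y) = integral {0..1} (\<lambda>y. q y * X y) + k * integral {0..1} (\<lambda>y. q' y * X y)"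
          by (intro integral_unique) (simp add: algebra_simps)
        then show ?thesis unfolding \<Lambda>_def by (simp only: bform_lincomb[OF that(1,2,4,5) vc(2,4)]) (simp add: algebra_simps)
      qed
      have "\<exists>d. (F has_field_derivative d) (at a)" if a: "a \<in> ball c0 r1" for a
        unfolding F_def[abs_def]
      proof (rule os_functional_differentiable[OF ne[OF a] \<epsilon>(1) f, where r = "r1 - dist c0 a" and L = Lc and \<Lambda> = \<Lambda>
            and \<phi> = "\<lambda>z. fst (s z)" and ?\<phi>1.0 = "\<lambda>z. fst (snd (s z))" and \<omega> = "\<lambda>z. fst (snd (snd (s z)))"
            and ?\<omega>1.0 = "\<lambda>z. snd (snd (snd (s z)))"])
        show "r1 - dist c0 a > 0" using a by simp
        show "os \<epsilon> z f (fst (s z)) (fst (snd (s z))) (fst (snd (snd (s z)))) (snd (snd (snd (s z)))) \<and> no_slip (fst (s z)) (fst (snd (s z)))"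
          if "cmod (z - a) < r1 - dist c0 a" for z
        proof (rule s)
          have "dist c0 z \<le> dist c0 a + dist a z" by (rule dist_triangle)
          then show "z \<in> ball c0 r1" using that by (simp add: dist_norm norm_minus_commute)
        qed
      qed (assumption | rule lin bd' Lc)+
      then have holo: "F holomorphic_on ball c0 r1"
        unfolding holomorphic_on_def field_differentiable_def by (meson has_field_derivative_at_within)
      have sphere: "cmod (F c) \<le> n^2 / 4 + n * (4 * (Kb * C) * (\<eta> * S))" if c: "cmod (c0 - c) = \<rho>" for c
      proof -
        have c': "c \<in> ball c0 r1" "c \<in> cball c0 \<rho>" "c \<in> sphere c0 \<rho>" using c \<rho> by (auto simp: dist_norm)
        note o = s[OF c'(1), THEN conjunct1] and ns = s[OF c'(1), THEN conjunct2]
        define p where "p = fst (s c)"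
        define p1 where "p1 = fst (snd (s c))"
        define q' where "q' = fst (snd (snd (s c)))"
        have b: "L2 p \<le> C * n" "L2 p1 \<le> C * n" "sqrt \<epsilon> * L2 q' \<le> C * n"
          using apriori[OF \<epsilon>(1,2) m(2)[OF c'(2)] \<kappa>(2)[OF c'(3)] R(2)[OF c'(2)] f o ns]
          by (auto simp: p_def p1_def q'_def fn)
        have "cmod (F c) \<le> \<epsilon> / \<alpha> * (L2 q' * (Ct * S)) + Kb * ((L2 p + L2 p1) * (2 * (\<eta> * S)))"
          unfolding F_def p_def p1_def q'_def by (rule bd[OF os_continuous(1-3)[OF o]])
        also have "\<epsilon> / \<alpha> * (L2 q' * (Ct * S)) = (sqrt \<epsilon> * L2 q') * (sqrt \<epsilon> * (Ct * S / \<alpha>))"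
        proof -
          have "t * t / \<alpha> * (L2 q' * (Ct * S)) = (t * L2 q') * (t * (Ct * S / \<alpha>))" for t by simp
          from this[of "sqrt \<epsilon>"] show ?thesis using \<epsilon> by simp
        qed
        also have "\<dots> \<le> (C * n) * (sqrt \<epsilon> * (Ct * S / \<alpha>))"
          using b(3) \<epsilon> Ct S \<alpha> by (intro mult_right_mono) auto
        also have "\<dots> = sqrt \<epsilon> * (C * n * Ct * S / \<alpha>)" by simp
        also have "\<dots> \<le> n^2 / 4" by (rule \<epsilon>2(2)[OF \<epsilon>(1,3)])
        also have "Kb * ((L2 p + L2 p1) * (2 * (\<eta> * S))) \<le> Kb * ((C * n + C * n) * (2 * (\<eta> * S)))"
          using b Kb \<eta> S by (intro mult_left_mono mult_right_mono add_mono) auto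
        also have "\<dots> = n * (4 * (Kb * C) * (\<eta> * S))" by (simp add: algebra_simps)
        finally show ?thesis by simp
      qed
      \<comment> \<open>Cauchy's inequality of order 0 is the maximum principle: the bound passes
        from the circle to the centre.\<close>
      have "cmod ((deriv ^^ 0) F c0) \<le> fact 0 * (n^2 / 4 + n * (4 * (Kb * C) * (\<eta> * S))) / \<rho> ^ 0"
      proof (rule Cauchy_inequality)
        show "F holomorphic_on ball c0 \<rho>" using \<rho> by (intro holomorphic_on_subset[OF holo]) auto
        show "continuous_on (cball c0 \<rho>) F"
          using \<rho> by (intro continuous_on_subset[OF holomorphic_on_imp_continuous_on[OF holo]]) auto
      qed (use \<rho> sphere in auto)
      then have Fc0: "cmod (F c0) \<le> n^2 / 4 + n * (4 * (Kb * C) * (\<eta> * S))" by simp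
      have b0: "c0 \<in> ball c0 r1" using \<rho> by simp
      note o = s[OF b0, THEN conjunct1] and ns = s[OF b0, THEN conjunct2]
      \<comment> \<open>As w is a Rayleigh mode its source is 0, so the left-hand side vanishes and
        F c0 equals the integral of f v, where v = \<psi> - e.\<close>
      have "integral {0..1} (\<lambda>y. fst (s c0) y * 0) = integral {0..1} (\<lambda>y. f y * v y)
       - \<delta> \<epsilon> * integral {0..1} (\<lambda>y. fst (snd (snd (s c0))) y * (v2 y - of_real (\<alpha>^2) * v y)) + bform c0 (fst (s c0)) (fst (snd (s c0))) e e1"
        using ns by (intro weak_identity[OF o \<epsilon>(1) f _ _ w(1) c0 z w(2,3) v e ve]) (auto simp: no_slip_def)
      then have Fv: "F c0 = integral {0..1} (\<lambda>y. f y * v y)"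
        by (simp add: F_def \<Lambda>_def X_def algebra_simps)
      have "complex_of_real (n^2) = integral {0..1} (\<lambda>y. complex_of_real ((cmod (\<psi> y))^2))"
      proof -
        have "continuous_on {0..1} (\<lambda>y. (cmod (\<psi> y))^2)" by (intro continuous_intros \<psi>c)
        from integral_linear[OF integrable01[OF this] bounded_linear_of_real, where 'a1 = complex]
        show ?thesis unfolding n_def L2_square[OF \<psi>c] by (simp add: o_def)
      qed
      also have "\<dots> = integral {0..1} (\<lambda>y. f y * v y + f y * e y)"
      proof (rule integral_cong)
        fix y :: real assume y: "y \<in> {0..1}"
        have "v y + e y = \<psi> y" using ve y by (simp add: \<psi>_def)
        then have "f y * v y + f y * e y = cnj (\<psi> y) * \<psi> y" by (simp add: f_def flip: distrib_left)
        then show "complex_of_real ((cmod (\<psi> y))^2) = f y * v y + f y * e y"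
          by (simp add: mult.commute flip: complex_norm_square)
      qed
      also have "\<dots> = F c0 + integral {0..1} (\<lambda>y. f y * e y)"
        unfolding Fv by (intro integral_add integrable01 continuous_intros f vc)
      finally have "n^2 \<le> cmod (F c0) + cmod (integral {0..1} (\<lambda>y. f y * e y))"
        using norm_triangle_ineq[of "F c0" "integral {0..1} (\<lambda>y. f y * e y)"] by (metis norm_of_real abs_power2)
      also have "cmod (integral {0..1} (\<lambda>y. f y * e y)) \<le> n * (\<eta> * S)"
        by (rule order_trans[OF L2_Cauchy_Schwarz[OF f vc(2)]])
          (unfold fn, intro mult_left_mono eL less_imp_le[OF n])
      also note Fc0
      finally have "n^2 \<le> n^2 / 4 + n * (\<eta> * (S * (1 + 4 * (Kb * C))))" by (simp add: algebra_simps)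
      also have "\<dots> = n^2 / 2" unfolding \<eta>S by (simp add: power2_eq_square)
      finally show False using n by simp
    qed
  qed
qed

lemma D01_D01_U: "y \<in> {0..1} \<Longrightarrow> D01 (D01 U) y = U2 y"
  using D01_congruent[OF U1 deriv01_D01[OF U]] .

lemma rayleigh_eigenmode_ray:
  assumes "rayleigh_eigenmode U \<alpha> c" "Im c > 0"
  obtains w w1 where "ray c (\<lambda>_. 0) w w1" "w 0 = 0" "w 1 = 0" "\<exists>y\<in>{0..1}. w y \<noteq> 0"
proof -
  from assms(1)[unfolded rayleigh_eigenmode_def, THEN conjunct2]
  obtain \<phi> where \<phi>: "C_k_01 2 \<phi> \<and> (\<exists>y\<in>{0..1}. \<phi> y \<noteq> 0) \<and> \<phi> 0 = 0 \<and> \<phi> 1 = 0 \<and>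
       (\<forall>y\<in>{0..1}. of_real (D01 (D01 U) y) * \<phi> y - (of_real (U y) - c) * helmholtz \<alpha> \<phi> y = 0)" ..
  note C = \<phi>[THEN conjunct1] and nz = \<phi>[THEN conjunct2, THEN conjunct1]
    and bc = \<phi>[THEN conjunct2, THEN conjunct2, THEN conjunct1]
      \<phi>[THEN conjunct2, THEN conjunct2, THEN conjunct2, THEN conjunct1]
  have eq: "of_real (D01 (D01 U) y) * \<phi> y - (of_real (U y) - c) * helmholtz \<alpha> \<phi> y = 0" if "y \<in> {0..1}" for y
    using \<phi>[THEN conjunct2, THEN conjunct2, THEN conjunct2, THEN conjunct2] that by (rule bspec)
  have "\<forall>j<2. (D01 ^^ j) \<phi> differentiable_on {0..1}" using C by (simp add: C_k_01_def)
  from this[rule_format, of 0] this[rule_format, of 1] have d: "deriv01 \<phi> (D01 \<phi>)" "deriv01 (D01 \<phi>) (D01 (D01 \<phi>))" by (simp_all add: deriv01_D01I)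
  have "q c y * \<phi> y - 0 = D01 (D01 \<phi>) y" if y: "y \<in> {0..1}" for y
  proof -
    have "of_real (U2 y) * \<phi> y = helmholtz \<alpha> \<phi> y * (of_real (U y) - c)"
      using eq[OF y] by (simp add: D01_D01_U[OF y] mult.commute)
    then have "of_real (U2 y) * \<phi> y / (of_real (U y) - c) = helmholtz \<alpha> \<phi> y"
      using U_minus_nz[OF assms(2)] by (intro nonzero_divide_eq_eq[THEN iffD2]) auto
    then show ?thesis by (simp add: q_def helmholtz_def distrib_right)
  qed
  then have "ray c (\<lambda>_. 0) \<phi> (D01 \<phi>)" unfolding ray_def by (intro conjI d(1) deriv01_cong[OF d(2) refl])
  then show thesis using bc nz by (rule that)
qed

text \<open>On [0,1] \<open>helmholtz\<close> maps \<phi> to \<omega>, and \<phi>'' = \<alpha>^2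
  \<phi> + \<omega> with a twice continuously differentiable \<omega> supplies the fourth
  derivative.\<close>

lemma os_eig_orr_sommerfeld:
  assumes "os_eig \<epsilon> c" and \<epsilon>: "\<epsilon> > 0"
  shows "orr_sommerfeld_eigenmode \<epsilon> U \<alpha> c"
proof -
  obtain \<phi> \<phi>1 \<omega> \<omega>1 where os: "os \<epsilon> c (\<lambda>_. 0) \<phi> \<phi>1 \<omega> \<omega>1" and ns: "no_slip \<phi> \<phi>1" and nz: "\<exists>y\<in>{0..1}. \<phi> y \<noteq> 0"
    using assms unfolding os_eig_def by blast
  define A where "A = complex_of_real (\<alpha>^2)"
  define \<omega>2 where "\<omega>2 y = os_rhs \<epsilon> c y 0 (\<phi> y) (\<omega> y)" for y
  define \<phi>2 where "\<phi>2 y = A * \<phi> y + \<omega> y" for y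
  define \<phi>3 where "\<phi>3 y = A * \<phi>1 y + \<omega>1 y" for y
  define \<phi>4 where "\<phi>4 y = A * \<phi>2 y + \<omega>2 y" for y
  have o: "deriv01 \<phi> \<phi>1" "deriv01 \<phi>1 \<phi>2" "deriv01 \<omega> \<omega>1" "deriv01 \<omega>1 \<omega>2"
    using os unfolding os_alt \<phi>2_def \<omega>2_def A_def by auto
  have d3: "deriv01 \<phi>2 \<phi>3" unfolding \<phi>2_def[abs_def] \<phi>3_def[abs_def] by (intro deriv01_add deriv01_cmult o)
  have d4: "deriv01 \<phi>3 \<phi>4" unfolding \<phi>3_def[abs_def] \<phi>4_def[abs_def] by (intro deriv01_add deriv01_cmult o)
  have c4: "continuous_on {0..1} \<phi>4"
    unfolding \<phi>4_def \<phi>2_def \<omega>2_def os_rhs_def using \<delta>(3) \<epsilon>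
    by (intro continuous_intros os_continuous[OF os] U_continuous) auto
  have e1: "D01 \<phi> y = \<phi>1 y" if "y \<in> {0..1}" for y using deriv01_D01[OF o(1) that] .
  have e2: "D01 (D01 \<phi>) y = \<phi>2 y" if "y \<in> {0..1}" for y using D01_congruent[OF o(2) e1 that] .
  have e3: "D01 (D01 (D01 \<phi>)) y = \<phi>3 y" if "y \<in> {0..1}" for y using D01_congruent[OF d3 e2 that] .
  have e4: "D01 (D01 (D01 (D01 \<phi>))) y = \<phi>4 y" if "y \<in> {0..1}" for y using D01_congruent[OF d4 e3 that] .
  have "C_k_01 4 \<phi>"
    unfolding C_k_01_def
  proof (intro conjI allI impI)
    fix j :: nat assume "j < 4"
    then consider "j = 0" | "j = 1" | "j = 2" | "j = 3" by linarith
    then show "(D01 ^^ j) \<phi> differentiable_on {0..1}"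
      using deriv01_differentiable[OF o(1)] deriv01_differentiable[OF deriv01_cong[OF o(2) e1 refl]]
        deriv01_differentiable[OF deriv01_cong[OF d3 e2 refl]] deriv01_differentiable[OF deriv01_cong[OF d4 e3 refl]]
      by cases (simp_all add: eval_nat_numeral)
  next
    show "continuous_on {0..1} ((D01 ^^ 4) \<phi>)"
      using continuous_on_eq[OF c4 e4[symmetric]] by (simp add: eval_nat_numeral)
  qed
  have h1: "helmholtz \<alpha> \<phi> y = \<omega> y" if "y \<in> {0..1}" for y
    using e2[OF that] by (simp add: helmholtz_def \<phi>2_def A_def)
  have "D01 (helmholtz \<alpha> \<phi>) y = \<omega>1 y" if "y \<in> {0..1}" for y using D01_congruent[OF o(3) h1 that] .
  then have "D01 (D01 (helmholtz \<alpha> \<phi>)) y = \<omega>2 y" if "y \<in> {0..1}" for y using D01_congruent[OF o(4) _ that] by blast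
  then have h2: "\<delta> \<epsilon> * helmholtz \<alpha> (helmholtz \<alpha> \<phi>) y = - of_real (U2 y) * \<phi> y + (of_real (U y) - c) * \<omega> y"
    if "y \<in> {0..1}" for y
    using that h1[OF that] \<delta>(3) \<epsilon> by (simp add: helmholtz_def[of _ "helmholtz \<alpha> \<phi>"] \<omega>2_def os_rhs_def)
  have "of_real \<epsilon> / (\<i> * of_real \<alpha>) * helmholtz \<alpha> (helmholtz \<alpha> \<phi>) y + of_real (D01 (D01 U) y) * \<phi> y
      - (of_real (U y) - c) * helmholtz \<alpha> \<phi> y = 0" if y: "y \<in> {0..1}" for y
    using h2[OF y, unfolded \<delta>_def] by (simp only: h1[OF y] D01_D01_U[OF y]) simp
  moreover have "\<phi> 0 = 0" "\<phi> 1 = 0" "D01 \<phi> 0 = 0" "D01 \<phi> 1 = 0" using ns e1 by (auto simp: no_slip_def)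
  ultimately show ?thesis unfolding orr_sommerfeld_eigenmode_def using \<alpha> \<open>C_k_01 4 \<phi>\<close> nz by blast
qed

lemma unstable_rayleigh_persists:
  assumes "unstable_rayleigh_eigenmode U \<alpha> c0"
  shows "\<exists>\<epsilon>0>0. \<exists>cstar. (\<forall>\<epsilon>. 0 < \<epsilon> \<and> \<epsilon> < \<epsilon>0 \<longrightarrow> unstable_orr_sommerfeld_eigenmode \<epsilon> U \<alpha> (cstar \<epsilon>)) \<and>
     (cstar \<longlongrightarrow> c0) (at_right 0)"
proof (rule nearby_selection[where E = "\<lambda>\<epsilon>. unstable_orr_sommerfeld_eigenmode \<epsilon> U \<alpha>"])
  have c0: "Im c0 > 0" "rayleigh_eigenmode U \<alpha> c0" using assms by (auto simp: unstable_rayleigh_eigenmode_def)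
  obtain w w1 where w: "ray c0 (\<lambda>_. 0) w w1" "w 0 = 0" "w 1 = 0" "\<exists>y\<in>{0..1}. w y \<noteq> 0"
    using rayleigh_eigenmode_ray[OF c0(2,1)] .
  fix r :: real assume "r > 0"
  from os_eig_near[OF c0(1) w this] obtain \<epsilon>1 where "\<epsilon>1 > 0"
    and near: "\<forall>\<epsilon>. 0 < \<epsilon> \<and> \<epsilon> < \<epsilon>1 \<longrightarrow> (\<exists>c. dist c c0 < r \<and> Im c > 0 \<and> os_eig \<epsilon> c)" by (elim exE conjE)
  have "\<exists>c. dist c c0 < r \<and> unstable_orr_sommerfeld_eigenmode \<epsilon> U \<alpha> c" if "0 < \<epsilon> \<and> \<epsilon> < \<epsilon>1" for \<epsilon>
  proof -
    from near[rule_format, OF that] obtain c where "dist c c0 < r" "Im c > 0" "os_eig \<epsilon> c" by (elim exE conjE)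
    then show ?thesis using os_eig_orr_sommerfeld that unfolding unstable_orr_sommerfeld_eigenmode_def by (intro exI[of _ c]) simp
  qed
  with \<open>\<epsilon>1 > 0\<close> show "\<exists>\<epsilon>1>0. \<forall>\<epsilon>. 0 < \<epsilon> \<and> \<epsilon> < \<epsilon>1 \<longrightarrow> (\<exists>c. dist c c0 < r \<and> unstable_orr_sommerfeld_eigenmode \<epsilon> U \<alpha> c)"
    by (intro exI[of _ \<epsilon>1] conjI allI impI)
qed

end

lemma shear_flow_shear_profile:
  assumes "\<alpha> > 0" "n \<ge> 1"
  shows "shear_flow (shear_profile A n) (\<lambda>y. 1 + 4 * pi * A * cos (4 * real n * pi * y))
     (\<lambda>y. - 16 * real n * pi\<^sup>2 * A * sin (4 * real n * pi * y)) \<alpha>"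
proof
  show "deriv01 (shear_profile A n) (\<lambda>y. 1 + 4 * pi * A * cos (4 * real n * pi * y))"
    unfolding shear_profile_def[abs_def]
    by (rule deriv01I) (use assms in \<open>auto intro!: derivative_eq_intros\<close>)
  show "deriv01 (\<lambda>y. 1 + 4 * pi * A * cos (4 * real n * pi * y)) (\<lambda>y. - 16 * real n * pi\<^sup>2 * A * sin (4 * real n * pi * y))"
    by (rule deriv01I) (auto intro!: derivative_eq_intros simp: power2_eq_square)
qed (use assms in \<open>auto intro!: continuous_intros\<close>)

theorem theorem4p1:
  fixes A \<alpha>n \<alpha>0 :: real and n :: nat and I :: "real set"
    and c :: "real \<Rightarrow> complex" and c0 :: complex
  assumes "1/2 * (1 / (4 * pi)) < A" and "A < 1 / (4 * pi)" and "n \<ge> 1"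
    and "\<alpha>n > 0"
    and "lowest_dirichlet_eigenvalue (rayleigh_potential (shear_profile A n) (1/2)) (- (\<alpha>n^2))"
    and "unstable_curve_stemming_from (shear_profile A n) \<alpha>n (1/2) I c"
    and "\<alpha>0 \<in> I" and "c0 = c \<alpha>0"
  shows "\<exists>\<epsilon>0>0. \<exists>cstar :: real \<Rightarrow> complex.
           (\<forall>\<epsilon>. 0 < \<epsilon> \<and> \<epsilon> < \<epsilon>0 \<longrightarrow>
              unstable_orr_sommerfeld_eigenmode \<epsilon> (shear_profile A n) \<alpha>0 (cstar \<epsilon>)) \<and>
           (cstar \<longlongrightarrow> c0) (at_right 0)"
proof -
  have "\<forall>\<alpha>\<in>I. unstable_rayleigh_eigenmode (shear_profile A n) \<alpha> (c \<alpha>)"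
    using assms(6) unfolding unstable_curve_stemming_from_def by (elim conjE)
  then have c0: "unstable_rayleigh_eigenmode (shear_profile A n) \<alpha>0 c0"
    using assms(7,8) by simp
  have "I \<subseteq> {0<..}" using assms(6) unfolding unstable_curve_stemming_from_def by (elim conjE)
  then have \<alpha>0: "\<alpha>0 > 0" using assms(7) by auto
  interpret shear_flow "shear_profile A n" "\<lambda>y. 1 + 4 * pi * A * cos (4 * real n * pi * y)"
    "\<lambda>y. - 16 * real n * pi\<^sup>2 * A * sin (4 * real n * pi * y)" \<alpha>0
    by (rule shear_flow_shear_profile[OF \<alpha>0 assms(3)])
  show ?thesis using unstable_rayleigh_persists[OF c0] .
qed

end
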